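(* Let $\varphi$ be a homogeneous polynomial of degree $2$ in $\mathbb{Q}[x_0,x_1,x_2]$, irreducible over $\mathbb{Q}$, whose set of zeros $\mathcal{C}$ in $\mathbb{P}^2(\mathbb{R})$ consists of at least two points. Let $\gamma=(1+\sqrt5)/2$. (i) For each point $\Xi\in\mathcal{C}$ having $\mathbb{Q}$-linearly independent homogeneous coordinates, if $1/\gamma$ is an exponent of approximation to $\Xi$, then it is a strict exponent of approximation to $\Xi$. (ii) There are infinitely many points $\Xi\in\mathcal{C}$ which have $\mathbb{Q}$-linearly independent homogeneous coordinates and for which $1/\gamma$ is an exponent of approximation. (iii) There exists $\epsilon>0$, independent of $\varphi$, such that the set of points $\Xi\in\mathcal{C}$ with $\lambda(\Xi)>1/\gamma-\epsilon$ is countable.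
   Context: Norms on $\mathbb{R}^m$ are maximum norms, and for $\underline{x},\underline{y}\in\mathbb{R}^3$, $\underline{x}\wedge\underline{y}$ is the usual cross product. Let $\Xi\in\mathbb{P}^2(\mathbb{R})$ with representative $\underline{\Xi}\in\mathbb{R}^3$. A real $\lambda\ge0$ is an exponent of approximation to $\Xi$ if there is a constant $c_1>0$ such that the conditions $\|\underline{x}\|\le X$, $\|\underline{x}\wedge\underline{\Xi}\|\le c_1X^{-\lambda}$ have a nonzero solution $\underline{x}\in\mathbb{Z}^3$ for each sufficiently large $X$; it is a strict exponent of approximation if moreover there is a constant $c_2>0$ such that these conditions with $c_1$ replaced by $c_2$ have no nonzero integer solution for arbitrarily large values of $X$. These notions do not depend on the choice of representative. $\lambda(\Xi)$ is the supremum of all exponents of approximation to $\Xi$. *)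

theory Defs
  imports
    "HOL-Analysis.Analysis"
    "HOL-Library.Poly_Mapping"
    "HOL-Computational_Algebra.Factorial_Ring"
begin

section \<open>Polynomials in three variables over the rationals\<close>

text \<open>
  The ring of polynomials in three variables over the rationals is the monoid algebra of the
  monomials \<open>3 \<Rightarrow>\<^sub>0 nat\<close> (exponent vectors). The index type \<open>3\<close> consists of
  \<open>0\<close>, \<open>1\<close>, \<open>2\<close>, where \<open>3 = 0\<close>; it is also the index type of \<open>real^3\<close>. The library's
  \<open>cross3\<close> lists the coordinates in the order 1, 2, 3 = 0, a cyclic shift of 0, 1, 2, so it
  agrees with the cross product taken in the latter order.
\<close>

type_synonym qpoly3 = "(3 \<Rightarrow>\<^sub>0 nat) \<Rightarrow>\<^sub>0 rat"

definition eval3 :: "qpoly3 \<Rightarrow> real^3 \<Rightarrow> real" where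
  "eval3 p v = (\<Sum>m\<in>Poly_Mapping.keys p.
      of_rat (Poly_Mapping.lookup p m) * (\<Prod>i\<in>UNIV. (v $ i) ^ Poly_Mapping.lookup m i))"

definition homogeneous3 :: "nat \<Rightarrow> qpoly3 \<Rightarrow> bool" where
  "homogeneous3 d p \<longleftrightarrow> p \<noteq> 0 \<and>
     (\<forall>m\<in>Poly_Mapping.keys p. (\<Sum>i\<in>UNIV. Poly_Mapping.lookup m i) = d)"

lemma eval3_scaleR:
  assumes "homogeneous3 d p"
  shows "eval3 p (c *\<^sub>R v) = c ^ d * eval3 p v"
proof -
  have "(\<Prod>i\<in>UNIV. ((c *\<^sub>R v) $ i) ^ Poly_Mapping.lookup m i)
      = c ^ d * (\<Prod>i\<in>UNIV. (v $ i) ^ Poly_Mapping.lookup m i)"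
    if "m \<in> Poly_Mapping.keys p" for m
  proof -
    have "(\<Prod>i\<in>UNIV. c ^ Poly_Mapping.lookup m i) = c ^ d"
      using assms that by (simp add: homogeneous3_def power_sum [symmetric])
    then show ?thesis
      by (simp add: power_mult_distrib prod.distrib)
  qed
  then show ?thesis
    unfolding eval3_def sum_distrib_left by (intro sum.cong refl) (simp add: mult_ac)
qed

section \<open>The real projective plane\<close>

text \<open>
  A point of the real projective plane is a line through the origin of \<open>real^3\<close>; its
  representatives are the nonzero vectors of that line.
\<close>

definition proj_plane :: "(real^3) set set" where
  "proj_plane = {L. subspace L \<and> dim L = 1}"

definition representative :: "real^3 \<Rightarrow> (real^3) set \<Rightarrow> bool" where
  "representative v P \<longleftrightarrow> P \<in> proj_plane \<and> v \<in> P \<and> v \<noteq> 0"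

lemma representative_exists:
  assumes "P \<in> proj_plane"
  shows "\<exists>v. representative v P"
proof -
  have "\<not> P \<subseteq> {0}"
    using assms dim_eq_0 [of P] by (auto simp: proj_plane_def)
  then show ?thesis
    using assms by (auto simp: representative_def)
qed

lemma representative_span:
  assumes "representative v P"
  shows "P = span {v}"
proof -
  have "subspace P" "dim P = 1" "v \<in> P" "v \<noteq> 0"
    using assms by (auto simp: representative_def proj_plane_def)
  then have "span {v} \<subseteq> P" "dim (span {v}) = dim P"
    using span_minimal [of "{v}" P] by (simp_all add: dim_span dim_singleton)
  then show ?thesis
    using subspace_dim_equal [of "span {v}" P] \<open>subspace P\<close> by auto
qed

lemma representative_proportional:
  assumes "representative v P" "representative w P"
  obtains c where "c \<noteq> 0" "w = c *\<^sub>R v"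
proof -
  have "w \<in> span {v}"
    using assms representative_span [OF assms(1)] by (simp add: representative_def)
  then obtain c where "w = c *\<^sub>R v"
    by (auto simp: span_singleton)
  moreover have "c \<noteq> 0"
    using assms(2) \<open>w = c *\<^sub>R v\<close> by (auto simp: representative_def)
  ultimately show thesis
    using that by blast
qed

definition zero_set :: "qpoly3 \<Rightarrow> (real^3) set set" where
  "zero_set p = {P \<in> proj_plane. \<exists>v. representative v P \<and> eval3 p v = 0}"

lemma zero_set_iff:
  assumes "homogeneous3 d p" "representative v P"
  shows "P \<in> zero_set p \<longleftrightarrow> eval3 p v = 0"
proof -
  have "eval3 p v = 0" if "representative w P" "eval3 p w = 0" for w
  proof -
    obtain c where "v = c *\<^sub>R w"
      using representative_proportional \<open>representative w P\<close> assms(2) by metis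
    then show ?thesis
      using eval3_scaleR [OF assms(1)] that by simp
  qed
  then show ?thesis
    using assms by (auto simp: zero_set_def representative_def)
qed

definition rat_indep_coords :: "(real^3) set \<Rightarrow> bool" where
  "rat_indep_coords P \<longleftrightarrow> (\<exists>v. representative v P \<and>
     (\<forall>a :: rat^3. (\<Sum>i\<in>UNIV. of_rat (a $ i) * v $ i) = 0 \<longrightarrow> a = 0))"

lemma rat_indep_coords_iff:
  assumes "representative v P"
  shows "rat_indep_coords P \<longleftrightarrow>
    (\<forall>a :: rat^3. (\<Sum>i\<in>UNIV. of_rat (a $ i) * v $ i) = 0 \<longrightarrow> a = 0)"
proof -
  have "(\<Sum>i\<in>UNIV. of_rat (a $ i) * w $ i) = 0"
    if w: "representative w P" and a: "(\<Sum>i\<in>UNIV. of_rat (a $ i) * v $ i) = 0" for w and a :: "rat^3"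
  proof -
    obtain c where "w = c *\<^sub>R v"
      using representative_proportional [OF assms w] by blast
    then have "(\<Sum>i\<in>UNIV. of_rat (a $ i) * w $ i) = c * (\<Sum>i\<in>UNIV. of_rat (a $ i) * v $ i)"
      by (simp add: sum_distrib_left mult_ac)
    then show ?thesis using a by simp
  qed
  then show ?thesis
    using assms unfolding rat_indep_coords_def by blast
qed

section \<open>Exponents of approximation\<close>

definition approx_solvable :: "real^3 \<Rightarrow> real \<Rightarrow> real \<Rightarrow> real \<Rightarrow> bool" where
  "approx_solvable v l c X \<longleftrightarrow> (\<exists>x :: real^3. x \<noteq> 0 \<and> (\<forall>i. x $ i \<in> \<int>) \<and>
     infnorm x \<le> X \<and> infnorm (cross3 x v) \<le> c * X powr (- l))"

definition approx_exponent :: "(real^3) set \<Rightarrow> real \<Rightarrow> bool" where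
  "approx_exponent P l \<longleftrightarrow> l \<ge> 0 \<and>
     (\<exists>v. representative v P \<and> (\<exists>c>0. \<forall>\<^sub>F X in at_top. approx_solvable v l c X))"

definition strict_approx_exponent :: "(real^3) set \<Rightarrow> real \<Rightarrow> bool" where
  "strict_approx_exponent P l \<longleftrightarrow> approx_exponent P l \<and>
     (\<exists>v. representative v P \<and> (\<exists>c>0. \<exists>\<^sub>F X in at_top. \<not> approx_solvable v l c X))"

text \<open>
  The supremum is taken in the extended reals: for a point with rational homogeneous
  coordinates every nonnegative real is an exponent.
\<close>

definition approx_lambda :: "(real^3) set \<Rightarrow> ereal" where
  "approx_lambda P = (SUP l\<in>{l. approx_exponent P l}. ereal l)"

lemma approx_solvable_scaleR:
  assumes "c \<noteq> 0"
  shows "approx_solvable (c *\<^sub>R v) l (\<bar>c\<bar> * d) X \<longleftrightarrow> approx_solvable v l d X"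
proof -
  have "cross3 x (c *\<^sub>R v) = c *\<^sub>R cross3 x v" for x
    by (simp add: cross_mult_right)
  then show ?thesis
    using assms by (simp add: approx_solvable_def infnorm_mul mult.assoc)
qed

lemma approx_exponent_iff:
  assumes "representative v P"
  shows "approx_exponent P l \<longleftrightarrow>
    l \<ge> 0 \<and> (\<exists>c>0. \<forall>\<^sub>F X in at_top. approx_solvable v l c X)"
proof -
  have "\<exists>c>0. \<forall>\<^sub>F X in at_top. approx_solvable v l c X"
    if w: "representative w P" and d: "d > 0" "\<forall>\<^sub>F X in at_top. approx_solvable w l d X" for w d
  proof -
    obtain c where "c \<noteq> 0" "v = c *\<^sub>R w"
      using representative_proportional [OF w assms] by blast
    then have "\<bar>c\<bar> * d > 0" "\<forall>\<^sub>F X in at_top. approx_solvable v l (\<bar>c\<bar> * d) X"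
      using d by (auto simp: approx_solvable_scaleR)
    then show ?thesis by blast
  qed
  then show ?thesis
    using assms unfolding approx_exponent_def by blast
qed

lemma strict_approx_exponent_iff:
  assumes "representative v P"
  shows "strict_approx_exponent P l \<longleftrightarrow>
    l \<ge> 0 \<and> (\<exists>c>0. \<forall>\<^sub>F X in at_top. approx_solvable v l c X) \<and>
    (\<exists>c>0. \<exists>\<^sub>F X in at_top. \<not> approx_solvable v l c X)"
proof -
  have "\<exists>c>0. \<exists>\<^sub>F X in at_top. \<not> approx_solvable v l c X"
    if w: "representative w P" and d: "d > 0" "\<exists>\<^sub>F X in at_top. \<not> approx_solvable w l d X" for w d
  proof -
    obtain c where "c \<noteq> 0" "v = c *\<^sub>R w"
      using representative_proportional [OF w assms] by blast
    then have "\<bar>c\<bar> * d > 0" "\<exists>\<^sub>F X in at_top. \<not> approx_solvable v l (\<bar>c\<bar> * d) X"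
      using d by (auto simp: approx_solvable_scaleR)
    then show ?thesis by blast
  qed
  then show ?thesis
    using assms unfolding strict_approx_exponent_def approx_exponent_iff [OF assms] by blast
qed

definition golden :: real where
  "golden = (1 + sqrt 5) / 2"

definition admissible_conic :: "qpoly3 \<Rightarrow> bool" where
  "admissible_conic p \<longleftrightarrow> homogeneous3 2 p \<and> irreducible p \<and>
     (\<exists>P\<in>zero_set p. \<exists>Q\<in>zero_set p. P \<noteq> Q)"

end

theory Submission
  imports Defs
begin

text \<open>
  Let \<open>B\<close> be the polar form of the polynomial and \<open>q x = B x x / 2\<close> its values. Among the minimal
  points \<open>x i\<close> of \<open>\<Xi>\<close> there are infinitely many turns: indices at which three consecutive ones are
  linearly independent. Their determinant bounds the next minimal point from below, the
  integrality of \<open>q (x i) \<noteq> 0\<close> bounds it from above. At the exponent \<open>1/golden\<close> these bounds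
  coincide up to constants, and a small constant in the approximation condition makes them
  contradict each other, which gives (i).

  For exponents close to \<open>1/golden\<close> the minimal points \<open>y k\<close> at the turns satisfy that \<open>y (k + 3)\<close>
  is proportional to \<open>psi (y (k + 2)) (y k)\<close>, where \<open>psi x y = B x y x - q x y\<close> is a multiple of the
  reflection in \<open>x\<close>: the determinants that measure the deviation have bounded denominators and
  tend to \<open>0\<close>. Three integral points therefore determine \<open>\<Xi>\<close>, which gives (iii). Conversely,
  running this recursion from three points of the same norm with integral inner products yields a
  point with exponent \<open>1/golden\<close>, and rational reflections move it to infinitely many others,
  which gives (ii).
\<close>

section \<open>Integral and rational vectors\<close>

text \<open>A rational point of the conic among the minimal points would carry no integrality
  information, as \<open>q\<close> vanishes there. In suitable coordinates such a point of a smooth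
  conic is a multiple of \<open>(a\<^sup>2, a * b, b\<^sup>2)\<close>, so its cross product with a
  nonparallel integral vector has norm at least of the order of the square root of its own norm.
  This excludes it once the exponent exceeds 1/2. In the ideal picture for the recursion the
  logarithm of the norm of \<open>y k\<close> is \<open>S k\<close> with
  \<open>S (k + 1) = golden * S k\<close>, and the distance is \<open>exp (- S k)\<close>. Since
  \<open>2 * S (k + 3) - S (k + 4) = S (k + 1)\<close>, the point
  \<open>psi (y (k + 3)) (y (k + 4))\<close> has about the norm and the distance of
  \<open>y (k + 1)\<close>. The relation is therefore proved backwards and then inverted; forwards,
  the bound for the distance of \<open>psi (y (k + 3)) (y (k + 1))\<close> is only
  \<open>exp (- S (k + 1))\<close>, far too large. In (ii) denominators must stay bounded although
  \<open>psi\<close> is quadratic in its first argument; a common norm \<alpha> and inner products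
  in integral multiples of \<alpha> make \<open>psi\<close> divided by \<alpha> integral in its
  coefficients.\<close>

definition ivec :: "real^3 \<Rightarrow> bool" where "ivec x \<longleftrightarrow> (\<forall>i. x $ i \<in> \<int>)"

definition rvec :: "real^3 \<Rightarrow> bool" where "rvec x \<longleftrightarrow> (\<forall>i. x $ i \<in> \<rat>)"

lemma rvec_0 [simp]: "rvec 0"
  by (simp add: rvec_def)

lemma ivec_imp_rvec: "ivec x \<Longrightarrow> rvec x"
  using Ints_subset_Rats by (auto simp: ivec_def rvec_def)

lemma ivec_diff: "ivec x \<Longrightarrow> ivec y \<Longrightarrow> ivec (x - y)"
  and ivec_scaleR: "c \<in> \<int> \<Longrightarrow> ivec x \<Longrightarrow> ivec (c *\<^sub>R x)"
  by (simp_all add: ivec_def)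

lemma rvec_add: "rvec x \<Longrightarrow> rvec y \<Longrightarrow> rvec (x + y)"
  and rvec_diff: "rvec x \<Longrightarrow> rvec y \<Longrightarrow> rvec (x - y)"
  and rvec_scaleR: "c \<in> \<rat> \<Longrightarrow> rvec x \<Longrightarrow> rvec (c *\<^sub>R x)"
  by (simp_all add: rvec_def)

lemma ivec_axis [simp]: "ivec (axis i 1)" and rvec_axis [simp]: "rvec (axis i 1)"
  by (simp_all add: ivec_def rvec_def axis_def)

lemma ivec_cross3: "ivec x \<Longrightarrow> ivec y \<Longrightarrow> ivec (cross3 x y)"
  by (simp add: ivec_def forall_3 cross_components)

lemma rvec_cross3: "rvec x \<Longrightarrow> rvec y \<Longrightarrow> rvec (cross3 x y)"
  by (simp add: rvec_def forall_3 cross_components)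

lemma ivec_inner: "ivec x \<Longrightarrow> ivec y \<Longrightarrow> x \<bullet> y \<in> \<int>"
  by (simp add: ivec_def inner_vec_def sum_3)

lemma rvec_inner: "rvec x \<Longrightarrow> rvec y \<Longrightarrow> x \<bullet> y \<in> \<rat>"
  by (simp add: rvec_def inner_vec_def sum_3)

lemma Ints_abs_ge_1: "x \<in> \<int> \<Longrightarrow> x \<noteq> 0 \<Longrightarrow> 1 \<le> \<bar>x\<bar>" for x :: real
  by (auto elim!: Ints_cases)

lemma ivec_norm_ge_1:
  assumes "ivec x" "x \<noteq> 0"
  shows "1 \<le> norm x"
proof -
  obtain i where "x $ i \<noteq> 0"
    using assms(2) by (auto simp: vec_eq_iff)
  then have "1 \<le> \<bar>x $ i\<bar>"
    using assms(1) Ints_abs_ge_1 by (auto simp: ivec_def)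
  then show ?thesis
    using component_le_norm_cart [of x i] by linarith
qed

lemma Rats_denominator:
  assumes "x \<in> \<rat>"
  obtains N :: nat where "N > 0" "real N * x \<in> \<int>"
proof -
  obtain a b :: int where "b > 0" "x = of_int a / of_int b"
    using assms Rats_cases' by blast
  then show thesis
    by (intro that [of "nat b"]) auto
qed

lemma rvec_denominator:
  assumes "rvec x"
  obtains N :: nat where "N > 0" "ivec (real N *\<^sub>R x)"
proof -
  have "\<forall>i. \<exists>N :: nat. N > 0 \<and> real N * x $ i \<in> \<int>"
    using assms Rats_denominator unfolding rvec_def by metis
  then obtain N :: "3 \<Rightarrow> nat" where N: "\<And>i. N i > 0" "\<And>i. real (N i) * x $ i \<in> \<int>"
    by metis
  have "real (N 1 * N 2 * N 3) * x $ i \<in> \<int>" for i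
  proof -
    have "real (N 1 * N 2 * N 3) * x $ i
      = (if i = 1 then real (N 2 * N 3) * (real (N 1) * x $ 1)
        else if i = 2 then real (N 1 * N 3) * (real (N 2) * x $ 2)
        else real (N 1 * N 2) * (real (N 3) * x $ 3))"
      using exhaust_3 [of i] by auto
    then show ?thesis
      using N(2) by (metis Ints_mult Ints_of_nat)
  qed
  then show thesis
    using N(1) by (intro that [of "N 1 * N 2 * N 3"]) (auto simp: ivec_def)
qed

lemma finite_ivec_bounded: "finite {x. ivec x \<and> norm x \<le> R}"
proof (rule finite_subset)
  let ?A = "real_of_int ` {-\<lceil>R\<rceil>..\<lceil>R\<rceil>}"
  show "finite (vec_lambda ` {f :: 3 \<Rightarrow> real. \<forall>i. f i \<in> ?A})"
    using finite_PiE [of "UNIV :: 3 set" "\<lambda>_. ?A"] by (auto simp: PiE_def Pi_def)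
  have "x $ i \<in> ?A" if "ivec x" "norm x \<le> R" for x i
  proof -
    obtain k where k: "x $ i = of_int k"
      using \<open>ivec x\<close> by (auto simp: ivec_def elim: Ints_cases)
    have "\<bar>x $ i\<bar> \<le> R"
      using component_le_norm_cart [of x i] that by linarith
    then have "k \<in> {-\<lceil>R\<rceil>..\<lceil>R\<rceil>}"
      unfolding k by (simp add: abs_le_iff) linarith
    then show ?thesis
      by (simp add: k)
  qed
  then show "{x. ivec x \<and> norm x \<le> R} \<subseteq> vec_lambda ` {f. \<forall>i. f i \<in> ?A}"
    by (auto intro!: image_eqI [where x = "vec_nth x" for x])
qed

lemma countable_rvec: "countable {x. rvec x}"
proof -
  have "countable ((\<lambda>(a, b, c). vector [a, b, c] :: real^3) ` (\<rat> \<times> \<rat> \<times> \<rat>))"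
    by (intro countable_image countable_SIGMA countable_rat)
  moreover have "{x. rvec x} \<subseteq> (\<lambda>(a, b, c). vector [a, b, c] :: real^3) ` (\<rat> \<times> \<rat> \<times> \<rat>)"
  proof
    fix x :: "real^3" assume "x \<in> {x. rvec x}"
    then show "x \<in> (\<lambda>(a, b, c). vector [a, b, c]) ` (\<rat> \<times> \<rat> \<times> \<rat>)"
      by (intro image_eqI [where x = "(x $ 1, x $ 2, x $ 3)"])
        (auto simp: rvec_def vec_eq_iff forall_3)
  qed
  ultimately show ?thesis
    by (rule countable_subset [rotated])
qed

text \<open>Exponents are defined by the maximum norm, the minimal points below by the Euclidean
  one, which has orthogonal projections; 2 is a convenient bound for \<open>sqrt 3\<close>.\<close>

lemma norm_le_2_infnorm: "norm x \<le> 2 * infnorm x" for x :: "real^3"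
proof -
  have "sqrt 3 \<le> 2"
    by (rule real_le_lsqrt) auto
  then have "sqrt 3 * infnorm x \<le> 2 * infnorm x"
    by (intro mult_right_mono infnorm_pos_le)
  then show ?thesis
    using norm_le_infnorm [of x] by simp
qed

lemma nat_cases_3:
  fixes n :: nat
  obtains "n = 0" | "n = 1" | "n = 2" | i where "n = i + 3"
proof -
  have "n = 0 \<or> n = 1 \<or> n = 2 \<or> n = (n - 3) + 3"
    by auto
  then show thesis
    using that by blast
qed

lemma square_mult_nonsquare:
  fixes b d :: int
  assumes "\<And>z. z\<^sup>2 \<noteq> b" "d \<noteq> 0"
  shows "z\<^sup>2 \<noteq> d\<^sup>2 * b"
proof
  assume z: "z\<^sup>2 = d\<^sup>2 * b"
  then have "d\<^sup>2 dvd z\<^sup>2"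
    by simp
  then have "d dvd z"
    by simp
  then obtain y where "z = d * y" ..
  then have "y\<^sup>2 = b"
    using z assms(2) by (simp add: power_mult_distrib)
  then show False
    using assms(1) by blast
qed

section \<open>Cross products and determinants\<close>

definition vol :: "real^3 \<Rightarrow> real^3 \<Rightarrow> real^3 \<Rightarrow> real" where
  "vol x y z = cross3 x y \<bullet> z"

lemma cross3_cross3_right: "cross3 a (cross3 x y) = (a \<bullet> y) *\<^sub>R x - (a \<bullet> x) *\<^sub>R y"
  by (simp add: cross3_simps forall_3)

lemma norm_cross3_le: "norm (cross3 x y) \<le> norm x * norm y"
proof -
  have "(norm (cross3 x y))\<^sup>2 \<le> (norm x * norm y)\<^sup>2"
    using norm_cross_dot [of x y] by (smt (verit) zero_le_power2)
  then show ?thesis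
    by (rule power2_le_imp_le) simp
qed

lemma abs_vol_le: "\<bar>vol x y z\<bar> \<le> norm x * norm y * norm z"
  unfolding vol_def using Cauchy_Schwarz_ineq2 [of "cross3 x y" z] norm_cross3_le [of x y]
  by (meson mult_right_mono norm_ge_zero order_trans)

lemma vol_rotate: "vol x y z = vol y z x" and vol_swap: "vol x y z = - vol y x z"
  by (simp_all add: vol_def cross3_simps)

lemma vol_refl [simp]: "vol x x z = 0" "vol x y x = 0" "vol x y y = 0"
  by (simp_all add: vol_def dot_cross_self)

lemma vol_combo:
  "vol (a *\<^sub>R x + b *\<^sub>R y) z w = a * vol x z w + b * vol y z w"
  "vol z (a *\<^sub>R x + b *\<^sub>R y) w = a * vol z x w + b * vol z y w"
  "vol z w (a *\<^sub>R x + b *\<^sub>R y) = a * vol z w x + b * vol z w y"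
  by (simp_all add: vol_def cross_add_left cross_add_right cross_mult_left cross_mult_right
      inner_add_left inner_add_right)

lemma ivec_vol: "ivec x \<Longrightarrow> ivec y \<Longrightarrow> ivec z \<Longrightarrow> vol x y z \<in> \<int>"
  by (simp add: vol_def ivec_inner ivec_cross3)

lemma rvec_vol: "rvec x \<Longrightarrow> rvec y \<Longrightarrow> rvec z \<Longrightarrow> vol x y z \<in> \<rat>"
  by (simp add: vol_def rvec_inner rvec_cross3)

text \<open>Cramer's rule with the denominator cleared.\<close>

lemma vol_expand:
  "vol x y z *\<^sub>R w = vol w y z *\<^sub>R x + vol x w z *\<^sub>R y + vol x y w *\<^sub>R z"
  by (simp add: vol_def cross3_simps forall_3)

lemma orthogonal_both_imp_cross3:
  assumes "a \<bullet> x = 0" "a \<bullet> y = 0" "cross3 x y \<noteq> 0"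
  obtains r where "a = r *\<^sub>R cross3 x y"
proof -
  have "cross3 (cross3 x y) a = 0"
    using cross3_cross3_right [of a x y] assms(1,2) cross_skew [of "cross3 x y" a] by simp
  then have "collinear {0, cross3 x y, a}"
    by (simp only: cross_eq_0)
  then show thesis
    using assms(3) that by (auto simp: collinear_lemma)
qed

lemma cross3_eq_0_iff_parallel:
  assumes "x \<noteq> 0"
  shows "cross3 x y = 0 \<longleftrightarrow> (\<exists>r. y = r *\<^sub>R x)"
  using assms by (auto simp: cross_eq_0 collinear_lemma)

lemma vol_nonzero_imp_cross3:
  assumes "vol x y z \<noteq> 0"
  shows "cross3 x y \<noteq> 0" "cross3 y z \<noteq> 0" "cross3 x z \<noteq> 0"
  using assms vol_rotate [of x y z] vol_rotate [of z x y] cross_skew [of x z] by (auto simp: vol_def)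

section \<open>Distance to a unit direction\<close>

locale direction =
  fixes v :: "real^3"
  assumes norm_v [simp]: "norm v = 1"
begin

text \<open>As \<open>v\<close> is a unit vector, this is the Euclidean distance from
  \<open>x\<close> to the line spanned by \<open>v\<close>.\<close>

definition L :: "real^3 \<Rightarrow> real" where "L x = norm (cross3 x v)"

definition perp :: "real^3 \<Rightarrow> real^3" where "perp x = x - (x \<bullet> v) *\<^sub>R v"

lemma decompose: "x = (x \<bullet> v) *\<^sub>R v + perp x"
  by (simp add: perp_def)

lemma v_v [simp]: "v \<bullet> v = 1"
  using norm_v norm_eq_1 by blast

lemma norm_perp: "norm (perp x) = L x"
proof -
  have "(L x)\<^sup>2 = x \<bullet> x - (x \<bullet> v)\<^sup>2"
    using norm_cross_dot [of x v] by (simp add: L_def power2_norm_eq_inner)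
  also have "\<dots> = (norm (perp x))\<^sup>2"
    unfolding power2_norm_eq_inner perp_def
    by (simp add: inner_diff_left inner_diff_right inner_commute power2_eq_square)
  finally show ?thesis
    by (smt (verit) L_def norm_ge_zero power2_eq_iff_nonneg)
qed

lemma abs_inner_v_le: "\<bar>x \<bullet> v\<bar> \<le> norm x"
  using Cauchy_Schwarz_ineq2 [of x v] by simp

lemma L_nonneg [simp]: "0 \<le> L x" and L_le_norm: "L x \<le> norm x"
  using norm_cross3_le [of x v] by (simp_all add: L_def)

lemma L_scaleR: "L (r *\<^sub>R x) = \<bar>r\<bar> * L x"
  by (simp add: L_def cross_mult_left)

text \<open>Split both vectors along \<open>v\<close> and across it: the product of the two
  components along \<open>v\<close> vanishes. The product of the perpendicular parts is absorbed by
  \<open>L x \<le> norm x\<close>, hence the 2.\<close>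

lemma norm_cross3_le_L: "norm (cross3 x y) \<le> 2 * norm x * L y + norm y * L x"
proof -
  have "cross3 x y = cross3 ((x \<bullet> v) *\<^sub>R v + perp x) ((y \<bullet> v) *\<^sub>R v + perp y)"
    by (simp add: decompose [symmetric])
  also have "\<dots> = (x \<bullet> v) *\<^sub>R cross3 v (perp y) + (y \<bullet> v) *\<^sub>R cross3 (perp x) v
      + cross3 (perp x) (perp y)"
    by (simp add: cross_add_left cross_add_right cross_mult_left cross_mult_right)
  also have "norm \<dots> \<le> norm x * L y + norm y * L x + L x * L y"
  proof (intro norm_triangle_mono)
    show "norm ((x \<bullet> v) *\<^sub>R cross3 v (perp y)) \<le> norm x * L y"
      using abs_inner_v_le [of x] norm_cross3_le [of v "perp y"]
      by (simp add: norm_perp mult_mono)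
    show "norm ((y \<bullet> v) *\<^sub>R cross3 (perp x) v) \<le> norm y * L x"
      using abs_inner_v_le [of y] norm_cross3_le [of "perp x" v]
      by (simp add: norm_perp mult_mono)
    show "norm (cross3 (perp x) (perp y)) \<le> L x * L y"
      using norm_cross3_le [of "perp x" "perp y"] by (simp add: norm_perp)
  qed
  finally show ?thesis
    using mult_right_mono [OF L_le_norm [of x], of "L y"] by simp
qed

text \<open>In the expansion by the same splitting, a term with two components along
  \<open>v\<close> vanishes, so every surviving term has at least two factors
  \<open>L\<close>.\<close>

lemma abs_vol_le_L:
  "\<bar>vol x y z\<bar> \<le> 2 * norm x * L y * L z + norm y * L x * L z + norm z * L x * L y"
proof -
  define a b c p1 p2 p3 where "a = x \<bullet> v" and "b = y \<bullet> v" and "c = z \<bullet> v"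
    and "p1 = perp x" and "p2 = perp y" and "p3 = perp z"
  note defs = this
  have "vol x y z = vol (a *\<^sub>R v + 1 *\<^sub>R p1) (b *\<^sub>R v + 1 *\<^sub>R p2) (c *\<^sub>R v + 1 *\<^sub>R p3)"
    by (simp add: defs decompose [symmetric])
  then have eq: "vol x y z = a * vol v p2 p3 + b * vol p1 v p3 + c * vol p1 p2 v + vol p1 p2 p3"
    unfolding vol_combo by (simp add: algebra_simps)
  have "\<bar>a * vol v p2 p3\<bar> \<le> norm x * (L y * L z)"
    using abs_vol_le [of v p2 p3] abs_inner_v_le [of x]
    by (simp add: defs abs_mult norm_perp mult_mono)
  moreover have "\<bar>b * vol p1 v p3\<bar> \<le> norm y * (L x * L z)"
    using abs_vol_le [of p1 v p3] abs_inner_v_le [of y]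
    by (simp add: defs abs_mult norm_perp mult_mono)
  moreover have "\<bar>c * vol p1 p2 v\<bar> \<le> norm z * (L x * L y)"
    using abs_vol_le [of p1 p2 v] abs_inner_v_le [of z]
    by (simp add: defs abs_mult norm_perp mult_mono)
  moreover have "\<bar>vol p1 p2 p3\<bar> \<le> norm x * (L y * L z)"
    using abs_vol_le [of p1 p2 p3] mult_right_mono [OF L_le_norm [of x], of "L y * L z"]
    by (simp add: defs norm_perp mult.assoc)
  ultimately have "\<bar>vol x y z\<bar> \<le> norm x * (L y * L z) + norm y * (L x * L z)
      + norm z * (L x * L y) + norm x * (L y * L z)"
    unfolding eq by linarith
  then show ?thesis
    by (simp add: mult.assoc)
qed

text \<open>The triple product of \<open>n\<close>, \<open>x\<close> and \<open>v\<close> collapses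
  to a multiple of \<open>x\<close>. In use: a fixed plane containing arbitrarily long points at
  bounded distance from the line contains \<open>v\<close>.\<close>

lemma norm_inner_v_le:
  assumes "n \<bullet> x = 0"
  shows "norm x * \<bar>n \<bullet> v\<bar> \<le> norm n * L x"
proof -
  have "cross3 n (cross3 x v) = (n \<bullet> v) *\<^sub>R x"
    by (simp add: cross3_cross3_right assms)
  then show ?thesis
    using norm_cross3_le [of n "cross3 x v"] by (simp add: L_def mult.commute)
qed

end

section \<open>Minimal points\<close>

text \<open>Breaking ties in the norm by the distance makes the next minimal point the closest among
  all points of its own norm, as the induction constructing the sequence requires.\<close>

lemma (in direction) lexicographic_minimum:
  assumes "\<And>y. y \<in> S \<Longrightarrow> ivec y" "S \<noteq> {}"
  obtains y where "y \<in> S" "\<And>z. z \<in> S \<Longrightarrow> norm y < norm z \<or> norm y = norm z \<and> L y \<le> L z"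
proof -
  obtain y0 where "y0 \<in> S"
    using assms(2) by blast
  define F where "F = {y \<in> S. norm y \<le> norm y0}"
  have "finite F" "F \<noteq> {}"
    using finite_ivec_bounded [of "norm y0"] assms(1) \<open>y0 \<in> S\<close>
    by (auto simp: F_def elim: finite_subset [rotated])
  then obtain y1 where y1: "y1 \<in> F" "\<And>z. z \<in> F \<Longrightarrow> norm y1 \<le> norm z"
    using arg_min_if_finite [of F norm] by (metis not_le)
  define G where "G = {y \<in> F. norm y = norm y1}"
  have "finite G" "G \<noteq> {}"
    using \<open>finite F\<close> y1(1) by (auto simp: G_def)
  then obtain y where y: "y \<in> G" "\<And>z. z \<in> G \<Longrightarrow> L y \<le> L z"
    using arg_min_if_finite [of G L] by (metis not_le)
  show thesis
  proof (rule that)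
    show "y \<in> S"
      using y by (simp add: G_def F_def)
    fix z assume "z \<in> S"
    show "norm y < norm z \<or> norm y = norm z \<and> L y \<le> L z"
    proof (cases "z \<in> F")
      case True
      then show ?thesis
        using y1 y by (fastforce simp: G_def)
    next
      case False
      then show ?thesis
        using \<open>z \<in> S\<close> y(1) by (auto simp: G_def F_def)
    qed
  qed
qed

text \<open>The sequence of minimal points of Davenport and Schmidt, in the Euclidean norm.
  \<open>independent\<close> says that the coordinates of \<open>v\<close> are linearly independent
  over the rationals.\<close>

locale minimal_sequence = direction +
  fixes x :: "nat \<Rightarrow> real^3"
  assumes independent: "rvec a \<Longrightarrow> a \<bullet> v = 0 \<Longrightarrow> a = 0"
    and ivec_x: "ivec (x i)"
    and x_nonzero: "x i \<noteq> 0"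
    and norm_x_Suc: "norm (x i) < norm (x (Suc i))"
    and L_x_Suc: "L (x (Suc i)) < L (x i)"
    and x_minimal: "ivec y \<Longrightarrow> y \<noteq> 0 \<Longrightarrow> norm y < norm (x (Suc i)) \<Longrightarrow> L (x i) \<le> L y"

text \<open>Independence makes all distances positive: \<open>L y = 0\<close> would make
  \<open>v\<close> a multiple of \<open>y\<close>, and some \<open>cross3 y (axis k 1)\<close> would
  be a nonzero rational vector orthogonal to \<open>v\<close>. So every point can be beaten, and its
  successor is the lexicographic minimum of the points that beat it.\<close>

lemma (in direction) minimal_sequence_exists:
  assumes indep: "\<And>a. rvec a \<Longrightarrow> a \<bullet> v = 0 \<Longrightarrow> a = 0"
    and small: "\<And>\<epsilon>. \<epsilon> > 0 \<Longrightarrow> \<exists>x. ivec x \<and> x \<noteq> 0 \<and> L x < \<epsilon>"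
  shows "\<exists>x. minimal_sequence v x"
proof -
  \<comment> \<open>\<open>P\<close> also compares points of equal norm, which forces the norm of
    the successor to be strictly larger.\<close>
  define P where "P y \<longleftrightarrow> ivec y \<and> y \<noteq> 0 \<and>
      (\<forall>z. ivec z \<longrightarrow> z \<noteq> 0 \<longrightarrow> norm z \<le> norm y \<longrightarrow> L y \<le> L z)" for y
  define Q where "Q y y' \<longleftrightarrow> norm y < norm y' \<and> L y' < L y \<and>
      (\<forall>z. ivec z \<longrightarrow> z \<noteq> 0 \<longrightarrow> norm z < norm y' \<longrightarrow> L y \<le> L z)" for y y'
  have L_pos: "L y > 0" if y: "ivec y" "y \<noteq> 0" for y
  proof (rule ccontr)
    assume "\<not> L y > 0"
    then have "cross3 y v = 0"
      by (simp add: L_def)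
    then obtain r where r: "v = r *\<^sub>R y"
      using y by (auto simp: cross3_eq_0_iff_parallel)
    obtain k where k: "cross3 y (axis k 1) \<noteq> 0"
      using cross_basis_nonzero [OF y(2)] by blast
    moreover have "cross3 y (axis k 1) = 0"
      using y by (intro indep) (auto simp: r rvec_cross3 ivec_imp_rvec dot_cross_self)
    ultimately show False ..
  qed
  have "\<exists>f. \<forall>n. P (f n) \<and> Q (f n) (f (Suc n))"
  proof (rule dependent_nat_choice [where P = "\<lambda>_. P" and Q = "\<lambda>_. Q", simplified])
    have "axis 1 1 \<in> {y. ivec y \<and> y \<noteq> 0}"
      by (simp add: axis_eq_0_iff)
    then obtain y where "y \<in> {y. ivec y \<and> y \<noteq> 0}"
      "\<And>z. z \<in> {y. ivec y \<and> y \<noteq> 0} \<Longrightarrow> norm y < norm z \<or> norm y = norm z \<and> L y \<le> L z"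
      using lexicographic_minimum [of "{y. ivec y \<and> y \<noteq> 0}"] by blast
    then have "P y"
      unfolding P_def by force
    then show "\<exists>y. P y" ..
  next
    fix y assume y: "P y"
    let ?S = "{z. ivec z \<and> z \<noteq> 0 \<and> L z < L y}"
    have "?S \<noteq> {}"
      using small [of "L y"] L_pos y by (auto simp: P_def)
    then obtain z where z: "z \<in> ?S"
      "\<And>z'. z' \<in> ?S \<Longrightarrow> norm z < norm z' \<or> norm z = norm z' \<and> L z \<le> L z'"
      using lexicographic_minimum [of ?S] by blast
    have "norm y < norm z"
      using z(1) y by (force simp: P_def)
    moreover have "L z \<le> L z'" if "ivec z'" "z' \<noteq> 0" "norm z' \<le> norm z" for z'
      using z(1) z(2) [of z'] that by (cases "L z' < L y") auto
    moreover have "L y \<le> L z'" if "ivec z'" "z' \<noteq> 0" "norm z' < norm z" for z'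
      using z(2) [of z'] that by (cases "L z' < L y") auto
    ultimately show "\<exists>z. P z \<and> Q y z"
      using z(1) unfolding P_def Q_def by blast
  qed
  then obtain x where x: "\<And>n. P (x n)" "\<And>n. Q (x n) (x (Suc n))"
    by blast
  have "minimal_sequence v x"
    using x indep by unfold_locales (auto simp: P_def Q_def)
  then show ?thesis
    by blast
qed

lemma (in direction) small_if_solvable:
  assumes "\<forall>\<^sub>F X in at_top. approx_solvable v l c X" "l > 0" "\<epsilon> > 0"
  shows "\<exists>x. ivec x \<and> x \<noteq> 0 \<and> L x < \<epsilon>"
proof -
  have "((\<lambda>X. 2 * (c * X powr (-l))) \<longlongrightarrow> 2 * (c * 0)) at_top"
    using assms(2) by (intro tendsto_mult tendsto_const tendsto_neg_powr filterlim_ident) auto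
  then have "\<forall>\<^sub>F X in at_top. 2 * (c * X powr (-l)) < \<epsilon>"
    by (rule order_tendstoD) (use assms(3) in simp)
  then have "\<forall>\<^sub>F X in at_top. 2 * (c * X powr (-l)) < \<epsilon> \<and> approx_solvable v l c X"
    using assms(1) by (rule eventually_conj)
  then obtain X where X: "2 * (c * X powr (-l)) < \<epsilon>" "approx_solvable v l c X"
    using eventually_happens trivial_limit_at_top_linorder by blast
  then obtain x where x: "x \<noteq> 0" "ivec x" "infnorm (cross3 x v) \<le> c * X powr (-l)"
    by (auto simp: approx_solvable_def ivec_def)
  have "L x \<le> 2 * infnorm (cross3 x v)"
    unfolding L_def by (rule norm_le_2_infnorm)
  then show ?thesis
    using x X(1) by (intro exI [of _ x]) simp
qed

context minimal_sequence
begin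

lemma L_pos [simp]: "0 < L (x i)"
  using L_x_Suc [of i] L_nonneg [of "x (Suc i)"] by linarith

lemma norm_pos [simp]: "0 < norm (x i)"
  by (simp add: x_nonzero)

lemma norm_ge_1: "1 \<le> norm (x i)"
  by (intro ivec_norm_ge_1 ivec_x x_nonzero)

lemma norm_x_mono: "i < j \<Longrightarrow> norm (x i) < norm (x j)"
  using norm_x_Suc by (rule lift_Suc_mono_less)

lemma norm_x_mono': "i \<le> j \<Longrightarrow> norm (x i) \<le> norm (x j)"
  using norm_x_mono by (cases "i = j") (auto simp: le_less)

lemma L_x_antimono: "i < j \<Longrightarrow> L (x j) < L (x i)"
  using lift_Suc_mono_less [of "\<lambda>i. - L (x i)" i j] L_x_Suc by simp

lemma norm_x_at_top: "filterlim (\<lambda>i. norm (x i)) at_top sequentially"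
  unfolding filterlim_at_top
proof
  fix R :: real
  have "inj x"
    using norm_x_mono by (metis injI linorder_neqE_nat less_irrefl)
  moreover have "finite {y. ivec y \<and> norm y \<le> R}"
    by (rule finite_ivec_bounded)
  ultimately have "finite (x -` {y. ivec y \<and> norm y \<le> R})"
    by (intro finite_vimageI)
  then have "finite {i. \<not> R \<le> norm (x i)}"
    by (rule finite_subset [rotated]) (auto simp: ivec_x)
  then show "\<forall>\<^sub>F i in sequentially. R \<le> norm (x i)"
    by (simp add: cofinite_eq_sequentially [symmetric] eventually_cofinite)
qed

text \<open>Norm and distance scale by the same factor, but from \<open>x i\<close> to
  \<open>x j\<close> one grows and the other shrinks.\<close>

lemma cross3_x_nonzero:
  assumes "i < j"
  shows "cross3 (x i) (x j) \<noteq> 0"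
proof
  assume "cross3 (x i) (x j) = 0"
  then obtain r where r: "x j = r *\<^sub>R x i"
    using x_nonzero by (auto simp: cross3_eq_0_iff_parallel)
  have "norm (x i) < \<bar>r\<bar> * norm (x i)" "\<bar>r\<bar> * L (x i) < L (x i)"
    using norm_x_mono [OF assms] L_x_antimono [OF assms] by (simp_all add: r L_scaleR)
  then show False
    using L_pos norm_pos by (smt (verit) mult_le_cancel_right1)
qed

section \<open>Planes of consecutive minimal points, and turns\<close>

definition normal :: "nat \<Rightarrow> real^3" where "normal i = cross3 (x i) (x (Suc i))"

lemma normal_nonzero: "normal i \<noteq> 0"
  by (simp add: normal_def cross3_x_nonzero)

lemma normal_orthogonal: "normal i \<bullet> x i = 0" "normal i \<bullet> x (Suc i) = 0"
  by (simp_all add: normal_def dot_cross_self)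

lemma ivec_normal: "ivec (normal i)"
  by (simp add: normal_def ivec_cross3 ivec_x)

lemma orthogonal_imp_normal:
  assumes "a \<bullet> x i = 0" "a \<bullet> x (Suc i) = 0" "a \<noteq> 0"
  obtains r where "r \<noteq> 0" "a = r *\<^sub>R normal i"
  using orthogonal_both_imp_cross3 [OF assms(1,2)] normal_nonzero assms(3)
  unfolding normal_def by (metis scale_eq_0_iff)

lemma norm_normal_le: "norm (normal i) \<le> 3 * norm (x (Suc i)) * L (x i)"
proof -
  have "norm (x i) * L (x (Suc i)) \<le> norm (x (Suc i)) * L (x i)"
    using norm_x_Suc [of i] L_x_Suc [of i] by (intro mult_mono) auto
  then show ?thesis
    using norm_cross3_le_L [of "x i" "x (Suc i)"] by (simp add: normal_def)
qed

definition turn :: "nat \<Rightarrow> bool" where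
  "turn p \<longleftrightarrow> p > 0 \<and> vol (x (p - 1)) (x p) (x (Suc p)) \<noteq> 0"

text \<open>A nonzero integral determinant is at least 1 in absolute value; in
  \<open>abs_vol_le_L\<close> each of the 2 + 1 + 1 terms is at most the longest norm times the two
  largest distances.\<close>

lemma turn_vol_bound:
  assumes "turn p"
  shows "1 \<le> 4 * norm (x (Suc p)) * L (x p) * L (x (p - 1))"
proof -
  let ?a = "x (p - 1)" and ?b = "x p" and ?c = "x (Suc p)"
  have less: "p - 1 < p" "p < Suc p" "p - 1 < Suc p"
    using assms by (auto simp: turn_def)
  have mono: "norm ?a \<le> norm ?c" "norm ?b \<le> norm ?c" "L ?c \<le> L ?b" "L ?b \<le> L ?a" "L ?c \<le> L ?a"
    using less norm_x_mono L_x_antimono by (auto intro: less_imp_le)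
  have "1 \<le> \<bar>vol ?a ?b ?c\<bar>"
    using assms by (intro Ints_abs_ge_1 ivec_vol ivec_x) (simp add: turn_def)
  moreover have "norm ?a * (L ?b * L ?c) \<le> norm ?c * (L ?b * L ?a)"
    using mono by (intro mult_mono) auto
  moreover have "norm ?b * (L ?c * L ?a) \<le> norm ?c * (L ?b * L ?a)"
    using mono by (intro mult_mono) auto
  ultimately show ?thesis
    using abs_vol_le_L [of ?a ?b ?c] by (simp only: mult_ac)
qed

text \<open>Without turns after \<open>N\<close> all later points would stay in the plane orthogonal
  to \<open>normal N\<close>. They are arbitrarily long and at bounded distance from the line, so
  this plane would contain \<open>v\<close>, against independence.\<close>

lemma infinite_turns: "infinite {p. turn p}"
proof
  assume "finite {p. turn p}"
  then obtain N where N: "\<And>p. p > N \<Longrightarrow> \<not> turn p"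
    by (metis finite_nat_set_iff_bounded mem_Collect_eq order_less_asym)
  have orth: "normal N \<bullet> x (N + k) = 0 \<and> normal N \<bullet> x (Suc (N + k)) = 0" for k
  proof (induction k)
    case (Suc k)
    obtain r where r: "r \<noteq> 0" "normal N = r *\<^sub>R normal (N + k)"
      using orthogonal_imp_normal Suc normal_nonzero by blast
    have "\<not> turn (Suc (N + k))"
      using N by simp
    then have "normal (N + k) \<bullet> x (Suc (Suc (N + k))) = 0"
      by (simp add: turn_def normal_def vol_def)
    then show ?case
      using Suc by (simp add: r)
  qed (simp add: normal_orthogonal)
  have "norm (x (N + k)) * \<bar>normal N \<bullet> v\<bar> \<le> norm (normal N) * L (x 0)" for k
  proof -
    have "L (x (N + k)) \<le> L (x 0)"
      using L_x_antimono [of 0 "N + k"] by (cases "N + k = 0") auto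
    then show ?thesis
      using norm_inner_v_le [of "normal N" "x (N + k)"] orth [of k]
      by (smt (verit) mult_left_mono norm_ge_zero)
  qed
  moreover have "normal N \<bullet> v \<noteq> 0"
    using independent [of "normal N"] normal_nonzero ivec_imp_rvec ivec_normal by blast
  ultimately have "norm (x (N + k)) \<le> norm (normal N) * L (x 0) / \<bar>normal N \<bullet> v\<bar>" for k
    by (simp add: pos_le_divide_eq)
  moreover obtain K where "\<And>n. n \<ge> K \<Longrightarrow> norm (x n) > norm (normal N) * L (x 0) / \<bar>normal N \<bullet> v\<bar>"
    using norm_x_at_top by (metis eventually_sequentially filterlim_at_top_dense)
  ultimately show False
    by (metis le_add2 not_le)
qed

text \<open>Consecutive points span the same plane until a turn is passed; the turning point
  \<open>r\<close> itself still lies in the old plane.\<close>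

lemma normal_between_turns:
  assumes "\<And>m. p < m \<Longrightarrow> m < r \<Longrightarrow> \<not> turn m" "p \<le> m" "m \<le> r"
  shows "normal p \<bullet> x m = 0"
proof -
  have "normal p \<bullet> x (p + k) = 0 \<and> (p + k < r \<longrightarrow> normal p \<bullet> x (Suc (p + k)) = 0)" if "p + k \<le> r" for k
    using that
  proof (induction k)
    case (Suc k)
    then have IH: "normal p \<bullet> x (p + k) = 0" "normal p \<bullet> x (Suc (p + k)) = 0"
      by auto
    then obtain t where t: "t \<noteq> 0" "normal p = t *\<^sub>R normal (p + k)"
      using orthogonal_imp_normal normal_nonzero by blast
    have "normal p \<bullet> x (Suc (p + Suc k)) = 0" if "p + Suc k < r"
    proof -
      have "\<not> turn (Suc (p + k))"
        using assms(1) that by simp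
      then have "normal (p + k) \<bullet> x (Suc (Suc (p + k))) = 0"
        by (simp add: turn_def normal_def vol_def)
      then show ?thesis
        by (simp add: t(2))
    qed
    then show ?case
      using IH by simp
  qed (simp add: normal_orthogonal)
  from this [of "m - p"] show ?thesis
    using assms by simp
qed

text \<open>The plane at \<open>p\<close> is the one spanned by the last two points up to
  \<open>r\<close>, and a turn means that the next point leaves it.\<close>

lemma normal_after_turn:
  assumes "turn r" "p < r" "\<And>m. p < m \<Longrightarrow> m < r \<Longrightarrow> \<not> turn m"
  shows "normal p \<bullet> x (Suc r) \<noteq> 0"
proof
  assume 0: "normal p \<bullet> x (Suc r) = 0"
  have "normal p \<bullet> x (r - 1) = 0" "normal p \<bullet> x (Suc (r - 1)) = 0"
    using normal_between_turns [of p r] assms by auto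
  then obtain t where "t \<noteq> 0" "normal p = t *\<^sub>R normal (r - 1)"
    using orthogonal_imp_normal normal_nonzero by blast
  then show False
    using 0 assms(1) by (simp add: turn_def normal_def vol_def)
qed

text \<open>The planes before and after the turn meet in the line of \<open>x r\<close>, so the
  cross product of their integral normals is a nonzero integral multiple of
  \<open>x r\<close>.\<close>

lemma norm_turn_le:
  assumes "turn r" "p < r" "\<And>m. p < m \<Longrightarrow> m < r \<Longrightarrow> \<not> turn m"
  shows "norm (x r) \<le> 9 * (norm (x (Suc p)) * L (x p)) * (norm (x (Suc r)) * L (x r))"
proof -
  have "cross3 (normal p) (normal r) = (normal p \<bullet> x (Suc r)) *\<^sub>R x r"
    using normal_between_turns [of p r r] assms by (simp add: normal_def [of r] cross3_cross3_right)
  then have "norm (cross3 (normal p) (normal r)) = \<bar>normal p \<bullet> x (Suc r)\<bar> * norm (x r)"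
    by simp
  moreover have "1 \<le> \<bar>normal p \<bullet> x (Suc r)\<bar>"
    using normal_after_turn [OF assms] by (intro Ints_abs_ge_1 ivec_inner ivec_normal ivec_x)
  ultimately have "norm (x r) \<le> norm (cross3 (normal p) (normal r))"
    using mult_right_mono [of 1 "\<bar>normal p \<bullet> x (Suc r)\<bar>" "norm (x r)"] by simp
  also have "\<dots> \<le> norm (normal p) * norm (normal r)"
    by (rule norm_cross3_le)
  also have "\<dots> \<le> (3 * norm (x (Suc p)) * L (x p)) * (3 * norm (x (Suc r)) * L (x r))"
    by (intro mult_mono norm_normal_le) auto
  finally show ?thesis
    by (simp add: mult_ac)
qed

text \<open>Dependence would put \<open>x s\<close> into the plane of \<open>x p\<close> and
  \<open>x r\<close>, and then the planes before and after the turn \<open>r\<close> would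
  coincide.\<close>

lemma vol_turns_nonzero:
  assumes "turn r" "p < r" "\<And>m. p < m \<Longrightarrow> m < r \<Longrightarrow> \<not> turn m"
    and "turn s" "r < s" "\<And>m. r < m \<Longrightarrow> m < s \<Longrightarrow> \<not> turn m"
  shows "vol (x p) (x r) (x s) \<noteq> 0"
proof
  assume "vol (x p) (x r) (x s) = 0"
  have pr: "normal p \<bullet> x p = 0" "normal p \<bullet> x r = 0"
    using normal_between_turns [of p r] assms by auto
  then obtain t where "normal p = t *\<^sub>R cross3 (x p) (x r)"
    using orthogonal_both_imp_cross3 cross3_x_nonzero assms by metis
  then have "normal p \<bullet> x s = 0"
    using \<open>vol (x p) (x r) (x s) = 0\<close> by (simp add: vol_def)
  then obtain t1 where t1: "normal p = t1 *\<^sub>R cross3 (x r) (x s)"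
    using orthogonal_both_imp_cross3 cross3_x_nonzero assms pr by metis
  have "normal r \<bullet> x r = 0" "normal r \<bullet> x s = 0"
    using normal_between_turns [of r s] assms by auto
  then obtain t2 where t2: "normal r = t2 *\<^sub>R cross3 (x r) (x s)"
    using orthogonal_both_imp_cross3 cross3_x_nonzero assms by metis
  then have "cross3 (x r) (x s) \<bullet> x (Suc r) = 0"
    using normal_orthogonal [of r] normal_nonzero [of r] by auto
  then show False
    using normal_after_turn [OF assms(1-3)] by (simp add: t1)
qed

text \<open>Solvability at half the norm of \<open>x (Suc i)\<close> gives a point of smaller
  Euclidean norm than \<open>x (Suc i)\<close>, because \<open>sqrt 3 < 2\<close>; minimality then
  bounds \<open>L (x i)\<close>. The 4 collects a 2 from comparing norms and
  \<open>2 powr l \<le> 2\<close> from the halving.\<close>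

lemma L_le_if_solvable:
  assumes "\<forall>\<^sub>F X in at_top. approx_solvable v l c X" "0 \<le> l" "l \<le> 1" "0 < c"
  shows "\<forall>\<^sub>F i in sequentially. L (x i) \<le> 4 * c * norm (x (Suc i)) powr (- l)"
proof -
  have "filterlim (\<lambda>i. norm (x (Suc i)) * (1 / 2)) at_top sequentially"
    using norm_x_at_top
    by (intro filterlim_at_top_mult_tendsto_pos [OF tendsto_const])
      (simp_all add: filterlim_sequentially_Suc [where f = "\<lambda>i. norm (x i)"])
  then have "filterlim (\<lambda>i. norm (x (Suc i)) / 2) at_top sequentially"
    by simp
  then have "\<forall>\<^sub>F i in sequentially. approx_solvable v l c (norm (x (Suc i)) / 2)"
    using assms(1) by (simp add: filterlim_iff)
  then show ?thesis
  proof (rule eventually_mono)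
    fix i
    let ?X = "norm (x (Suc i)) / 2"
    assume "approx_solvable v l c ?X"
    then obtain y where y: "y \<noteq> 0" "ivec y" "infnorm y \<le> ?X" "infnorm (cross3 y v) \<le> c * ?X powr (- l)"
      by (auto simp: approx_solvable_def ivec_def)
    have s: "sqrt 3 < 2"
      by (rule real_less_lsqrt) auto
    have "norm y \<le> sqrt 3 * infnorm y"
      using norm_le_infnorm [of y] by simp
    also have "\<dots> < 2 * infnorm y"
      using s y(1) infnorm_pos_lt [of y] by simp
    finally have "norm y < norm (x (Suc i))"
      using y(3) by simp
    then have "L (x i) \<le> L y"
      using y by (intro x_minimal)
    also have "\<dots> \<le> 2 * infnorm (cross3 y v)"
      unfolding L_def by (rule norm_le_2_infnorm)
    also have "\<dots> \<le> 2 * (c * ?X powr (- l))"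
      using y by simp
    also have "?X powr (- l) = norm (x (Suc i)) powr (- l) * 2 powr l"
      by (simp add: powr_divide powr_minus field_simps)
    also have "2 * (c * (norm (x (Suc i)) powr (- l) * 2 powr l))
      \<le> 2 * (c * (norm (x (Suc i)) powr (- l) * 2 powr 1))"
      using assms by (intro mult_left_mono powr_mono) auto
    finally show "L (x i) \<le> 4 * c * norm (x (Suc i)) powr (- l)"
      by (simp add: mult_ac)
  qed
qed

end

section \<open>Rational conics\<close>

locale rational_form =
  fixes B :: "real^3 \<Rightarrow> real^3 \<Rightarrow> real"
  assumes bilinear: "bilinear B"
    and sym: "B x y = B y x"
    and rational: "rvec x \<Longrightarrow> rvec y \<Longrightarrow> B x y \<in> \<rat>"
begin

definition q :: "real^3 \<Rightarrow> real" where "q x = B x x / 2"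

definition psi :: "real^3 \<Rightarrow> real^3 \<Rightarrow> real^3" where
  "psi x y = B x y *\<^sub>R x - q x *\<^sub>R y"

lemmas B_simps = bilinear_ladd [OF bilinear] bilinear_radd [OF bilinear]
  bilinear_lsub [OF bilinear] bilinear_rsub [OF bilinear]
  bilinear_lmul [OF bilinear] bilinear_rmul [OF bilinear]
  bilinear_lzero [OF bilinear] bilinear_rzero [OF bilinear]

lemma B_self: "B x x = 2 * q x"
  by (simp add: q_def)

lemma q_add: "q (x + y) = q x + B x y + q y"
  by (simp add: q_def B_simps sym [of y x] field_simps)

lemma q_scaleR: "q (c *\<^sub>R x) = c\<^sup>2 * q x"
  by (simp add: q_def B_simps power2_eq_square)

lemma q_0 [simp]: "q 0 = 0"
  by (simp add: q_def B_simps)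

lemma rational_q: "rvec x \<Longrightarrow> q x \<in> \<rat>"
  by (simp add: q_def rational)

lemma psi_scaleR: "psi (a *\<^sub>R x) (b *\<^sub>R y) = (a\<^sup>2 * b) *\<^sub>R psi x y"
  by (simp add: psi_def q_scaleR B_simps scaleR_diff_right power2_eq_square mult_ac)

text \<open>For \<open>q x \<noteq> 0\<close> the map \<open>psi x\<close> is \<open>- q x\<close>
  times the reflection in \<open>x\<close>, an involution.\<close>

lemma psi_psi: "psi x (psi x y) = (q x)\<^sup>2 *\<^sub>R y"
  unfolding psi_def
  by (simp add: B_simps B_self scaleR_diff_right scaleR_diff_left power2_eq_square algebra_simps)

lemma q_psi: "q (psi x y) = (q x)\<^sup>2 * q y"
  unfolding psi_def
  by (simp add: q_def B_simps sym [of y x] power2_eq_square algebra_simps)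

lemma linear_psi: "linear (psi x)"
  by (rule linearI) (simp_all add: psi_def B_simps algebra_simps)

lemma B_eq_inner: "B a x = (\<chi> i. B a (axis i 1)) \<bullet> x"
proof -
  have "x = x $ 1 *\<^sub>R axis 1 1 + x $ 2 *\<^sub>R axis 2 1 + x $ 3 *\<^sub>R axis 3 1"
    by (simp add: vec_eq_iff forall_3 axis_def)
  then have "B a x = B a (x $ 1 *\<^sub>R axis 1 1 + x $ 2 *\<^sub>R axis 2 1 + x $ 3 *\<^sub>R axis 3 1)"
    by simp
  then show ?thesis
    by (simp add: B_simps inner_vec_def sum_3)
qed

lemma rvec_gradient: "rvec a \<Longrightarrow> rvec (\<chi> i. B a (axis i 1))"
  by (simp add: rvec_def [of "vec_lambda _"] rational)

lemma common_denominator: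
  obtains N :: nat where "N > 0" "\<And>x y. ivec x \<Longrightarrow> ivec y \<Longrightarrow> real N * B x y \<in> \<int>"
    "\<And>x. ivec x \<Longrightarrow> real N * q x \<in> \<int>"
proof -
  have "\<exists>N :: nat. N > 0 \<and> ivec (real N *\<^sub>R (\<chi> j. B (axis i 1) (axis j 1)))" for i :: 3
    using rvec_denominator rvec_gradient [OF rvec_axis [of i]] by metis
  then obtain N :: "3 \<Rightarrow> nat" where N: "\<And>i. N i > 0"
    "\<And>i. ivec (real (N i) *\<^sub>R (\<chi> j. B (axis i 1) (axis j 1)))"
    by metis
  have int: "real (N 1 * N 2 * N 3) * B x y \<in> \<int>" if "ivec x" "ivec y" for x y
  proof -
    let ?r = "\<lambda>i. (real (N i) *\<^sub>R (\<chi> j. B (axis i 1) (axis j 1))) \<bullet> y"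
    have "x = x $ 1 *\<^sub>R axis 1 1 + x $ 2 *\<^sub>R axis 2 1 + x $ 3 *\<^sub>R axis 3 1"
      by (simp add: vec_eq_iff forall_3 axis_def)
    then have "B x y = B (x $ 1 *\<^sub>R axis 1 1 + x $ 2 *\<^sub>R axis 2 1 + x $ 3 *\<^sub>R axis 3 1) y"
      by simp
    then have B: "B x y = x $ 1 * B (axis 1 1) y + x $ 2 * B (axis 2 1) y + x $ 3 * B (axis 3 1) y"
      by (simp add: B_simps)
    have eq: "real (N 1 * N 2 * N 3) * B x y = real (N 2) * real (N 3) * x $ 1 * ?r 1
        + real (N 1) * real (N 3) * x $ 2 * ?r 2 + real (N 1) * real (N 2) * x $ 3 * ?r 3"
      unfolding B B_eq_inner [of "axis 1 1" y] B_eq_inner [of "axis 2 1" y]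
        B_eq_inner [of "axis 3 1" y] inner_scaleR_left
      by (simp add: algebra_simps)
    have "?r i \<in> \<int>" for i
      using N(2) that by (intro ivec_inner)
    moreover have "x $ i \<in> \<int>" for i
      using that by (simp add: ivec_def)
    ultimately show ?thesis
      unfolding eq by (intro Ints_add Ints_mult Ints_of_nat)
  qed
  show thesis
  \<comment> \<open>The 2 clears the half in the definition of \<open>q\<close>.\<close>
  proof (rule that [of "2 * (N 1 * N 2 * N 3)"])
    show "0 < 2 * (N 1 * N 2 * N 3)"
      using N(1) by simp
    show "real (2 * (N 1 * N 2 * N 3)) * B x y \<in> \<int>" if "ivec x" "ivec y" for x y
    proof -
      have "real (2 * (N 1 * N 2 * N 3)) * B x y = 2 * (real (N 1 * N 2 * N 3) * B x y)"
        by simp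
      then show ?thesis
        using Ints_mult [OF Ints_numeral int [OF that]] by metis
    qed
    show "real (2 * (N 1 * N 2 * N 3)) * q x \<in> \<int>" if "ivec x" for x
    proof -
      have "real (2 * (N 1 * N 2 * N 3)) * q x = real (N 1 * N 2 * N 3) * B x x"
        by (simp add: q_def)
      then show ?thesis
        using int [OF that that] by metis
    qed
  qed
qed

end

text \<open>Irreducibility enters only as the absence of a factorisation into rational linear forms;
  the factor 2 in \<open>B x x = 2 * q x\<close> is absorbed by one of them.\<close>

locale rational_conic = rational_form +
  assumes irred: "rvec a \<Longrightarrow> rvec b \<Longrightarrow> \<exists>x. B x x \<noteq> (a \<bullet> x) * (b \<bullet> x)"
    and two_zeros: "\<exists>v w. cross3 v w \<noteq> 0 \<and> q v = 0 \<and> q w = 0"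

section \<open>A gap between isotropic integral points and other integral points\<close>

text \<open>With \<open>x0 = g * u\<close>, \<open>x1 = g * w\<close> and \<open>u\<close>,
  \<open>w\<close> coprime, \<open>u * x2 = g * w\<^sup>2\<close> forces \<open>u\<close> to divide
  \<open>g\<close>; the quotient is \<open>m\<close>.\<close>

lemma square_parametrization:
  fixes x0 x1 x2 :: int
  assumes "x0 * x2 = x1\<^sup>2" "x0 \<noteq> 0 \<or> x2 \<noteq> 0"
  obtains m a b where "m \<noteq> 0" "x0 = m * a\<^sup>2" "x1 = m * a * b" "x2 = m * b\<^sup>2"
proof (cases "x0 = 0")
  case True
  then show thesis
    using assms by (intro that [of x2 0 1]) auto
next
  case False
  define g where "g = gcd x0 x1"
  obtain u w where uw: "x0 = g * u" "x1 = g * w" "coprime u w"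
    using gcd_coprime_exists [of x0 x1] False unfolding g_def by (metis gcd_eq_0_iff mult.commute)
  have g: "g \<noteq> 0"
    using False by (simp add: g_def)
  then have ux2: "u * x2 = g * w\<^sup>2"
    using assms(1) uw by (simp add: power2_eq_square algebra_simps)
  then have "u dvd g * w\<^sup>2"
    by (metis dvd_triv_left)
  then have "u dvd g"
    using uw(3) by (simp add: coprime_dvd_mult_left_iff)
  then obtain m where m: "g = u * m"
    by (elim dvdE)
  have "u \<noteq> 0"
    using False uw by auto
  then have "x2 = m * w\<^sup>2"
    using ux2 m by simp
  then show thesis
    using g m uw by (intro that [of m u w]) (auto simp: power2_eq_square mult_ac)
qed

text \<open>For the point \<open>m * (a\<^sup>2, a * b, b\<^sup>2)\<close> the minors are built from
  \<open>m * a\<close> and \<open>m * b\<close> times integers \<open>s\<close>, \<open>t\<close>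
  that are linear in the second point and not both 0. So \<open>m * a\<close> and
  \<open>m * b\<close> are bounded by \<open>M\<close>, and the coordinates by products of two such
  bounds.\<close>

lemma square_minors_bound:
  fixes x0 x1 x2 y0 y1 y2 M :: int
  assumes "x0 * x2 = x1\<^sup>2"
    and bounds: "\<bar>x0 * y1 - x1 * y0\<bar> \<le> M" "\<bar>x1 * y2 - x2 * y1\<bar> \<le> M" "\<bar>x0 * y2 - x2 * y0\<bar> \<le> M"
    and nonzero: "x0 * y1 - x1 * y0 \<noteq> 0 \<or> x1 * y2 - x2 * y1 \<noteq> 0 \<or> x0 * y2 - x2 * y0 \<noteq> 0"
  shows "\<bar>x0\<bar> \<le> M\<^sup>2" "\<bar>x1\<bar> \<le> M\<^sup>2" "\<bar>x2\<bar> \<le> M\<^sup>2"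
proof -
  have "x0 \<noteq> 0 \<or> x2 \<noteq> 0"
    using assms(1) nonzero by auto
  then obtain m a b where m: "m \<noteq> 0" and x: "x0 = m * a\<^sup>2" "x1 = m * a * b" "x2 = m * b\<^sup>2"
    using square_parametrization assms(1) by metis
  define s t where "s = a * y1 - b * y0" and "t = a * y2 - b * y1"
  have minors: "x0 * y1 - x1 * y0 = m * a * s" "x1 * y2 - x2 * y1 = m * b * t"
    "x0 * y2 - x2 * y0 = m * (a * t + b * s)"
    by (simp_all add: x s_def t_def power2_eq_square algebra_simps)
  have M: "\<bar>m * a * s\<bar> \<le> M" "\<bar>m * b * t\<bar> \<le> M" "\<bar>m * (a * t + b * s)\<bar> \<le> M"
    using bounds by (simp_all add: minors)
  have st: "s \<noteq> 0 \<or> t \<noteq> 0"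
    using nonzero by (auto simp: minors)
  have *: "\<bar>m * c\<bar> \<le> M" if "\<bar>m * c * r\<bar> \<le> M" "r \<noteq> 0" for c r
  proof -
    have "\<bar>m * c\<bar> * 1 \<le> \<bar>m * c\<bar> * \<bar>r\<bar>"
      using that by (intro mult_left_mono) auto
    then show ?thesis
      using that by (simp add: abs_mult)
  qed
  have "\<bar>m * a\<bar> \<le> M"
  proof (cases "s = 0")
    \<comment> \<open>Here the third minor reduces to \<open>m * a * t\<close>.\<close>
    case True
    then show ?thesis
      using * [of a t] M st by (simp add: mult.assoc)
  qed (use * [of a s] M in simp)
  moreover have "\<bar>m * b\<bar> \<le> M"
  proof (cases "t = 0")
    case True
    then show ?thesis
      using * [of b s] M st by (simp add: mult.assoc)
  qed (use * [of b t] M in simp)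
  moreover have "\<bar>m * c * d\<bar> \<le> M\<^sup>2" if "\<bar>m * c\<bar> \<le> M" "\<bar>m * d\<bar> \<le> M" for c d
  proof -
    have "\<bar>d\<bar> \<le> \<bar>m * d\<bar>"
      using m mult_right_mono [of 1 "\<bar>m\<bar>" "\<bar>d\<bar>"] by (simp add: abs_mult)
    then have "\<bar>m * c\<bar> * \<bar>d\<bar> \<le> M * M"
      using that by (intro mult_mono) auto
    then show ?thesis
      by (simp add: abs_mult power2_eq_square)
  qed
  ultimately show "\<bar>x0\<bar> \<le> M\<^sup>2" "\<bar>x1\<bar> \<le> M\<^sup>2" "\<bar>x2\<bar> \<le> M\<^sup>2"
    by (simp_all add: x power2_eq_square mult.assoc)
qed

lemma orthogonal_basis_imp_zero:
  assumes "vol a b c \<noteq> 0" "n \<bullet> a = 0" "n \<bullet> b = 0" "n \<bullet> c = 0"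
  shows "n = 0"
proof -
  have "vol a b c * (n \<bullet> n) = 0"
    using arg_cong [OF vol_expand [of a b c n], of "\<lambda>w. n \<bullet> w"] assms(2-4)
    by (simp add: inner_add_right)
  then show ?thesis
    using assms(1) by simp
qed

lemma dual_basis_expand:
  assumes "vol a b c \<noteq> 0"
  shows "w = (((1 / vol a b c) *\<^sub>R cross3 b c) \<bullet> w) *\<^sub>R a
    + (((1 / vol a b c) *\<^sub>R cross3 c a) \<bullet> w) *\<^sub>R b
    + (((1 / vol a b c) *\<^sub>R cross3 a b) \<bullet> w) *\<^sub>R c"
proof -
  have *: "vol a b c *\<^sub>R w = (cross3 b c \<bullet> w) *\<^sub>R a + (cross3 c a \<bullet> w) *\<^sub>R b + (cross3 a b \<bullet> w) *\<^sub>R c"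
    by (simp add: vol_def cross3_simps forall_3)
  have "w = (1 / vol a b c) *\<^sub>R (vol a b c *\<^sub>R w)"
    using assms by simp
  then show ?thesis
    unfolding * by (simp add: scaleR_add_right)
qed

text \<open>In the coordinates given by \<open>a\<close>, \<open>b\<close>, \<open>c\<close> the
  point \<open>x\<close> is quadratic in a shorter integral vector, so
  \<open>square_minors_bound\<close> controls it by the squared minors of \<open>x\<close> and
  \<open>y\<close>. These minors are inner products of fixed vectors with
  \<open>cross3 x y\<close>.\<close>

lemma isotropic_gap_parabola:
  assumes "ivec a" "ivec b" "ivec c" "vol a b c \<noteq> 0"
  obtains K where "K > 0" "\<And>x y. ivec x \<Longrightarrow> ivec y \<Longrightarrow> (a \<bullet> x) * (c \<bullet> x) = (b \<bullet> x)\<^sup>2 \<Longrightarrow>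
    cross3 x y \<noteq> 0 \<Longrightarrow> norm x \<le> K * (norm (cross3 x y))\<^sup>2"
proof -
  define N where "N = norm (cross3 a b) + norm (cross3 b c) + norm (cross3 a c)"
  define K where "K = N * (N\<^sup>2 / \<bar>vol a b c\<bar>)"
  have "N > 0"
    using vol_nonzero_imp_cross3 [OF assms(4)] by (auto simp: N_def intro!: add_pos_nonneg)
  then have "K > 0"
    using assms(4) by (simp add: K_def)
  moreover have "norm x \<le> K * (norm (cross3 x y))\<^sup>2"
    if x: "ivec x" and y: "ivec y" and eq: "(a \<bullet> x) * (c \<bullet> x) = (b \<bullet> x)\<^sup>2" and xy: "cross3 x y \<noteq> 0"
    for x y
  proof -
    obtain x0 x1 x2 y0 y1 y2 where
      xi: "a \<bullet> x = of_int x0" "b \<bullet> x = of_int x1" "c \<bullet> x = of_int x2" and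
      yi: "a \<bullet> y = of_int y0" "b \<bullet> y = of_int y1" "c \<bullet> y = of_int y2"
      using assms x y ivec_inner by (metis Ints_cases)
    define M where "M = max \<bar>x0 * y1 - x1 * y0\<bar> (max \<bar>x1 * y2 - x2 * y1\<bar> \<bar>x0 * y2 - x2 * y0\<bar>)"
    have minor: "(a' \<bullet> x) * (b' \<bullet> y) - (b' \<bullet> x) * (a' \<bullet> y) = cross3 a' b' \<bullet> cross3 x y" for a' b'
      by (simp add: cross3_simps)
    have m: "of_int (x0 * y1 - x1 * y0) = cross3 a b \<bullet> cross3 x y"
      "of_int (x1 * y2 - x2 * y1) = cross3 b c \<bullet> cross3 x y"
      "of_int (x0 * y2 - x2 * y0) = cross3 a c \<bullet> cross3 x y"
      by (simp_all add: minor [symmetric] xi yi)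
    have "of_int \<bar>x0 * y1 - x1 * y0\<bar> \<le> norm (cross3 a b) * norm (cross3 x y)"
      "of_int \<bar>x1 * y2 - x2 * y1\<bar> \<le> norm (cross3 b c) * norm (cross3 x y)"
      "of_int \<bar>x0 * y2 - x2 * y0\<bar> \<le> norm (cross3 a c) * norm (cross3 x y)"
      unfolding of_int_abs m by (rule Cauchy_Schwarz_ineq2)+
    moreover have "norm (cross3 a b) * norm (cross3 x y) \<le> N * norm (cross3 x y)"
      "norm (cross3 b c) * norm (cross3 x y) \<le> N * norm (cross3 x y)"
      "norm (cross3 a c) * norm (cross3 x y) \<le> N * norm (cross3 x y)"
      by (intro mult_right_mono; simp add: N_def)+
    ultimately have "of_int M \<le> N * norm (cross3 x y)"
      unfolding M_def of_int_max by simp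
    then have M2: "of_int (M\<^sup>2) \<le> (N * norm (cross3 x y))\<^sup>2"
      unfolding of_int_power by (intro power_mono) (simp_all add: M_def le_max_iff_disj)
    have nonzero: "x0 * y1 - x1 * y0 \<noteq> 0 \<or> x1 * y2 - x2 * y1 \<noteq> 0 \<or> x0 * y2 - x2 * y0 \<noteq> 0"
    proof (rule ccontr)
      assume "\<not> ?thesis"
      then have "cross3 x y \<bullet> cross3 a b = 0" "cross3 x y \<bullet> cross3 b c = 0" "cross3 x y \<bullet> cross3 a c = 0"
        using m by (simp_all add: inner_commute)
      \<comment> \<open>The determinant of the matrix of minors is, up to sign, the square of the
        original one, so the three normals are independent.\<close>
      moreover have "vol (cross3 a b) (cross3 b c) (cross3 a c) = - (vol a b c)\<^sup>2"
        by (simp add: vol_def cross3_simps power2_eq_square)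
      ultimately show False
        using orthogonal_basis_imp_zero xy assms(4)
        by (metis neg_equal_0_iff_equal power_eq_0_iff)
    qed
    have x01: "x0 * x2 = x1\<^sup>2"
      using eq by (simp add: xi flip: of_int_mult of_int_power)
    have "\<bar>x0\<bar> \<le> M\<^sup>2" "\<bar>x1\<bar> \<le> M\<^sup>2" "\<bar>x2\<bar> \<le> M\<^sup>2"
      by (rule square_minors_bound [OF x01 _ _ _ nonzero]; simp add: M_def)+
    then have bounds: "\<bar>a \<bullet> x\<bar> \<le> (N * norm (cross3 x y))\<^sup>2" "\<bar>b \<bullet> x\<bar> \<le> (N * norm (cross3 x y))\<^sup>2"
      "\<bar>c \<bullet> x\<bar> \<le> (N * norm (cross3 x y))\<^sup>2"
      unfolding xi using M2 by linarith+
    let ?R = "(N * norm (cross3 x y))\<^sup>2"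
    have "vol a b c *\<^sub>R x = (a \<bullet> x) *\<^sub>R cross3 b c - (b \<bullet> x) *\<^sub>R cross3 a c + (c \<bullet> x) *\<^sub>R cross3 a b"
      by (simp add: vol_def cross3_simps forall_3)
    then have "\<bar>vol a b c\<bar> * norm x
        = norm ((a \<bullet> x) *\<^sub>R cross3 b c - (b \<bullet> x) *\<^sub>R cross3 a c + (c \<bullet> x) *\<^sub>R cross3 a b)"
      by (metis norm_scaleR)
    also have "\<dots> \<le> \<bar>a \<bullet> x\<bar> * norm (cross3 b c) + \<bar>b \<bullet> x\<bar> * norm (cross3 a c) + \<bar>c \<bullet> x\<bar> * norm (cross3 a b)"
      by (metis (no_types) norm_triangle_mono norm_triangle_ineq4 norm_scaleR order_refl)
    also have "\<dots> \<le> ?R * norm (cross3 b c) + ?R * norm (cross3 a c) + ?R * norm (cross3 a b)"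
      by (intro add_mono mult_right_mono bounds norm_ge_zero)
    also have "\<dots> = N * ?R"
      by (simp add: N_def algebra_simps)
    finally show ?thesis
      using assms(4) by (simp add: K_def field_simps power_mult_distrib)
  qed
  ultimately show thesis
    by (rule that)
qed

context rational_conic
begin

text \<open>Otherwise \<open>o'\<close> and \<open>x\<close> complete to a basis in which
  \<open>q\<close> involves neither the first coordinate nor the square of the second:
  \<open>q w = c * (b * B x h + c * q h)\<close>, a product of rational linear forms.\<close>

lemma isotropic_parallel_if_radical:
  assumes o: "rvec o'" "q o' = 0" "\<And>y. B o' y = 0" and x: "rvec x" "q x = 0"
  shows "cross3 o' x = 0"
proof (rule ccontr)
  assume nz: "cross3 o' x \<noteq> 0"
  define h where "h = cross3 o' x"
  define D where "D = vol o' x h"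
  have D: "D \<noteq> 0"
    using nz by (simp add: D_def vol_def h_def)
  have rv: "rvec h" "D \<in> \<rat>"
    using o x by (simp_all add: h_def D_def rvec_cross3 rvec_vol)
  define m n where "m = (1 / D) *\<^sub>R cross3 o' x"
    and "n = (2 / D) *\<^sub>R (B x h *\<^sub>R cross3 h o' + q h *\<^sub>R cross3 o' x)"
  have "rvec m" "rvec n"
    unfolding m_def n_def
    by (intro rvec_scaleR rvec_add rvec_cross3 Rats_divide Rats_1 Rats_number_of rational rational_q
        rv o x)+
  moreover have "B w w = (m \<bullet> w) * (n \<bullet> w)" for w
  proof -
    define a b c where "a = ((1 / D) *\<^sub>R cross3 x h) \<bullet> w" and "b = ((1 / D) *\<^sub>R cross3 h o') \<bullet> w"
      and "c = ((1 / D) *\<^sub>R cross3 o' x) \<bullet> w"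
    have w: "w = a *\<^sub>R o' + b *\<^sub>R x + c *\<^sub>R h"
      using dual_basis_expand [of o' x h w] D unfolding a_def b_def c_def D_def by blast
    have "q w = c * (b * B x h + c * q h)"
      unfolding w by (simp add: q_add q_scaleR o x B_simps algebra_simps power2_eq_square)
    moreover have "m \<bullet> w = c" "n \<bullet> w = 2 * (B x h * b + q h * c)"
      by (simp_all add: m_def n_def b_def c_def inner_add_left field_simps)
    ultimately show ?thesis
      by (simp add: B_self algebra_simps)
  qed
  ultimately show False
    using irred by blast
qed

text \<open>A rational singular point is the only rational point of the conic, so \<open>x\<close>
  is a multiple of one integral \<open>e\<close>, and \<open>norm x\<close> is even bounded linearly
  by \<open>norm (cross3 x y)\<close>. Squaring is harmless since
  \<open>1 \<le> norm x\<close>.\<close>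

lemma isotropic_gap_radical:
  assumes o: "rvec o'" "o' \<noteq> 0" "q o' = 0" "\<And>y. B o' y = 0"
  shows "\<exists>K>0. \<forall>x y. ivec x \<longrightarrow> ivec y \<longrightarrow> q x = 0 \<longrightarrow> cross3 x y \<noteq> 0 \<longrightarrow>
    norm x \<le> K * (norm (cross3 x y))\<^sup>2"
proof -
  obtain N where N: "N > 0" "ivec (real N *\<^sub>R o')"
    using rvec_denominator o(1) .
  define e where "e = real N *\<^sub>R o'"
  have e: "ivec e" "e \<noteq> 0"
    using N o by (simp_all add: e_def)
  define K where "K = (norm e)\<^sup>2"
  show ?thesis
  proof (intro exI [of _ K] conjI allI impI)
    show "K > 0"
      using e by (simp add: K_def)
    fix x y assume xy: "ivec x" "ivec y" "q x = 0" "cross3 x y \<noteq> 0"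
    then have "cross3 e x = 0"
      unfolding e_def cross_mult_left using isotropic_parallel_if_radical [of o' x] o
      by (simp add: ivec_imp_rvec)
    then obtain r where r: "x = r *\<^sub>R e"
      using e(2) by (auto simp: cross3_eq_0_iff_parallel)
    have "x \<noteq> 0"
      using xy by auto
    then have x1: "1 \<le> norm x"
      using xy by (intro ivec_norm_ge_1)
    have "1 \<le> norm (cross3 e y)"
      using e xy by (intro ivec_norm_ge_1 ivec_cross3) (auto simp: r cross_mult_left)
    then have "\<bar>r\<bar> \<le> norm (cross3 x y)"
      by (simp add: r cross_mult_left mult_le_cancel_left1)
    then have "norm x \<le> norm (cross3 x y) * norm e"
      using mult_right_mono [of "\<bar>r\<bar>" "norm (cross3 x y)" "norm e"] by (simp add: r)
    then have "(norm x)\<^sup>2 \<le> (norm (cross3 x y) * norm e)\<^sup>2"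
      by (intro power_mono) auto
    moreover have "norm x \<le> (norm x)\<^sup>2"
      using mult_left_mono [OF x1, of "norm x"] by (simp add: power2_eq_square)
    ultimately show "norm x \<le> K * (norm (cross3 x y))\<^sup>2"
      by (simp add: K_def power_mult_distrib mult.commute)
  qed
qed

text \<open>Complete \<open>o'\<close> to a hyperbolic pair \<open>o'\<close>, \<open>g\<close> and
  take \<open>f\<close> orthogonal to both. In dual coordinates the conic becomes
  \<open>ca * cb = d * cc\<^sup>2\<close>; multiplication by \<open>d\<close> gives the parabola
  \<open>(d * ca) * cb = (d * cc)\<^sup>2\<close>, and \<open>M\<close> clears denominators.\<close>

lemma isotropic_gap_nondegenerate:
  assumes o: "rvec o'" "q o' = 0" "B o' h \<noteq> 0" and h: "rvec h"
  shows "\<exists>K>0. \<forall>x y. ivec x \<longrightarrow> ivec y \<longrightarrow> q x = 0 \<longrightarrow> cross3 x y \<noteq> 0 \<longrightarrow>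
    norm x \<le> K * (norm (cross3 x y))\<^sup>2"
proof -
  define k where "k = B o' h"
  \<comment> \<open>This multiple of \<open>o'\<close> is chosen to make \<open>g\<close>
    isotropic.\<close>
  define g where "g = h - (q h / k) *\<^sub>R o'"
  define f0 where "f0 = cross3 o' g"
  define f where "f = f0 - (B f0 g / k) *\<^sub>R o' - (B f0 o' / k) *\<^sub>R g"
  have k: "k \<noteq> 0" "k \<in> \<rat>"
    using o h by (simp_all add: k_def rational)
  have Boo: "B o' o' = 0" and Bog: "B o' g = k"
    using o by (simp_all add: B_self g_def B_simps k_def)
  have qg: "q g = 0"
    using k o by (simp add: g_def q_def B_simps sym [of h o'] k_def [symmetric] Boo field_simps)
  have rg: "rvec g"
    unfolding g_def by (intro rvec_diff rvec_scaleR Rats_divide rational_q o h k)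
  have "cross3 o' g \<noteq> 0"
  proof
    assume "cross3 o' g = 0"
    moreover have "o' \<noteq> 0"
      using o by (auto simp: B_simps)
    ultimately obtain r where "g = r *\<^sub>R o'"
      by (auto simp: cross3_eq_0_iff_parallel)
    then show False
      using Bog Boo k by (simp add: B_simps)
  qed
  then have D0: "vol o' g f0 \<noteq> 0"
    by (simp add: vol_def f0_def)
  have rf0: "rvec f0"
    by (simp add: f0_def rvec_cross3 o rg)
  have rf: "rvec f"
    unfolding f_def by (intro rvec_diff rvec_scaleR Rats_divide rational o rg k rf0)
  have Bgg: "B g g = 0"
    by (simp add: B_self qg)
  have Bfo: "B f o' = 0" "B f g = 0"
    using k Boo Bog Bgg by (simp_all add: f_def B_simps sym [of g o'])
  have "f = 1 *\<^sub>R f0 + (-1) *\<^sub>R ((B f0 g / k) *\<^sub>R o' + (B f0 o' / k) *\<^sub>R g)"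
    by (simp add: f_def)
  then have "vol o' g f = vol o' g f0"
    unfolding vol_combo by (simp only: vol_combo) simp
  define D where "D = vol o' g f"
  have D: "D \<noteq> 0" "D \<in> \<rat>"
    using D0 \<open>vol o' g f = vol o' g f0\<close> rvec_vol [OF o(1) rg rf] by (simp_all add: D_def)
  define ca cb cc where "ca = (1 / D) *\<^sub>R cross3 g f" and "cb = (1 / D) *\<^sub>R cross3 f o'"
    and "cc = (1 / D) *\<^sub>R cross3 o' g"
  have rc: "rvec ca" "rvec cb" "rvec cc"
    unfolding ca_def cb_def cc_def by (intro rvec_scaleR rvec_cross3 Rats_divide Rats_1 o rg rf D)+
  have q_w: "q w = k * (ca \<bullet> w) * (cb \<bullet> w) + q f * (cc \<bullet> w)\<^sup>2" for w
  proof -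
    define a b c where "a = ca \<bullet> w" and "b = cb \<bullet> w" and "c = cc \<bullet> w"
    have w: "w = a *\<^sub>R o' + b *\<^sub>R g + c *\<^sub>R f"
      using dual_basis_expand [of o' g f w] D(1)
      unfolding a_def b_def c_def ca_def cb_def cc_def D_def by blast
    have "q w = k * a * b + q f * c\<^sup>2"
      unfolding w
      by (simp add: q_add q_scaleR o qg B_simps Bog Bfo sym [of o' f] sym [of g f] algebra_simps)
    then show ?thesis
      by (simp add: a_def b_def c_def)
  qed
  define d where "d = - q f / k"
  have d: "d \<noteq> 0" "d \<in> \<rat>"
  proof -
    have "q f \<noteq> 0"
    proof
      assume "q f = 0"
      then have "B w w = (((2 * k) *\<^sub>R ca) \<bullet> w) * (cb \<bullet> w)" for w
        using q_w [of w] by (simp add: B_self)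
      moreover have "rvec ((2 * k) *\<^sub>R ca)"
        by (intro rvec_scaleR Rats_mult Rats_number_of k rc)
      ultimately show False
        using irred rc by blast
    qed
    then show "d \<noteq> 0" "d \<in> \<rat>"
      using k by (simp_all add: d_def rational_q rf)
  qed
  obtain N1 N2 N3 :: nat where N: "N1 > 0" "ivec (real N1 *\<^sub>R (d *\<^sub>R ca))" "N2 > 0"
    "ivec (real N2 *\<^sub>R (d *\<^sub>R cc))" "N3 > 0" "ivec (real N3 *\<^sub>R cb)"
    using rvec_denominator rc d rvec_scaleR by metis
  define M where "M = real (N1 * N2 * N3)"
  have M: "M \<noteq> 0"
    using N by (simp add: M_def)
  have iv: "ivec (M *\<^sub>R (d *\<^sub>R ca))" "ivec (M *\<^sub>R (d *\<^sub>R cc))" "ivec (M *\<^sub>R cb)"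
    using ivec_scaleR [OF Ints_of_nat [of "N2 * N3"] N(2)]
      ivec_scaleR [OF Ints_of_nat [of "N1 * N3"] N(4)]
      ivec_scaleR [OF Ints_of_nat [of "N1 * N2"] N(6)]
    by (simp_all add: M_def mult_ac)
  have "cross3 (cross3 g f) (cross3 o' g) \<bullet> cross3 f o' = - D\<^sup>2"
    by (simp add: D_def vol_def cross3_simps power2_eq_square)
  then have vol: "vol (M *\<^sub>R (d *\<^sub>R ca)) (M *\<^sub>R (d *\<^sub>R cc)) (M *\<^sub>R cb) \<noteq> 0"
    using M d D by (simp add: vol_def cross_mult_left cross_mult_right ca_def cb_def cc_def)
  obtain K where K: "K > 0" "\<And>x y. ivec x \<Longrightarrow> ivec y \<Longrightarrow>
      ((M *\<^sub>R (d *\<^sub>R ca)) \<bullet> x) * ((M *\<^sub>R cb) \<bullet> x) = ((M *\<^sub>R (d *\<^sub>R cc)) \<bullet> x)\<^sup>2 \<Longrightarrow>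
      cross3 x y \<noteq> 0 \<Longrightarrow> norm x \<le> K * (norm (cross3 x y))\<^sup>2"
    using isotropic_gap_parabola [OF iv(1,2,3) vol] by blast
  show ?thesis
  proof (intro exI [of _ K] conjI allI impI K(1))
    fix x y assume xy: "ivec x" "ivec y" "q x = 0" "cross3 x y \<noteq> 0"
    have "(ca \<bullet> x) * (cb \<bullet> x) = d * (cc \<bullet> x)\<^sup>2"
      using q_w [of x] xy(3) k by (simp add: d_def field_simps)
    then have "((M *\<^sub>R (d *\<^sub>R ca)) \<bullet> x) * ((M *\<^sub>R cb) \<bullet> x) = M\<^sup>2 * d * (d * (cc \<bullet> x)\<^sup>2)"
      by (simp add: power2_eq_square)
    also have "\<dots> = ((M *\<^sub>R (d *\<^sub>R cc)) \<bullet> x)\<^sup>2"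
      by (simp add: power2_eq_square)
    finally show "norm x \<le> K * (norm (cross3 x y))\<^sup>2"
      using K(2) xy by blast
  qed
qed

text \<open>The exponent 2 on the right is what makes 1/2 the threshold in
  \<open>eventually_q_nonzero\<close>. If the conic has no rational point, nothing is claimed;
  otherwise the rational point is singular or smooth.\<close>

lemma isotropic_gap:
  shows "\<exists>K>0. \<forall>x y. ivec x \<longrightarrow> ivec y \<longrightarrow> q x = 0 \<longrightarrow> cross3 x y \<noteq> 0 \<longrightarrow>
    norm x \<le> K * (norm (cross3 x y))\<^sup>2"
proof (cases "\<exists>o'. ivec o' \<and> o' \<noteq> 0 \<and> q o' = 0")
  case False
  then have "\<not> (ivec x \<and> q x = 0 \<and> cross3 x y \<noteq> 0)" for x y
    by auto
  then show ?thesis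
    using zero_less_one by blast
next
  case True
  then obtain o' where o: "rvec o'" "o' \<noteq> 0" "q o' = 0"
    using ivec_imp_rvec by blast
  show ?thesis
  proof (cases "\<exists>i. B o' (axis i 1) \<noteq> 0")
    case True
    then obtain i where i: "B o' (axis i 1) \<noteq> 0" ..
    show ?thesis
      by (rule isotropic_gap_nondegenerate [OF o(1,3) i rvec_axis])
  next
    case False
    then have "B o' y = 0" for y
      by (subst B_eq_inner) (simp add: inner_vec_def)
    with o show ?thesis
      by (rule isotropic_gap_radical)
  qed
qed

end

section \<open>Estimates near a real point of the conic\<close>

locale conic_direction = rational_conic + direction +
  assumes q_v: "q v = 0"
begin

lemma B_bound: obtains K where "K > 0" "\<And>x y. \<bar>B x y\<bar> \<le> K * norm x * norm y"
  using bilinear_bounded_pos [OF bilinear] by (auto simp: mult.assoc)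

text \<open>Since \<open>q v = 0\<close>, the square of the component along \<open>v\<close> drops
  out, and each remaining term contains the perpendicular part.\<close>

lemma q_bound: "\<exists>K>0. \<forall>x. \<bar>q x\<bar> \<le> K * norm x * L x"
proof -
  obtain K where K: "K > 0" "\<And>x y. \<bar>B x y\<bar> \<le> K * norm x * norm y"
    by (fact B_bound)
  have "\<bar>q x\<bar> \<le> 2 * K * norm x * L x" for x
  proof -
    define b u where "b = x \<bullet> v" and "u = perp x"
    have x: "x = b *\<^sub>R v + u"
      unfolding b_def u_def by (rule decompose)
    have "q x = b * B v u + B u u / 2"
      unfolding x by (simp add: q_add q_scaleR q_v B_simps B_self)
    moreover have "\<bar>b * B v u\<bar> \<le> norm x * (K * L x)"
      using abs_inner_v_le [of x] K(2) [of v u]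
      by (simp add: b_def u_def abs_mult mult_mono norm_perp)
    moreover have "\<bar>B u u\<bar> \<le> K * L x * L x"
      using K(2) [of u u] by (simp add: u_def norm_perp)
    moreover have "K * L x * L x \<le> norm x * (K * L x)"
      using mult_right_mono [OF L_le_norm [of x], of "K * L x"] K(1) by (simp add: mult_ac)
    ultimately have "\<bar>q x\<bar> \<le> 2 * (norm x * (K * L x))"
      by linarith
    then show ?thesis
      by (simp add: mult_ac)
  qed
  then show ?thesis
    using K(1) by (intro exI [of _ "2 * K"]) auto
qed

text \<open>Estimated term by term, \<open>norm (psi x y)\<close> would contain
  \<open>norm x * norm y * L x\<close>. This part cancels between the two summands of
  \<open>psi\<close>, which is why \<open>psi\<close> can send good approximations to good
  approximations.\<close>

lemma psi_bound:
  "\<exists>K>0. \<forall>x y. norm (psi x y) \<le> K * ((norm x)\<^sup>2 * L y + norm y * (L x)\<^sup>2) \<and>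
    L (psi x y) \<le> K * (norm x * L x * L y + norm y * (L x)\<^sup>2)"
proof -
  obtain K where K: "K > 0" "\<And>x y. \<bar>B x y\<bar> \<le> K * norm x * norm y"
    by (fact B_bound)
  have main: "\<bar>psi x y \<bullet> v\<bar> \<le> 2 * K * ((norm x)\<^sup>2 * L y + norm y * (L x)\<^sup>2)"
    "L (psi x y) \<le> 4 * K * (norm x * L x * L y + norm y * (L x)\<^sup>2)" for x y
  proof -
    define X Y l m where "X = norm x" and "Y = norm y" and "l = L x" and "m = L y"
    note defs = this
    define b u a w where "b = x \<bullet> v" and "u = perp x" and "a = y \<bullet> v" and "w = perp y"
    note decs = this
    have pos: "0 \<le> X" "0 \<le> Y" "0 \<le> l" "0 \<le> m" "l \<le> X" "m \<le> Y"
      by (simp_all add: defs L_le_norm)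
    have x: "x = b *\<^sub>R v + u" and y: "y = a *\<^sub>R v + w"
      unfolding decs by (rule decompose)+
    have bounds: "\<bar>b\<bar> \<le> X" "\<bar>a\<bar> \<le> Y" "norm u = l" "norm w = m"
      by (simp_all add: decs defs abs_inner_v_le norm_perp)
    have Bb: "\<bar>B v u\<bar> \<le> K * l" "\<bar>B v w\<bar> \<le> K * m" "\<bar>B u w\<bar> \<le> K * l * m" "\<bar>q u\<bar> \<le> K * l * l"
      using K(2) [of v u] K(2) [of v w] K(2) [of u w] K(2) [of u u] K(1) pos
      by (simp_all add: bounds q_def)
    have Bxy: "B x y = b * B v w + a * B v u + B u w"
      unfolding x y using q_v by (simp add: B_simps B_self sym [of u v] algebra_simps)
    have qx: "q x = b * B v u + q u"
      unfolding x by (simp add: q_add q_scaleR q_v B_simps)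
    have perp: "u \<bullet> v = 0" "w \<bullet> v = 0"
      by (simp_all add: decs perp_def inner_diff_left)
    \<comment> \<open>The contributions \<open>a * b * B v u\<close> of both summands have
      cancelled.\<close>
    have psi: "psi x y = (b * b * B v w + b * B u w - a * q u) *\<^sub>R v + (B x y *\<^sub>R u - q x *\<^sub>R w)"
    proof -
      have "psi x y = B x y *\<^sub>R (b *\<^sub>R v + u) - q x *\<^sub>R (a *\<^sub>R v + w)"
        by (simp only: psi_def x [symmetric] y [symmetric])
      then show ?thesis
        by (simp add: Bxy qx algebra_simps)
    qed
    have "psi x y \<bullet> v = b * b * B v w + b * B u w - a * q u"
      unfolding psi by (simp add: inner_add_left inner_diff_left perp)
    moreover have "\<bar>b * b * B v w\<bar> \<le> X * X * (K * m)" "\<bar>b * B u w\<bar> \<le> X * (K * l * m)"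
      "\<bar>a * q u\<bar> \<le> Y * (K * l * l)"
      unfolding abs_mult using pos K(1) bounds Bb by (intro mult_mono; simp)+
    moreover have "X * (K * l * m) \<le> X * X * (K * m)"
      using mult_left_mono [OF pos(5), of "X * (K * m)"] pos K(1) by (simp add: mult_ac)
    moreover have "0 \<le> Y * (K * l * l)"
      using pos K(1) by simp
    ultimately have "\<bar>psi x y \<bullet> v\<bar> \<le> 2 * (X * X * (K * m)) + 2 * (Y * (K * l * l))"
      by linarith
    then show "\<bar>psi x y \<bullet> v\<bar> \<le> 2 * K * ((norm x)\<^sup>2 * L y + norm y * (L x)\<^sup>2)"
      by (simp add: defs power2_eq_square algebra_simps)
    have "L (psi x y) \<le> \<bar>B x y\<bar> * norm (cross3 u v) + \<bar>q x\<bar> * norm (cross3 w v)"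
      unfolding L_def psi cross_add_left cross_mult_left Cross3.left_diff_distrib
      using norm_triangle_ineq4 [of "B x y *\<^sub>R cross3 u v" "q x *\<^sub>R cross3 w v"] by simp
    moreover have "norm (cross3 u v) \<le> l" "norm (cross3 w v) \<le> m"
      using norm_cross3_le [of u v] norm_cross3_le [of w v] by (simp_all add: bounds)
    moreover have "\<bar>B x y\<bar> \<le> X * (K * m) + Y * (K * l) + X * (K * m)"
    proof -
      have "\<bar>b * B v w\<bar> \<le> X * (K * m)" "\<bar>a * B v u\<bar> \<le> Y * (K * l)"
        unfolding abs_mult using pos K(1) bounds Bb by (intro mult_mono; simp)+
      moreover have "K * l * m \<le> X * (K * m)"
        using mult_right_mono [OF pos(5), of "K * m"] pos K(1) by (simp add: mult_ac)
      ultimately show ?thesis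
        unfolding Bxy using Bb(3) by linarith
    qed
    moreover have "\<bar>q x\<bar> \<le> X * (K * l) + X * (K * l)"
    proof -
      have "\<bar>b * B v u\<bar> \<le> X * (K * l)"
        unfolding abs_mult using pos K(1) bounds Bb by (intro mult_mono; simp)+
      moreover have "K * l * l \<le> X * (K * l)"
        using mult_right_mono [OF pos(5), of "K * l"] pos K(1) by (simp add: mult_ac)
      ultimately show ?thesis
        unfolding qx using Bb(4) by linarith
    qed
    ultimately have "L (psi x y) \<le> (X * (K * m) + Y * (K * l) + X * (K * m)) * l
        + (X * (K * l) + X * (K * l)) * m"
      using pos by (smt (verit) mult_mono norm_ge_zero)
    also have "\<dots> = K * (4 * (X * l * m) + Y * (l * l))"
      by (simp add: algebra_simps)
    also have "\<dots> \<le> K * (4 * (X * l * m) + 4 * (Y * (l * l)))"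
      using pos K(1) by (intro mult_left_mono) auto
    finally show "L (psi x y) \<le> 4 * K * (norm x * L x * L y + norm y * (L x)\<^sup>2)"
      by (simp add: defs power2_eq_square algebra_simps)
  qed
  have "norm (psi x y) \<le> 6 * K * ((norm x)\<^sup>2 * L y + norm y * (L x)\<^sup>2)" for x y
  proof -
    have "norm (psi x y) \<le> \<bar>psi x y \<bullet> v\<bar> + L (psi x y)"
      using norm_triangle_ineq [of "(psi x y \<bullet> v) *\<^sub>R v" "perp (psi x y)"]
      by (simp add: decompose [symmetric] norm_perp)
    moreover have "norm x * L x * L y \<le> (norm x)\<^sup>2 * L y"
      by (simp add: power2_eq_square L_le_norm mult_left_mono mult_right_mono)
    then have "4 * K * (norm x * L x * L y + norm y * (L x)\<^sup>2)
        \<le> 4 * K * ((norm x)\<^sup>2 * L y + norm y * (L x)\<^sup>2)"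
      using K(1) by (intro mult_left_mono) auto
    ultimately show ?thesis
      using main [of x y] by linarith
  qed
  moreover have "L (psi x y) \<le> 6 * K * (norm x * L x * L y + norm y * (L x)\<^sup>2)" for x y
  proof -
    have "4 * K * (norm x * L x * L y + norm y * (L x)\<^sup>2) \<le> 6 * K * (norm x * L x * L y + norm y * (L x)\<^sup>2)"
      using K(1) by (intro mult_right_mono) auto
    then show ?thesis
      using main(2) [of x y] by linarith
  qed
  ultimately show ?thesis
    using K(1) by (intro exI [of _ "6 * K"]) auto
qed

end

section \<open>Logarithmic estimates along the minimal points\<close>

locale conic_minimal_sequence = conic_direction + minimal_sequence
begin

definition size :: "nat \<Rightarrow> real" where "size i = ln (norm (x i))"

definition defect :: "nat \<Rightarrow> real" where "defect i = ln (L (x i))"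

lemma norm_eq_exp: "norm (x i) = exp (size i)" and L_eq_exp: "L (x i) = exp (defect i)"
  using norm_pos L_pos by (simp_all add: size_def defect_def)

lemma size_at_top: "filterlim size at_top sequentially"
  unfolding size_def by (rule filterlim_compose [OF ln_at_top norm_x_at_top])

lemma size_mono: "i \<le> j \<Longrightarrow> size i \<le> size j"
  using norm_x_mono' [of i j] by (simp add: norm_eq_exp)

lemma defect_le_if_solvable:
  assumes "\<forall>\<^sub>F X in at_top. approx_solvable v l c X" "0 \<le> l" "l \<le> 1" "0 < c"
  shows "\<forall>\<^sub>F i in sequentially. defect i \<le> ln (4 * c) - l * size (Suc i)"
  using L_le_if_solvable [OF assms]
proof (rule eventually_mono)
  fix i assume "L (x i) \<le> 4 * c * norm (x (Suc i)) powr (- l)"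
  then have "ln (L (x i)) \<le> ln (4 * c * norm (x (Suc i)) powr (- l))"
    by (intro ln_mono L_pos)
  also have "\<dots> = ln (4 * c) - l * size (Suc i)"
    using assms(4) x_nonzero by (simp add: ln_mult ln_powr size_def)
  finally show "defect i \<le> ln (4 * c) - l * size (Suc i)"
    by (simp add: defect_def)
qed

lemma turn_size_le:
  assumes "turn p"
  shows "0 \<le> ln 4 + size (Suc p) + defect p + defect (p - 1)"
proof -
  have "ln 1 \<le> ln (4 * norm (x (Suc p)) * L (x p) * L (x (p - 1)))"
    using turn_vol_bound [OF assms] by simp
  also have "\<dots> = ln 4 + size (Suc p) + defect p + defect (p - 1)"
    using x_nonzero L_pos [THEN less_imp_neq, THEN not_sym]
    by (simp add: ln_mult size_def defect_def)
  finally show ?thesis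
    by simp
qed

lemma turn_size_le_consecutive:
  assumes "turn r" "p < r" "\<And>m. p < m \<Longrightarrow> m < r \<Longrightarrow> \<not> turn m"
  shows "size r \<le> ln 9 + size (Suc p) + defect p + size (Suc r) + defect r"
proof -
  have "ln (norm (x r)) \<le> ln (9 * (norm (x (Suc p)) * L (x p)) * (norm (x (Suc r)) * L (x r)))"
    using norm_turn_le [OF assms] by (intro ln_mono norm_pos)
  also have "\<dots> = ln 9 + size (Suc p) + defect p + size (Suc r) + defect r"
    using x_nonzero L_pos [THEN less_imp_neq, THEN not_sym]
    by (simp add: ln_mult size_def defect_def)
  finally show ?thesis
    by (simp add: size_def)
qed

text \<open>The gap lemma is what rules out rational points of the conic among the minimal points.\<close>

lemma eventually_q_nonzero:
  assumes "\<forall>\<^sub>F X in at_top. approx_solvable v l c X" "1/2 < l" "l \<le> 1" "0 < c"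
  shows "\<forall>\<^sub>F i in sequentially. q (x i) \<noteq> 0"
proof -
  obtain K where K: "K > 0" "\<And>x y. ivec x \<Longrightarrow> ivec y \<Longrightarrow> q x = 0 \<Longrightarrow> cross3 x y \<noteq> 0 \<Longrightarrow>
    norm x \<le> K * (norm (cross3 x y))\<^sup>2"
    using isotropic_gap by blast
  define M where "M = ln K + 2 * ln 3 + 2 * ln (4 * c)"
  have l: "0 < l"
    using assms(2) by simp
  \<comment> \<open>The gap lemma for \<open>x (Suc i)\<close> and \<open>x i\<close> yields
    \<open>(2 * l - 1) * size (Suc i) \<le> M\<close>, whose coefficient is positive since
    \<open>l > 1/2\<close>; it fails beyond this bound.\<close>
  have "\<forall>\<^sub>F i in sequentially. size i > M / (2 * l - 1)"
    using size_at_top by (simp add: filterlim_at_top_dense)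
  then have "\<forall>\<^sub>F i in sequentially. size (Suc i) > M / (2 * l - 1)"
    by (rule iffD2 [OF eventually_sequentially_Suc])
  then have "\<forall>\<^sub>F i in sequentially. size (Suc i) > M / (2 * l - 1) \<and>
      defect i \<le> ln (4 * c) - l * size (Suc i)"
    by (rule eventually_conj [OF _ defect_le_if_solvable [OF assms(1) less_imp_le [OF l] assms(3,4)]])
  then have "\<forall>\<^sub>F i in sequentially. q (x (Suc i)) \<noteq> 0"
  proof (rule eventually_mono)
    fix i assume elim: "size (Suc i) > M / (2 * l - 1) \<and> defect i \<le> ln (4 * c) - l * size (Suc i)"
    show "q (x (Suc i)) \<noteq> 0"
    proof
      assume "q (x (Suc i)) = 0"
      have "cross3 (x (Suc i)) (x i) = - normal i"
        unfolding normal_def by (rule cross_skew)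
      then have "norm (x (Suc i)) \<le> K * (norm (normal i))\<^sup>2"
        using K(2) [of "x (Suc i)" "x i"] \<open>q (x (Suc i)) = 0\<close> normal_nonzero ivec_x by simp
      also have "\<dots> \<le> K * (3 * norm (x (Suc i)) * L (x i))\<^sup>2"
        using K(1) norm_normal_le by (intro mult_left_mono power_mono) auto
      finally have "ln (norm (x (Suc i))) \<le> ln (K * (3 * norm (x (Suc i)) * L (x i))\<^sup>2)"
        by (intro ln_mono norm_pos)
      also have "\<dots> = ln K + 2 * (ln 3 + size (Suc i) + defect i)"
        using K(1) x_nonzero L_pos [THEN less_imp_neq, THEN not_sym]
        by (simp add: ln_mult ln_realpow size_def defect_def)
      finally have "(2 * l - 1) * size (Suc i) \<le> M"
        using elim assms(2) by (simp add: size_def M_def algebra_simps)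
      moreover have "M < (2 * l - 1) * size (Suc i)"
        using elim assms(2) by (simp add: field_simps)
      ultimately show False
        by simp
    qed
  qed
  then show ?thesis
    by (rule iffD1 [OF eventually_sequentially_Suc])
qed

text \<open>\<open>real N * q (x i)\<close> is a nonzero integer, while \<open>q_bound\<close> makes
  it small when \<open>x i\<close> is too close to the line.\<close>

lemma eventually_size_defect:
  assumes "\<forall>\<^sub>F X in at_top. approx_solvable v l c X" "1/2 < l" "l \<le> 1" "0 < c"
  shows "\<exists>K. \<forall>\<^sub>F i in sequentially. 0 \<le> size i + defect i + K"
proof -
  obtain N :: nat where N: "N > 0" "\<And>x. ivec x \<Longrightarrow> real N * q x \<in> \<int>"
    using common_denominator by metis
  obtain K where K: "K > 0" "\<And>x. \<bar>q x\<bar> \<le> K * norm x * L x"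
    using q_bound by blast
  have "\<forall>\<^sub>F i in sequentially. 0 \<le> size i + defect i + ln (real N * K)"
    using eventually_q_nonzero [OF assms]
  proof (rule eventually_mono)
    fix i assume "q (x i) \<noteq> 0"
    then have "1 \<le> \<bar>real N * q (x i)\<bar>"
      using N ivec_x by (intro Ints_abs_ge_1) auto
    also have "\<dots> \<le> real N * (K * norm (x i) * L (x i))"
      using K(2) by (simp add: abs_mult mult_left_mono)
    finally have "ln 1 \<le> ln (real N * K * norm (x i) * L (x i))"
      by (simp add: mult_ac)
    also have "\<dots> = ln (real N * K) + size i + defect i"
      using N K x_nonzero L_pos [THEN less_imp_neq, THEN not_sym]
      by (simp add: ln_mult size_def defect_def)
    finally show "0 \<le> size i + defect i + ln (real N * K)"
      by simp
  qed
  then show ?thesis ..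
qed

text \<open>At a turn \<open>p\<close>, integrality of \<open>q\<close> gives
  \<open>l * size (Suc p) \<le> size p + K + k\<close>, and the determinant gives
  \<open>0 \<le> ln 4 + (1 - l) * size (Suc p) - l * size p + 2 * k\<close>. As
  \<open>1 - l = l * l\<close>, the sizes cancel, and a very negative \<open>k\<close> is
  contradictory.\<close>

lemma not_solvable_golden:
  "\<exists>c>0. \<exists>\<^sub>F X in at_top. \<not> approx_solvable v (1 / golden) c X"
proof (rule ccontr)
  define l where "l = 1 / golden"
  assume "\<not> ?thesis"
  then have solvable: "\<forall>\<^sub>F X in at_top. approx_solvable v l c X" if "c > 0" for c
    using that by (auto simp: frequently_def l_def)
  have "2 < sqrt 5" "sqrt 5 < 3"
    by (simp_all add: real_less_rsqrt real_less_lsqrt)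
  then have l: "1/2 < l" "l \<le> 1" "l * l = 1 - l"
    by (simp_all add: l_def golden_def field_simps)
  \<comment> \<open>\<open>K\<close> is fixed by means of the approximation constant 1, before
    \<open>k\<close> and \<open>c\<close> are chosen.\<close>
  obtain K where K: "\<forall>\<^sub>F i in sequentially. 0 \<le> size i + defect i + K"
    using eventually_size_defect [OF solvable l(1,2)] zero_less_one by metis
  \<comment> \<open>Chosen to make \<open>ln 4 + l * K + l * k + 2 * k\<close> negative;
    \<open>c\<close> is then the constant with \<open>ln (4 * c) = k\<close>.\<close>
  define k where "k = - \<bar>l * K\<bar> - ln 4 - 1"
  define c where "c = exp k / 4"
  have "c > 0"
    by (simp add: c_def)
  have "\<forall>\<^sub>F i in sequentially. defect i \<le> k - l * size (Suc i)"
    using defect_le_if_solvable [OF solvable [OF \<open>c > 0\<close>] _ l(2) \<open>c > 0\<close>] l(1) by (simp add: c_def)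
  then have "\<forall>\<^sub>F i in sequentially. defect i \<le> k - l * size (Suc i) \<and> 0 \<le> size i + defect i + K"
    using K by (rule eventually_conj)
  then obtain n where n: "\<And>i. i \<ge> n \<Longrightarrow> defect i \<le> k - l * size (Suc i)"
    "\<And>i. i \<ge> n \<Longrightarrow> 0 \<le> size i + defect i + K"
    by (auto simp: eventually_sequentially)
  obtain p where p: "p > n" "turn p"
    using infinite_turns by (auto simp: infinite_nat_iff_unbounded)
  have 1: "l * size (Suc p) \<le> size p + K + k"
    using n [of p] p by linarith
  have "defect (p - 1) \<le> k - l * size p"
    using n(1) [of "p - 1"] p by simp
  moreover have "defect p \<le> k - l * size (Suc p)"
    using n p by simp
  ultimately have "0 \<le> ln 4 + (1 - l) * size (Suc p) - l * size p + 2 * k"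
    using turn_size_le [OF p(2)] by (simp add: algebra_simps)
  also have "(1 - l) * size (Suc p) = l * (l * size (Suc p))"
    by (simp add: mult.assoc [symmetric] l)
  also have "\<dots> \<le> l * (size p + K + k)"
    using 1 l by (intro mult_left_mono) auto
  finally have "0 \<le> ln 4 + l * K + l * k + 2 * k"
    by (simp add: algebra_simps)
  moreover have ln4: "0 \<le> ln (4::real)"
    by simp
  moreover have "k < 0"
    using ln4 abs_ge_zero [of "l * K"] unfolding k_def by linarith
  then have "l * k \<le> 0"
    using l by (simp add: mult_nonneg_nonpos)
  ultimately show False
    using ln4 abs_ge_self [of "l * K"] k_def by linarith
qed

end

section \<open>The recursion between consecutive turning points\<close>

context conic_minimal_sequence
begin

definition turn_index :: "nat \<Rightarrow> nat" where "turn_index = enumerate {p. turn p}"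

definition y :: "nat \<Rightarrow> real^3" where "y k = x (turn_index k)"

lemma turn_turn_index: "turn (turn_index k)"
  using enumerate_in_set [OF infinite_turns] by (simp add: turn_index_def)

lemma turn_index_less: "turn_index k < turn_index (Suc k)"
  unfolding turn_index_def by (rule enumerate_step [OF infinite_turns])

lemma le_turn_index: "k \<le> turn_index k"
  unfolding turn_index_def by (rule le_enumerate [OF infinite_turns])

lemma no_turn_between:
  assumes "turn_index k < m" "m < turn_index (Suc k)"
  shows "\<not> turn m"
proof
  assume "turn m"
  then have "(LEAST s. s \<in> {p. turn p} \<and> turn_index k < s) \<le> m"
    using assms(1) by (intro Least_le) simp
  then show False
    using assms(2) enumerate_Suc'' [OF infinite_turns, of k] by (simp add: turn_index_def)
qed

lemma vol_y_nonzero: "vol (y k) (y (Suc k)) (y (Suc (Suc k))) \<noteq> 0"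
  unfolding y_def
  by (rule vol_turns_nonzero [OF turn_turn_index turn_index_less no_turn_between
        turn_turn_index turn_index_less no_turn_between])

lemma ivec_y: "ivec (y k)" and y_nonzero: "y k \<noteq> 0"
  by (simp_all add: y_def ivec_x x_nonzero)

text \<open>\<open>cross3 z (y (Suc k))\<close> is orthogonal to three consecutive turning points,
  which form a basis.\<close>

lemma y_parallel:
  assumes "vol z (y (Suc k)) (y k) = 0" "vol z (y (Suc k)) (y (Suc (Suc k))) = 0"
  shows "cross3 z (y (Suc k)) = 0"
proof (rule orthogonal_basis_imp_zero [OF vol_y_nonzero [of k]])
  show "cross3 z (y (Suc k)) \<bullet> y k = 0" "cross3 z (y (Suc k)) \<bullet> y (Suc k) = 0"
    "cross3 z (y (Suc k)) \<bullet> y (Suc (Suc k)) = 0"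
    using assms by (simp_all add: vol_def dot_cross_self)
qed

end

text \<open>
  At the exponent \<open>1/golden\<close> the logarithms of the sizes of consecutive turning points grow by the
  factor \<open>golden = 1.618\<dots>\<close>, and the logarithm of the distance is minus that of the size; the
  constants \<open>1.617\<close>, \<open>1.619\<close> and \<open>-0.999\<close> leave room for the slightly smaller exponent \<open>0.618\<close>.
\<close>

lemma turn_growth_arith:
  fixes A A' P P' l l' m K :: real
  assumes "0 \<le> A" "0 \<le> K" "P \<le> A'"
    and "l \<le> K - (618 / 1000) * P" "l' \<le> K - (618 / 1000) * P'" "m \<le> K - (618 / 1000) * A"
    and "0 \<le> A + l + K" "0 \<le> A' + l' + K" "0 \<le> K + P + l + m" "A' \<le> K + P + l + P' + l'"
  shows "A' \<le> (1619 / 1000) * A + 20 * K" "(1617 / 1000) * A - 20 * K \<le> A'" "l \<le> - (999 / 1000) * A + 20 * K"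
  using assms by linarith+

context conic_minimal_sequence
begin

definition ysize :: "nat \<Rightarrow> real" where "ysize k = size (turn_index k)"

definition ydefect :: "nat \<Rightarrow> real" where "ydefect k = defect (turn_index k)"

lemma norm_y: "norm (y k) = exp (ysize k)" and L_y: "L (y k) = exp (ydefect k)"
  by (simp_all add: y_def ysize_def ydefect_def norm_eq_exp L_eq_exp)

lemma size_nonneg: "0 \<le> size i"
  using norm_ge_1 by (simp add: size_def)

lemma ysize_at_top: "filterlim ysize at_top sequentially"
proof -
  have "strict_mono turn_index"
    using turn_index_less by (simp add: strict_mono_Suc_iff)
  then show ?thesis
    unfolding ysize_def using size_at_top filterlim_compose filterlim_subseq by blast
qed

lemma y_growth:
  assumes solvable: "\<forall>\<^sub>F X in at_top. approx_solvable v (618 / 1000) c X" and "0 < c"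
  obtains K n where "0 \<le> K"
    "\<And>k. k \<ge> n \<Longrightarrow> ysize (Suc k) \<le> (1619 / 1000) * ysize k + K"
    "\<And>k. k \<ge> n \<Longrightarrow> (1617 / 1000) * ysize k - K \<le> ysize (Suc k)"
    "\<And>k. k \<ge> n \<Longrightarrow> ydefect k \<le> - (999 / 1000) * ysize k + K"
proof -
  obtain K0 where K0: "\<forall>\<^sub>F i in sequentially. 0 \<le> size i + defect i + K0"
    using eventually_size_defect [OF solvable] \<open>0 < c\<close> by auto
  have "\<forall>\<^sub>F i in sequentially. defect i \<le> ln (4 * c) - (618 / 1000) * size (Suc i)"
    using defect_le_if_solvable [OF solvable] \<open>0 < c\<close> by auto
  then have "\<forall>\<^sub>F i in sequentially. defect i \<le> ln (4 * c) - (618 / 1000) * size (Suc i) \<and>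
      0 \<le> size i + defect i + K0"
    using K0 by (rule eventually_conj)
  then obtain n where n: "\<And>i. i \<ge> n \<Longrightarrow> defect i \<le> ln (4 * c) - (618 / 1000) * size (Suc i)"
    "\<And>i. i \<ge> n \<Longrightarrow> 0 \<le> size i + defect i + K0"
    by (auto simp: eventually_sequentially)
  define K where "K = \<bar>ln (4 * c)\<bar> + \<bar>K0\<bar> + ln 4 + ln 9"
  have ln: "0 \<le> ln (4::real)" "0 \<le> ln (9::real)"
    by simp_all
  have K: "0 \<le> K" "ln (4 * c) \<le> K" "K0 \<le> K" "ln 4 \<le> K" "ln 9 \<le> K"
    unfolding K_def using ln by linarith+
  have step: "ysize (Suc k) \<le> (1619 / 1000) * ysize k + 20 * K" "(1617 / 1000) * ysize k - 20 * K \<le> ysize (Suc k)"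
    "ydefect k \<le> - (999 / 1000) * ysize k + 20 * K" if "k \<ge> Suc n" for k
  proof -
    let ?p = "turn_index k" and ?r = "turn_index (Suc k)"
    have pr: "n \<le> ?p - 1" "0 < ?p" "?p < ?r"
      using le_turn_index [of k] turn_index_less [of k] that by auto
    \<comment> \<open>In \<open>turn_growth_arith\<close>, \<open>A\<close> and \<open>A'\<close>
      are the sizes at \<open>p\<close> and \<open>r\<close>, and \<open>P\<close> and
      \<open>P'\<close> those at their successors; \<open>l\<close>, \<open>l'\<close>,
      \<open>m\<close> are the defects at \<open>p\<close>, \<open>r\<close> and
      \<open>p - 1\<close>.\<close>
    have "0 \<le> size ?p" "0 \<le> K" "size (Suc ?p) \<le> size ?r"
      using size_nonneg K(1) pr by (auto intro: size_mono)
    moreover have "defect ?p \<le> K - (618 / 1000) * size (Suc ?p)"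
      using n(1) [of ?p] pr K(2) by linarith
    moreover have "defect ?r \<le> K - (618 / 1000) * size (Suc ?r)"
      using n(1) [of ?r] pr K(2) by linarith
    moreover have "defect (?p - 1) \<le> K - (618 / 1000) * size ?p"
      using n(1) [of "?p - 1"] pr K(2) by simp
    moreover have "0 \<le> size ?p + defect ?p + K"
      using n(2) [of ?p] pr K(3) by linarith
    moreover have "0 \<le> size ?r + defect ?r + K"
      using n(2) [of ?r] pr K(3) by linarith
    moreover have "0 \<le> K + size (Suc ?p) + defect ?p + defect (?p - 1)"
      using turn_size_le [OF turn_turn_index [of k]] K(4) by linarith
    moreover have "size ?r \<le> K + size (Suc ?p) + defect ?p + size (Suc ?r) + defect ?r"
      using turn_size_le_consecutive [OF turn_turn_index turn_index_less no_turn_between [of k]] K(5)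
      by fastforce
    ultimately show "ysize (Suc k) \<le> (1619 / 1000) * ysize k + 20 * K"
      "(1617 / 1000) * ysize k - 20 * K \<le> ysize (Suc k)" "ydefect k \<le> - (999 / 1000) * ysize k + 20 * K"
      unfolding ysize_def ydefect_def by (rule turn_growth_arith)+
  qed
  show thesis
    by (rule that [of "20 * K" "Suc n"]) (use K(1) step in auto)
qed

lemma psi_y_estimates:
  assumes solvable: "\<forall>\<^sub>F X in at_top. approx_solvable v (618 / 1000) c X" and "0 < c"
  obtains C K n where "0 < C" "0 \<le> K"
    "\<And>k. k \<ge> n \<Longrightarrow> \<bar>vol (psi (y (k + 3)) (y (k + 4))) (y (k + 1)) (y k)\<bar>
      \<le> C * exp (K - (1 / 10) * ysize (k + 1))"
    "\<And>k. k \<ge> n \<Longrightarrow> \<bar>vol (psi (y (k + 3)) (y (k + 4))) (y (k + 1)) (y (k + 2))\<bar>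
      \<le> C * exp (K - (1 / 10) * ysize (k + 1))"
proof -
  obtain K n where K: "0 \<le> K" and n:
    "\<And>k. k \<ge> n \<Longrightarrow> ysize (Suc k) \<le> (1619 / 1000) * ysize k + K"
    "\<And>k. k \<ge> n \<Longrightarrow> (1617 / 1000) * ysize k - K \<le> ysize (Suc k)"
    "\<And>k. k \<ge> n \<Longrightarrow> ydefect k \<le> - (999 / 1000) * ysize k + K"
    using y_growth [OF assms] by blast
  obtain C where C: "C > 0" "\<And>x y. norm (psi x y) \<le> C * ((norm x)\<^sup>2 * L y + norm y * (L x)\<^sup>2)"
    "\<And>x y. L (psi x y) \<le> C * (norm x * L x * L y + norm y * (L x)\<^sup>2)"
    using psi_bound by blast
  have main: "\<bar>vol (psi (y (k + 3)) (y (k + 4))) (y (k + 1)) (y k)\<bar>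
      \<le> 8 * C * exp (30 * K - (1 / 10) * ysize (k + 1))"
    "\<bar>vol (psi (y (k + 3)) (y (k + 4))) (y (k + 1)) (y (k + 2))\<bar>
      \<le> 8 * C * exp (30 * K - (1 / 10) * ysize (k + 1))" if "k \<ge> n" for k
  proof -
    define S0 S S2 S3 S4 where "S0 = ysize k" and "S = ysize (k + 1)" and "S2 = ysize (k + 2)"
      and "S3 = ysize (k + 3)" and "S4 = ysize (k + 4)"
    define D0 D D2 D3 D4 where "D0 = ydefect k" and "D = ydefect (k + 1)" and "D2 = ydefect (k + 2)"
      and "D3 = ydefect (k + 3)" and "D4 = ydefect (k + 4)"
    note defs = S0_def S_def S2_def S3_def S4_def D0_def D_def D2_def D3_def D4_def
    define z where "z = psi (y (k + 3)) (y (k + 4))"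
    have S: "0 \<le> S"
      by (simp add: S_def ysize_def size_nonneg)
    have up: "S \<le> (1619 / 1000) * S0 + K" "S2 \<le> (1619 / 1000) * S + K" "S3 \<le> (1619 / 1000) * S2 + K" "S4 \<le> (1619 / 1000) * S3 + K"
      using n(1) [of k] n(1) [of "k + 1"] n(1) [of "k + 2"] n(1) [of "k + 3"] that
      by (simp_all add: defs eval_nat_numeral)
    have lo: "(1617 / 1000) * S0 - K \<le> S" "(1617 / 1000) * S - K \<le> S2" "(1617 / 1000) * S2 - K \<le> S3" "(1617 / 1000) * S3 - K \<le> S4"
      using n(2) [of k] n(2) [of "k + 1"] n(2) [of "k + 2"] n(2) [of "k + 3"] that
      by (simp_all add: defs eval_nat_numeral)
    have de: "D0 \<le> - (999 / 1000) * S0 + K" "D \<le> - (999 / 1000) * S + K" "D2 \<le> - (999 / 1000) * S2 + K"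
      "D3 \<le> - (999 / 1000) * S3 + K" "D4 \<le> - (999 / 1000) * S4 + K"
      using n(3) [of k] n(3) [of "k + 1"] n(3) [of "k + 2"] n(3) [of "k + 3"] n(3) [of "k + 4"] that
      by (simp_all add: defs)
    \<comment> \<open>For ideal growth, \<open>S3 = golden\<^sup>2 * S\<close>,
      \<open>S4 = golden ^ 3 * S\<close> and defects minus the sizes, the larger left side is
      \<open>S\<close> in the first line and \<open>- S\<close> in the second; 101/100 and 98/100
      absorb the rounding.\<close>
    have e: "2 * S3 + D4 \<le> (101 / 100) * S + 10 * K" "S4 + 2 * D3 \<le> (101 / 100) * S + 10 * K"
      "S3 + D3 + D4 \<le> - (98 / 100) * S + 10 * K" "S4 + 2 * D3 \<le> - (98 / 100) * S + 10 * K"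
      using up lo de S K by linarith+
    have "norm z \<le> C * (exp (2 * S3 + D4) + exp (S4 + 2 * D3))"
      using C(2) [of "y (k + 3)" "y (k + 4)"]
      by (simp add: z_def norm_y L_y defs exp_add exp_double)
    also have "\<dots> \<le> C * (exp ((101 / 100) * S + 10 * K) + exp ((101 / 100) * S + 10 * K))"
      using e C(1) by (intro mult_left_mono add_mono) auto
    finally have norm_z: "norm z \<le> 2 * C * exp ((101 / 100) * S + 10 * K)"
      by simp
    have "L z \<le> C * (exp (S3 + D3 + D4) + exp (S4 + 2 * D3))"
      using C(3) [of "y (k + 3)" "y (k + 4)"]
      by (simp add: z_def norm_y L_y defs exp_add exp_double)
    also have "\<dots> \<le> C * (exp (- (98 / 100) * S + 10 * K) + exp (- (98 / 100) * S + 10 * K))"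
      using e C(1) by (intro mult_left_mono add_mono) auto
    finally have L_z: "L z \<le> 2 * C * exp (- (98 / 100) * S + 10 * K)"
      by simp
    \<comment> \<open>For ideal growth the worst exponent that occurs below is
      \<open>S2 - 2 * S\<close>, about \<open>- 0.38 * S\<close>, so 1/10 leaves ample room.\<close>
    have vol: "\<bar>vol z a b\<bar> \<le> 8 * C * exp (30 * K - (1 / 10) * S)"
      if ab: "norm a = exp s" "norm b = exp s'" "L a = exp d" "L b = exp d'"
        and "(101 / 100) * S + 10 * K + d + d' \<le> 30 * K - (1 / 10) * S"
          "s + (- (98 / 100) * S + 10 * K) + d' \<le> 30 * K - (1 / 10) * S"
          "s' + (- (98 / 100) * S + 10 * K) + d \<le> 30 * K - (1 / 10) * S" for a b s s' d d'
    proof -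
      let ?E = "exp (30 * K - (1 / 10) * S)"
      have "norm z * (exp d * exp d') \<le> 2 * C * exp ((101 / 100) * S + 10 * K) * (exp d * exp d')"
        using norm_z by (intro mult_right_mono) auto
      also have "\<dots> = 2 * C * exp ((101 / 100) * S + 10 * K + d + d')"
        by (simp add: exp_add)
      also have "\<dots> \<le> 2 * C * ?E"
        using that C(1) by (intro mult_left_mono) auto
      finally have 1: "norm z * (exp d * exp d') \<le> 2 * C * ?E" .
      have "L z * (exp s * exp d') \<le> 2 * C * exp (- (98 / 100) * S + 10 * K) * (exp s * exp d')"
        using L_z by (intro mult_right_mono) auto
      also have "\<dots> = 2 * C * exp (s + (- (98 / 100) * S + 10 * K) + d')"
        by (simp add: exp_add)
      also have "\<dots> \<le> 2 * C * ?E"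
        using that C(1) by (intro mult_left_mono) auto
      finally have 2: "L z * (exp s * exp d') \<le> 2 * C * ?E" .
      have "L z * (exp s' * exp d) \<le> 2 * C * exp (- (98 / 100) * S + 10 * K) * (exp s' * exp d)"
        using L_z by (intro mult_right_mono) auto
      also have "\<dots> = 2 * C * exp (s' + (- (98 / 100) * S + 10 * K) + d)"
        by (simp add: exp_add)
      also have "\<dots> \<le> 2 * C * ?E"
        using that C(1) by (intro mult_left_mono) auto
      finally have 3: "L z * (exp s' * exp d) \<le> 2 * C * ?E" .
      have "\<bar>vol z a b\<bar> \<le> 2 * (norm z * (exp d * exp d')) + L z * (exp s * exp d') + L z * (exp s' * exp d)"
        using abs_vol_le_L [of z a b] by (simp add: ab mult_ac)
      then show ?thesis
        using 1 2 3 by linarith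
    qed
    have "\<bar>vol z (y (k + 1)) (y k)\<bar> \<le> 8 * C * exp (30 * K - (1 / 10) * S)"
    proof (rule vol)
      show "norm (y (k + 1)) = exp S" "norm (y k) = exp S0" "L (y (k + 1)) = exp D" "L (y k) = exp D0"
        by (simp_all only: norm_y L_y defs)
      show "(101 / 100) * S + 10 * K + D + D0 \<le> 30 * K - (1 / 10) * S"
        "S + (- (98 / 100) * S + 10 * K) + D0 \<le> 30 * K - (1 / 10) * S"
        "S0 + (- (98 / 100) * S + 10 * K) + D \<le> 30 * K - (1 / 10) * S"
        using up lo de S K by linarith+
    qed
    then show "\<bar>vol (psi (y (k + 3)) (y (k + 4))) (y (k + 1)) (y k)\<bar>
      \<le> 8 * C * exp (30 * K - (1 / 10) * ysize (k + 1))"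
      by (simp only: z_def S_def)
    have "\<bar>vol z (y (k + 1)) (y (k + 2))\<bar> \<le> 8 * C * exp (30 * K - (1 / 10) * S)"
    proof (rule vol)
      show "norm (y (k + 1)) = exp S" "norm (y (k + 2)) = exp S2" "L (y (k + 1)) = exp D"
        "L (y (k + 2)) = exp D2"
        by (simp_all only: norm_y L_y defs)
      show "(101 / 100) * S + 10 * K + D + D2 \<le> 30 * K - (1 / 10) * S"
        "S + (- (98 / 100) * S + 10 * K) + D2 \<le> 30 * K - (1 / 10) * S"
        "S2 + (- (98 / 100) * S + 10 * K) + D \<le> 30 * K - (1 / 10) * S"
        using up lo de S K by linarith+
    qed
    then show "\<bar>vol (psi (y (k + 3)) (y (k + 4))) (y (k + 1)) (y (k + 2))\<bar>
      \<le> 8 * C * exp (30 * K - (1 / 10) * ysize (k + 1))"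
      by (simp only: z_def S_def)
  qed
  show thesis
    by (rule that [of "8 * C" "30 * K" n]) (use C(1) K main in auto)
qed

lemma psi_y_parallel:
  assumes solvable: "\<forall>\<^sub>F X in at_top. approx_solvable v (618 / 1000) c X" and "0 < c"
  shows "\<forall>\<^sub>F k in sequentially. cross3 (psi (y (k + 3)) (y (k + 4))) (y (k + 1)) = 0"
proof -
  obtain C K n where C: "0 < C" "0 \<le> K" and n:
    "\<And>k. k \<ge> n \<Longrightarrow> \<bar>vol (psi (y (k + 3)) (y (k + 4))) (y (k + 1)) (y k)\<bar>
      \<le> C * exp (K - (1 / 10) * ysize (k + 1))"
    "\<And>k. k \<ge> n \<Longrightarrow> \<bar>vol (psi (y (k + 3)) (y (k + 4))) (y (k + 1)) (y (k + 2))\<bar>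
      \<le> C * exp (K - (1 / 10) * ysize (k + 1))"
    using psi_y_estimates [OF assms] by blast
  obtain N :: nat where N: "N > 0" "\<And>x y. ivec x \<Longrightarrow> ivec y \<Longrightarrow> real N * B x y \<in> \<int>"
    "\<And>x. ivec x \<Longrightarrow> real N * q x \<in> \<int>"
    using common_denominator by metis
  have zero: "vol (psi a b) c d = 0"
    if "ivec a" "ivec b" "ivec c" "ivec d" "real N * \<bar>vol (psi a b) c d\<bar> < 1" for a b c d
  proof -
    have "real N *\<^sub>R psi a b = (real N * B a b) *\<^sub>R a - (real N * q a) *\<^sub>R b"
      by (simp add: psi_def scaleR_diff_right)
    then have "ivec (real N *\<^sub>R psi a b)"
      using N that by (simp add: ivec_diff ivec_scaleR)
    then have "vol (real N *\<^sub>R psi a b) c d \<in> \<int>"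
      using that by (intro ivec_vol)
    then have "real N * vol (psi a b) c d \<in> \<int>"
      by (simp add: vol_def cross_mult_left)
    then have "real N * vol (psi a b) c d = 0"
      using Ints_abs_ge_1 [of "real N * vol (psi a b) c d"] that(5) by (force simp: abs_mult)
    then show ?thesis
      using N(1) by simp
  qed
  \<comment> \<open>Beyond \<open>R\<close> the determinant times its denominator is below
    1.\<close>
  define R where "R = (K + ln (real N * C)) / (1 / 10)"
  have "\<forall>\<^sub>F k in sequentially. ysize k > R"
    using ysize_at_top by (simp add: filterlim_at_top_dense)
  then have "\<forall>\<^sub>F k in sequentially. ysize (Suc k) > R"
    by (rule iffD2 [OF eventually_sequentially_Suc])
  then have "\<forall>\<^sub>F k in sequentially. ysize (Suc k) > R \<and> k \<ge> n"
    using eventually_ge_at_top by (rule eventually_conj)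
  then show ?thesis
  proof (rule eventually_mono)
    fix k assume k: "ysize (Suc k) > R \<and> k \<ge> n"
    have "real N * (C * exp (K - (1 / 10) * ysize (k + 1))) = exp (ln (real N * C) + (K - (1 / 10) * ysize (k + 1)))"
      using N(1) C(1) by (simp add: exp_add)
    also have "\<dots> < exp 0"
      using k by (simp add: R_def field_simps)
    finally have small: "real N * (C * exp (K - (1 / 10) * ysize (k + 1))) < 1"
      by simp
    have "vol (psi (y (k + 3)) (y (k + 4))) (y (k + 1)) (y k) = 0"
      using mult_left_mono [OF n(1) [of k], of "real N"] small k
      by (intro zero ivec_y) linarith
    moreover have "vol (psi (y (k + 3)) (y (k + 4))) (y (k + 1)) (y (k + 2)) = 0"
      using mult_left_mono [OF n(2) [of k], of "real N"] small k
      by (intro zero ivec_y) linarith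
    ultimately show "cross3 (psi (y (k + 3)) (y (k + 4))) (y (k + 1)) = 0"
      using y_parallel [of _ k] by simp
  qed
qed

text \<open>Applying \<open>psi (y (k + 3))\<close> once more inverts the backward relation up to
  the factor \<open>(q (y (k + 3)))\<^sup>2\<close>, which is eventually nonzero.\<close>

lemma y_recursion:
  assumes solvable: "\<forall>\<^sub>F X in at_top. approx_solvable v (618 / 1000) c X" and "0 < c"
  shows "\<forall>\<^sub>F k in sequentially. \<exists>r. y (k + 3) = r *\<^sub>R psi (y (k + 2)) (y k)"
proof -
  have "filterlim turn_index at_top sequentially"
    using turn_index_less by (simp add: filterlim_subseq strict_mono_Suc_iff)
  then have "\<forall>\<^sub>F k in sequentially. q (y k) \<noteq> 0"
    unfolding y_def
    by (rule eventually_compose_filterlim [OF eventually_q_nonzero [OF solvable _ _ \<open>0 < c\<close>], rotated 2])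
      simp_all
  then have "\<forall>\<^sub>F k in sequentially. q (y (k + 3)) \<noteq> 0"
    by (rule iffD2 [OF eventually_sequentially_seg])
  then have "\<forall>\<^sub>F k in sequentially. q (y (k + 3)) \<noteq> 0 \<and>
      cross3 (psi (y (k + 3)) (y (k + 4))) (y (k + 1)) = 0"
    using psi_y_parallel [OF assms] by (rule eventually_conj)
  then have "\<forall>\<^sub>F k in sequentially. \<exists>r. y (Suc k + 3) = r *\<^sub>R psi (y (Suc k + 2)) (y (Suc k))"
  proof (rule eventually_mono)
    fix k assume k: "q (y (k + 3)) \<noteq> 0 \<and> cross3 (psi (y (k + 3)) (y (k + 4))) (y (k + 1)) = 0"
    then have "cross3 (y (k + 1)) (psi (y (k + 3)) (y (k + 4))) = 0"
      using cross_skew [of "y (k + 1)"] by simp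
    then obtain r where r: "psi (y (k + 3)) (y (k + 4)) = r *\<^sub>R y (k + 1)"
      using y_nonzero by (auto simp: cross3_eq_0_iff_parallel)
    have "(q (y (k + 3)))\<^sup>2 *\<^sub>R y (k + 4) = psi (y (k + 3)) (r *\<^sub>R y (k + 1))"
      by (simp only: psi_psi r [symmetric])
    also have "\<dots> = r *\<^sub>R psi (y (k + 3)) (y (k + 1))"
      using psi_scaleR [of 1 _ r] by simp
    finally have *: "(q (y (k + 3)))\<^sup>2 *\<^sub>R y (k + 4) = r *\<^sub>R psi (y (k + 3)) (y (k + 1))" .
    have "y (k + 4) = (1 / (q (y (k + 3)))\<^sup>2) *\<^sub>R ((q (y (k + 3)))\<^sup>2 *\<^sub>R y (k + 4))"
      using k by simp
    then have "y (k + 4) = (r / (q (y (k + 3)))\<^sup>2) *\<^sub>R psi (y (k + 3)) (y (k + 1))"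
      unfolding * by simp
    then show "\<exists>r. y (Suc k + 3) = r *\<^sub>R psi (y (Suc k + 2)) (y (Suc k))"
      by (auto simp: eval_nat_numeral)
  qed
  then show ?thesis
    by (rule iffD1 [OF eventually_sequentially_Suc])
qed

end

section \<open>Countability of the well approximable points\<close>

context rational_form
begin

text \<open>The scalars of \<open>y_recursion\<close> are dropped: \<open>psi\<close> is homogeneous
  in both arguments, so they change each point only by a nonzero factor.\<close>

fun orbit :: "real^3 \<Rightarrow> real^3 \<Rightarrow> real^3 \<Rightarrow> nat \<Rightarrow> real^3" where
  "orbit a b c 0 = a"
| "orbit a b c (Suc 0) = b"
| "orbit a b c (Suc (Suc 0)) = c"
| "orbit a b c (Suc (Suc (Suc n))) = psi (orbit a b c (Suc (Suc n))) (orbit a b c n)"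

end

text \<open>Insensitive to rescaling each \<open>z n\<close> by a nonzero factor, so it passes from
  the turning points to \<open>orbit\<close>.\<close>

definition tends_to_direction :: "(nat \<Rightarrow> real^3) \<Rightarrow> real^3 \<Rightarrow> bool" where
  "tends_to_direction z v \<longleftrightarrow> (\<forall>n. z n \<noteq> 0) \<and> (\<lambda>n. norm (cross3 (z n) v) / norm (z n)) \<longlonglongrightarrow> 0"

text \<open>Up to a relatively small perpendicular part, \<open>z n\<close> is a multiple of
  \<open>v\<close> of comparable length, so its cross product with \<open>w\<close> is about
  \<open>norm (z n)\<close> times that of \<open>v\<close> with \<open>w\<close>.\<close>

lemma tends_to_direction_unique:
  assumes "tends_to_direction z v" "tends_to_direction z w" "norm v = 1"
  shows "cross3 v w = 0"
proof -
  interpret direction v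
    by unfold_locales (fact assms(3))
  let ?f = "\<lambda>n. norm (cross3 (z n) v) / norm (z n)" and ?g = "\<lambda>n. norm (cross3 (z n) w) / norm (z n)"
  have "norm (cross3 v w) \<le> ?g n + ?f n * (norm w + norm (cross3 v w))" for n
  proof -
    define b u where "b = z n \<bullet> v" and "u = perp (z n)"
    have z: "z n = b *\<^sub>R v + u"
      unfolding b_def u_def by (rule decompose)
    have "norm (z n) \<le> norm (b *\<^sub>R v) + norm u"
      unfolding z by (rule norm_triangle_ineq)
    then have b: "norm (z n) \<le> \<bar>b\<bar> + L (z n)"
      by (simp add: u_def norm_perp)
    have "b *\<^sub>R cross3 v w = cross3 (z n) w - cross3 u w"
      unfolding z by (simp add: cross_add_left cross_mult_left)
    then have "\<bar>b\<bar> * norm (cross3 v w) = norm (cross3 (z n) w - cross3 u w)"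
      by (metis norm_scaleR)
    also have "\<dots> \<le> norm (cross3 (z n) w) + norm (cross3 u w)"
      by (rule norm_triangle_ineq4)
    also have "\<dots> \<le> norm (cross3 (z n) w) + L (z n) * norm w"
      using norm_cross3_le [of u w] by (simp add: u_def norm_perp)
    finally have "norm (z n) * norm (cross3 v w)
        \<le> norm (cross3 (z n) w) + L (z n) * (norm w + norm (cross3 v w))"
      using mult_right_mono [OF b, of "norm (cross3 v w)"] by (simp add: algebra_simps)
    moreover have "norm (z n) > 0"
      using assms(1) by (simp add: tends_to_direction_def)
    ultimately show ?thesis
      by (simp add: L_def field_simps)
  qed
  moreover have "(\<lambda>n. ?g n + ?f n * (norm w + norm (cross3 v w))) \<longlonglongrightarrow> 0 + 0 * (norm w + norm (cross3 v w))"
    using assms(1,2) unfolding tends_to_direction_def by (intro tendsto_intros) auto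
  ultimately have "norm (cross3 v w) \<le> 0 + 0 * (norm w + norm (cross3 v w))"
    by (intro LIMSEQ_le_const) auto
  then show ?thesis
    by simp
qed

text \<open>From some index on, the turning points are nonzero multiples of the orbit points; their
  distances stay bounded while their norms tend to infinity.\<close>

lemma (in conic_minimal_sequence) orbit_tends_to:
  assumes solvable: "\<forall>\<^sub>F X in at_top. approx_solvable v (618 / 1000) c X" and "0 < c"
  shows "\<exists>a b d. ivec a \<and> ivec b \<and> ivec d \<and> tends_to_direction (orbit a b d) v"
proof -
  obtain m where m: "\<And>k. k \<ge> m \<Longrightarrow> \<exists>r. y (k + 3) = r *\<^sub>R psi (y (k + 2)) (y k)"
    using y_recursion [OF assms] by (auto simp: eventually_sequentially)
  define z where "z = orbit (y m) (y (m + 1)) (y (m + 2))"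
  have parallel: "\<exists>r. r \<noteq> 0 \<and> y (m + n) = r *\<^sub>R z n" for n
  proof (induction n rule: less_induct)
    case (less n)
    show ?case
    proof (cases n rule: nat_cases_3)
      case (4 i)
      obtain r1 where r1: "y (m + i) = r1 *\<^sub>R z i"
        using less [of i] 4 by auto
      obtain r2 where r2: "y (m + (i + 2)) = r2 *\<^sub>R z (i + 2)"
        using less [of "i + 2"] 4 by auto
      obtain r where "y (m + i + 3) = r *\<^sub>R psi (y (m + i + 2)) (y (m + i))"
        using m [of "m + i"] by auto
      also have "\<dots> = r *\<^sub>R psi (r2 *\<^sub>R z (i + 2)) (r1 *\<^sub>R z i)"
        by (simp only: r1 r2 add.assoc)
      also have "\<dots> = (r * (r2\<^sup>2 * r1)) *\<^sub>R z n"
        by (simp add: psi_scaleR z_def 4 eval_nat_numeral)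
      finally have "y (m + n) = (r * (r2\<^sup>2 * r1)) *\<^sub>R z n"
        by (simp add: 4 add.assoc)
      then show ?thesis
        using y_nonzero by (metis scale_eq_0_iff)
    qed (auto simp: z_def eval_nat_numeral intro: exI [of _ 1])
  qed
  have "z n \<noteq> 0" for n
    using parallel [of n] y_nonzero by (metis scale_zero_right)
  moreover have "(\<lambda>n. norm (cross3 (z n) v) / norm (z n)) \<longlonglongrightarrow> 0"
  proof (rule tendsto_sandwich [OF _ _ tendsto_const])
    have eq: "norm (cross3 (z n) v) / norm (z n) = L (y (m + n)) / norm (y (m + n))" for n
      using parallel [of n] by (auto simp: L_def cross_mult_left)
    have "L (y k) \<le> L (x 0)" for k
      using L_x_antimono [of 0 "turn_index k"] unfolding y_def by (cases "turn_index k = 0") auto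
    then show "\<forall>\<^sub>F n in sequentially. norm (cross3 (z n) v) / norm (z n) \<le> L (x 0) / norm (y (m + n))"
      by (intro always_eventually allI) (simp add: eq divide_right_mono)
    show "\<forall>\<^sub>F n in sequentially. 0 \<le> norm (cross3 (z n) v) / norm (z n)"
      by simp
    have "filterlim (\<lambda>k. norm (y k)) at_top sequentially"
      unfolding norm_y by (rule filterlim_compose [OF exp_at_top ysize_at_top])
    then have "(\<lambda>k. L (x 0) / norm (y k)) \<longlonglongrightarrow> 0"
      by (intro tendsto_divide_0 [OF tendsto_const] filterlim_at_top_imp_at_infinity)
    then show "(\<lambda>n. L (x 0) / norm (y (m + n))) \<longlonglongrightarrow> 0"
      using LIMSEQ_ignore_initial_segment [of "\<lambda>k. L (x 0) / norm (y k)" 0 m] by (simp add: add.commute)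
  qed
  ultimately have "tends_to_direction z v"
    by (simp add: tends_to_direction_def)
  then show ?thesis
    unfolding z_def using ivec_y by blast
qed

lemma unit_representative:
  assumes "P \<in> proj_plane"
  obtains v where "representative v P" "norm v = 1"
proof -
  obtain v where v: "representative v P"
    using representative_exists [OF assms] ..
  show thesis
  proof (rule that)
    show "representative ((1 / norm v) *\<^sub>R v) P"
      using v by (auto simp: representative_def proj_plane_def intro: subspace_scale)
    show "norm ((1 / norm v) *\<^sub>R v) = 1"
      using v by (simp add: representative_def)
  qed
qed

lemma representative_eqI:
  assumes "representative v P" "representative w Q" "cross3 v w = 0"
  shows "P = Q"
proof -
  have "v \<noteq> 0" "w \<noteq> 0"
    using assms by (auto simp: representative_def)
  then obtain r where r: "w = r *\<^sub>R v"
    using assms(3) by (auto simp: cross3_eq_0_iff_parallel)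
  then have "representative w P"
    using assms \<open>w \<noteq> 0\<close> by (auto simp: representative_def proj_plane_def intro: subspace_scale)
  then show ?thesis
    using assms representative_span by metis
qed

section \<open>Points of the conic on rational lines, and countability\<close>

context rational_conic
begin

definition points :: "(real^3) set set" where
  "points = {P \<in> proj_plane. \<forall>v. representative v P \<longrightarrow> q v = 0}"

lemma points_iff:
  assumes "representative v P"
  shows "P \<in> points \<longleftrightarrow> q v = 0"
proof
  assume "q v = 0"
  have "q w = 0" if w: "representative w P" for w
  proof -
    obtain c where "w = c *\<^sub>R v"
      using representative_proportional [OF assms w] by blast
    then show ?thesis
      using \<open>q v = 0\<close> by (simp add: q_scaleR)
  qed
  then show "P \<in> points"
    using assms by (simp add: points_def representative_def)
qed (use assms in \<open>simp add: points_def\<close>)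

text \<open>If \<open>q\<close> vanished on the plane orthogonal to \<open>a\<close>, subtracting
  from \<open>x\<close> its component along \<open>a\<close> would show that
  \<open>a \<bullet> x\<close> divides \<open>B x x\<close>, with the rational cofactor
  \<open>b \<bullet> x\<close>.\<close>

lemma no_rational_line:
  assumes a: "rvec a" "a \<noteq> 0"
  shows "\<exists>w. a \<bullet> w = 0 \<and> q w \<noteq> 0"
proof (rule ccontr)
  assume *: "\<not> ?thesis"
  define b where "b = (2 / (a \<bullet> a)) *\<^sub>R ((\<chi> i. B a (axis i 1)) - (q a / (a \<bullet> a)) *\<^sub>R a)"
  have "rvec b"
    unfolding b_def
    by (intro rvec_scaleR rvec_diff rvec_gradient Rats_divide Rats_number_of rvec_inner rational_q a)
  moreover have "B x x = (a \<bullet> x) * (b \<bullet> x)" for x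
  proof -
    define s where "s = (a \<bullet> x) / (a \<bullet> a)"
    have aa: "a \<bullet> a \<noteq> 0"
      using a by simp
    have "a \<bullet> (x + (- s) *\<^sub>R a) = 0"
      using aa by (simp add: inner_diff_right s_def)
    then have "q (x + (- s) *\<^sub>R a) = 0"
      using * by blast
    moreover have "q (x + (- s) *\<^sub>R a) = q x - s * B a x + s\<^sup>2 * q a"
      unfolding q_add q_scaleR B_simps sym [of x a] by simp
    ultimately have "q x = s * (B a x - s * q a)"
      by (simp add: algebra_simps power2_eq_square)
    moreover have "b \<bullet> x = 2 / (a \<bullet> a) * (B a x - s * q a)"
      by (simp add: b_def inner_diff_left s_def B_eq_inner [of a x])
    ultimately show ?thesis
      by (simp add: B_self s_def)
  qed
  ultimately show False
    using irred [OF a(1)] by blast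
qed

text \<open>A third zero \<open>s * v1 + t * v2\<close> with \<open>s\<close>, \<open>t\<close>
  nonzero gives \<open>s * t * B v1 v2 = 0\<close>, so \<open>q\<close> would vanish on the whole
  plane.\<close>

lemma at_most_two_on_line:
  assumes a: "rvec a" "a \<noteq> 0" and "a \<bullet> v1 = 0" "a \<bullet> v2 = 0" "a \<bullet> v3 = 0"
    and q: "q v1 = 0" "q v2 = 0" "q v3 = 0" and nz: "v1 \<noteq> 0" "v2 \<noteq> 0"
  shows "cross3 v1 v2 = 0 \<or> cross3 v1 v3 = 0 \<or> cross3 v2 v3 = 0"
proof (rule ccontr)
  assume *: "\<not> ?thesis"
  obtain r where r: "a = r *\<^sub>R cross3 v1 v2"
    using orthogonal_both_imp_cross3 assms * by metis
  then have D: "vol v1 v2 a \<noteq> 0"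
    using a * by (simp add: vol_def)
  have expand: "\<exists>s t. w = s *\<^sub>R v1 + t *\<^sub>R v2" if "a \<bullet> w = 0" for w
  proof -
    have "cross3 v1 v2 \<bullet> w = 0"
      using that a r by simp
    then have "w = (((1 / vol v1 v2 a) *\<^sub>R cross3 v2 a) \<bullet> w) *\<^sub>R v1
      + (((1 / vol v1 v2 a) *\<^sub>R cross3 a v1) \<bullet> w) *\<^sub>R v2"
      using dual_basis_expand [OF D, of w] by simp
    then show ?thesis
      by blast
  qed
  obtain s t where st: "v3 = s *\<^sub>R v1 + t *\<^sub>R v2"
    using expand assms by blast
  have "s \<noteq> 0" "t \<noteq> 0"
    using * nz unfolding st by (auto simp: cross_mult_right)
  moreover have "q v3 = s * t * B v1 v2"
    unfolding st by (simp add: q_add q_scaleR q B_simps)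
  ultimately have "B v1 v2 = 0"
    using q by simp
  then have "q w = 0" if "a \<bullet> w = 0" for w
    using expand [OF that] q by (auto simp: q_add q_scaleR B_simps)
  then show False
    using no_rational_line [OF a] by blast
qed

text \<open>There are countably many rational lines, and each meets the conic in at most two
  points.\<close>

lemma countable_dependent_points:
  "countable {P \<in> points. \<exists>v a. representative v P \<and> rvec a \<and> a \<noteq> 0 \<and> a \<bullet> v = 0}"
proof -
  define T where "T a = {P \<in> points. \<exists>v. representative v P \<and> a \<bullet> v = 0}" for a
  have "countable (T a)" if a: "rvec a" "a \<noteq> 0" for a
  proof (cases "\<exists>P\<in>T a. \<exists>Q\<in>T a. P \<noteq> Q")
    case True
    then obtain P Q where PQ: "P \<in> T a" "Q \<in> T a" "P \<noteq> Q"
      by blast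
    have "R \<in> {P, Q}" if R: "R \<in> T a" for R
    proof -
      obtain u where u: "representative u P" "a \<bullet> u = 0" "q u = 0"
        using PQ(1) unfolding T_def points_def by blast
      obtain v where v: "representative v Q" "a \<bullet> v = 0" "q v = 0"
        using PQ(2) unfolding T_def points_def by blast
      obtain w where w: "representative w R" "a \<bullet> w = 0" "q w = 0"
        using R unfolding T_def points_def by blast
      have "u \<noteq> 0" "v \<noteq> 0"
        using u v by (simp_all add: representative_def)
      then have "cross3 u v = 0 \<or> cross3 u w = 0 \<or> cross3 v w = 0"
        using at_most_two_on_line [OF a] u v w by blast
      then show ?thesis
        using representative_eqI [OF u(1) v(1)] representative_eqI [OF u(1) w(1)]
          representative_eqI [OF v(1) w(1)] PQ(3) by blast
    qed
    then have "T a \<subseteq> {P, Q}"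
      by blast
    then show ?thesis
      by (rule countable_subset) simp
  next
    case False
    then have "T a \<subseteq> {SOME P. P \<in> T a}"
      by (metis (mono_tags) insertI1 someI subsetI)
    then show ?thesis
      by (rule countable_subset) simp
  qed
  then have "countable (\<Union>a\<in>{a. rvec a} - {0}. T a)"
    by (intro countable_UN countable_Diff countable_rvec) auto
  moreover have "{P \<in> points. \<exists>v a. representative v P \<and> rvec a \<and> a \<noteq> 0 \<and> a \<bullet> v = 0}
      \<subseteq> (\<Union>a\<in>{a. rvec a} - {0}. T a)"
    by (auto simp: T_def)
  ultimately show ?thesis
    by (rule countable_subset [rotated])
qed

text \<open>Rationally dependent points are counted separately. Any other point is determined by a
  rational triple, because an orbit tends to at most one direction.\<close>

lemma countable_well_approximable:
  "countable {P \<in> points. approx_exponent P (618 / 1000)}"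
proof -
  define U where "U = (\<lambda>(a, b, d). {P \<in> proj_plane. \<exists>v. representative v P \<and> norm v = 1 \<and>
      tends_to_direction (orbit a b d) v})"
  have "countable (U p)" for p
  proof -
    have "P = Q" if "P \<in> U p" "Q \<in> U p" for P Q
      using that tends_to_direction_unique representative_eqI unfolding U_def
      by (auto split: prod.splits) blast+
    then have "U p \<subseteq> {SOME P. P \<in> U p}"
      by (metis insertI1 someI subsetI)
    then show ?thesis
      by (rule countable_subset) simp
  qed
  then have "countable (\<Union>p\<in>{a. rvec a} \<times> {a. rvec a} \<times> {a. rvec a}. U p)"
    by (intro countable_UN countable_SIGMA countable_rvec)
  moreover have "P \<in> (\<Union>p\<in>{a. rvec a} \<times> {a. rvec a} \<times> {a. rvec a}. U p)"
    if P: "P \<in> points" "approx_exponent P (618 / 1000)"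
      and indep: "\<nexists>v a. representative v P \<and> rvec a \<and> a \<noteq> 0 \<and> a \<bullet> v = 0" for P
  proof -
    obtain v where v: "representative v P" "norm v = 1"
      using P unit_representative by (auto simp: points_def)
    interpret conic_direction B v
      using P v by unfold_locales (auto simp: points_iff)
    obtain c where c: "c > 0" "\<forall>\<^sub>F X in at_top. approx_solvable v (618 / 1000) c X"
      using P approx_exponent_iff [OF v(1)] by blast
    have "\<exists>x. minimal_sequence v x"
    proof (rule minimal_sequence_exists)
      show "a = 0" if "rvec a" "a \<bullet> v = 0" for a
        using indep v(1) that by blast
      show "\<exists>x. ivec x \<and> x \<noteq> 0 \<and> L x < \<epsilon>" if "\<epsilon> > 0" for \<epsilon>
        by (rule small_if_solvable [OF c(2) _ that]) simp
    qed
    then obtain x where "minimal_sequence v x" ..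
    then interpret conic_minimal_sequence B v x
      by (simp add: conic_minimal_sequence_def minimal_sequence_def conic_direction_axioms)
    obtain a b d where "ivec a" "ivec b" "ivec d" "tends_to_direction (orbit a b d) v"
      using orbit_tends_to [OF c(2,1)] by blast
    moreover have "P \<in> proj_plane"
      using P by (simp add: points_def)
    ultimately have "P \<in> U (a, b, d)" "(a, b, d) \<in> {a. rvec a} \<times> {a. rvec a} \<times> {a. rvec a}"
      using v ivec_imp_rvec by (auto simp: U_def)
    then show ?thesis
      by blast
  qed
  then have "{P \<in> points. approx_exponent P (618 / 1000)}
      \<subseteq> {P \<in> points. \<exists>v a. representative v P \<and> rvec a \<and> a \<noteq> 0 \<and> a \<bullet> v = 0} \<union>
        (\<Union>p\<in>{a. rvec a} \<times> {a. rvec a} \<times> {a. rvec a}. U p)"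
    by (intro subsetI) (metis (mono_tags, lifting) UnI1 UnI2 mem_Collect_eq)
  ultimately show ?thesis
    using countable_dependent_points by (meson countable_Un countable_subset)
qed

lemma golden_exponent_strict:
  assumes P: "P \<in> points" and v: "representative v P"
    and indep: "\<And>a. rvec a \<Longrightarrow> a \<bullet> v = 0 \<Longrightarrow> a = 0"
    and ex: "approx_exponent P (1 / golden)"
  shows "strict_approx_exponent P (1 / golden)"
proof -
  obtain u where u: "representative u P" "norm u = 1"
    using P unit_representative by (auto simp: points_def)
  obtain r where "v = r *\<^sub>R u"
    using representative_proportional [OF u(1) v] by blast
  then have indep': "a = 0" if "rvec a" "a \<bullet> u = 0" for a
    using indep that by simp
  interpret conic_direction B u
    using P u by unfold_locales (auto simp: points_iff)
  obtain c where c: "c > 0" "\<forall>\<^sub>F X in at_top. approx_solvable u (1 / golden) c X"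
    using ex approx_exponent_iff [OF u(1)] by blast
  have "golden > 0"
    by (simp add: golden_def add_pos_nonneg)
  have "\<exists>x. minimal_sequence u x"
  proof (rule minimal_sequence_exists)
    show "a = 0" if "rvec a" "a \<bullet> u = 0" for a
      using that by (rule indep')
    show "\<exists>x. ivec x \<and> x \<noteq> 0 \<and> L x < \<epsilon>" if "\<epsilon> > 0" for \<epsilon>
      by (rule small_if_solvable [OF c(2) _ that]) (use \<open>golden > 0\<close> in simp)
  qed
  then obtain x where "minimal_sequence u x" ..
  then interpret conic_minimal_sequence B u x
    by (simp add: conic_minimal_sequence_def minimal_sequence_def conic_direction_axioms)
  show ?thesis
    using strict_approx_exponent_iff [OF u(1)] not_solvable_golden ex approx_exponent_iff [OF u(1)]
    by blast
qed

end

section \<open>Pell's equation\<close>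

lemma sqrt_irrational:
  fixes D :: int
  assumes "D > 0" "\<And>z. z\<^sup>2 \<noteq> D"
  shows "sqrt (of_int D) \<notin> \<rat>"
proof
  assume "sqrt (of_int D) \<in> \<rat>"
  then obtain a b :: int where ab: "b > 0" "coprime a b" "sqrt (of_int D) = of_int a / of_int b"
    using Rats_cases' by blast
  have "of_int D = (sqrt (of_int D))\<^sup>2"
    using assms(1) by simp
  then have "real_of_int (D * b\<^sup>2) = of_int (a\<^sup>2)"
    using ab by (simp add: power_divide)
  then have eq: "D * b\<^sup>2 = a\<^sup>2"
    by linarith
  have "coprime (a\<^sup>2) (b\<^sup>2)"
    using ab by simp
  then have "is_unit (b\<^sup>2)"
    using eq by (metis coprime_absorb_left dvd_triv_right coprime_commute)
  then have "b\<^sup>2 = 1"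
    by simp
  then show False
    using eq assms(2) [of a] by simp
qed

text \<open>Dirichlet's approximation theorem gives infinitely many coprime \<open>(h, k)\<close>
  with \<open>h\<^sup>2 - D * k\<^sup>2\<close> bounded. By the pigeonhole principle two of them
  have the same value \<open>N\<close> and are congruent modulo \<open>N\<close>; their quotient is
  integral and of norm 1.\<close>

lemma Pell_solution:
  fixes D :: int
  assumes "D > 0" "\<And>z. z\<^sup>2 \<noteq> D"
  obtains m n :: int where "m\<^sup>2 - D * n\<^sup>2 = 1" "n \<noteq> 0"
proof -
  let ?r = "sqrt (of_int D)"
  define A where "A = approx_set ?r"
  have inf: "infinite A"
    unfolding A_def using rational_iff_finite_approx_set sqrt_irrational [OF assms] by blast
  define f where "f = (\<lambda>(h, k). h\<^sup>2 - D * k\<^sup>2 :: int)"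
  define M where "M = \<lceil>2 * ?r + 1\<rceil>"
  have A: "k > 0" "coprime h k" "f (h, k) \<noteq> 0" "\<bar>f (h, k)\<bar> \<le> M" if "(h, k) \<in> A" for h k
  proof -
    show k: "k > 0" and cop: "coprime h k"
      using that by (auto simp: A_def approx_set_def)
    have less: "\<bar>?r - of_int h / of_int k\<bar> < 1 / (of_int k)\<^sup>2"
      using that by (auto simp: A_def approx_set_def)
    have k1: "real_of_int k \<ge> 1"
      using k by simp
    have "real_of_int (f (h, k)) = (of_int h)\<^sup>2 - (of_int k * ?r)\<^sup>2"
      using assms(1) by (simp add: f_def power_mult_distrib)
    then have eq: "real_of_int (f (h, k)) = (of_int h - of_int k * ?r) * (of_int h + of_int k * ?r)"
      by (simp add: algebra_simps power2_eq_square)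
    have 1: "\<bar>of_int h - of_int k * ?r\<bar> < 1 / of_int k"
    proof -
      have "\<bar>of_int h - of_int k * ?r\<bar> = of_int k * \<bar>?r - of_int h / of_int k\<bar>"
      proof -
        have "of_int h - of_int k * ?r = of_int k * (of_int h / of_int k - ?r)"
          using k by (simp add: field_simps)
        then show ?thesis
          using k by (simp add: abs_mult abs_minus_commute)
      qed
      also have "\<dots> < of_int k * (1 / (of_int k)\<^sup>2)"
        using less k by (intro mult_strict_left_mono) auto
      finally show ?thesis
        using k by (simp add: power2_eq_square)
    qed
    have 2: "\<bar>of_int h + of_int k * ?r\<bar> \<le> of_int k * (2 * ?r + 1)"
    proof -
      have "1 / of_int k \<le> (1::real)"
        using k1 by simp
      moreover have "0 \<le> of_int k * ?r"
        using k1 assms(1) by simp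
      ultimately have "\<bar>of_int h + of_int k * ?r\<bar> \<le> 2 * (of_int k * ?r) + 1"
        using 1 by linarith
      then show ?thesis
        using k1 by (simp add: algebra_simps)
    qed
    have "\<bar>real_of_int (f (h, k))\<bar> \<le> (1 / of_int k) * (of_int k * (2 * ?r + 1))"
      unfolding eq abs_mult by (rule mult_mono) (use 1 2 k1 in auto)
    then have "\<bar>real_of_int (f (h, k))\<bar> \<le> 2 * ?r + 1"
      using k1 by simp
    then show "\<bar>f (h, k)\<bar> \<le> M"
      unfolding M_def by linarith
    show "f (h, k) \<noteq> 0"
    proof
      assume "f (h, k) = 0"
      then have eq: "D * k\<^sup>2 = h\<^sup>2"
        by (simp add: f_def)
      have "coprime (h\<^sup>2) (k\<^sup>2)"
        using cop by simp
      then have "is_unit (k\<^sup>2)"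
        using eq by (metis coprime_absorb_left dvd_triv_right coprime_commute)
      then have "k\<^sup>2 = 1"
        by simp
      then show False
        using eq assms(2) [of h] by simp
    qed
  qed
  have "finite (f ` A)"
    by (rule finite_subset [of _ "{-M..M}"]) (use A(4) in \<open>force simp: abs_le_iff\<close>)+
  then obtain p where p: "p \<in> A" "infinite {a \<in> A. f a = f p}"
    using pigeonhole_infinite inf by blast
  define N where "N = f p"
  have N: "N \<noteq> 0"
    using A(3) p(1) by (cases p) (auto simp: N_def)
  define g where "g = (\<lambda>(h, k). (h mod N, k mod N))"
  have "finite (range (\<lambda>a. a mod N))"
  proof (rule finite_subset)
    show "range (\<lambda>a. a mod N) \<subseteq> {- \<bar>N\<bar>..\<bar>N\<bar>}"
    proof
      fix y assume "y \<in> range (\<lambda>a. a mod N)"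
      then obtain a where "y = a mod N" by blast
      then show "y \<in> {- \<bar>N\<bar>..\<bar>N\<bar>}"
        using abs_mod_less [OF N, of a] by (simp only: atLeastAtMost_iff) linarith
    qed
  qed simp
  then have "finite (range (\<lambda>a. a mod N) \<times> range (\<lambda>a. a mod N))"
    by (intro finite_cartesian_product)
  then have "finite (g ` {a \<in> A. f a = N})"
    by (rule finite_subset [rotated]) (auto simp: g_def)
  then have "\<not> inj_on g {a \<in> A. f a = N}"
    using p(2) finite_imageD unfolding N_def by blast
  then obtain a a' where aa: "a \<in> A" "a' \<in> A" "f a = N" "f a' = N" "g a = g a'" "a \<noteq> a'"
    by (auto simp: inj_on_def)
  obtain h k h' k' where eqs: "a = (h, k)" "a' = (h', k')"
    by fastforce
  have f: "h\<^sup>2 - D * k\<^sup>2 = N" "h'\<^sup>2 - D * k'\<^sup>2 = N"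
    using aa by (simp_all add: eqs f_def)
  have "N dvd h - h'" "N dvd k - k'"
    using aa(5) by (simp_all add: eqs g_def mod_eq_dvd_iff)
  then obtain i j where ij: "h' = h - N * i" "k' = k - N * j"
    by (metis dvdE diff_diff_eq2 add_diff_cancel_left' diff_add_cancel)
  \<comment> \<open>\<open>m + n * sqrt D\<close> is the quotient of \<open>h' + k' * sqrt D\<close>
    by \<open>h + k * sqrt D\<close>.\<close>
  define m n where "m = 1 - (h * i - D * k * j)" and "n = k * i - h * j"
  have mN: "h * h' - D * k * k' = N * m" and nN: "h * k' - h' * k = N * n"
    using f by (simp_all add: ij m_def n_def power2_eq_square algebra_simps)
  have "N\<^sup>2 * (m\<^sup>2 - D * n\<^sup>2) = (N * m)\<^sup>2 - D * (N * n)\<^sup>2"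
    by (simp add: power_mult_distrib algebra_simps)
  also have "\<dots> = (h\<^sup>2 - D * k\<^sup>2) * (h'\<^sup>2 - D * k'\<^sup>2)"
    unfolding mN [symmetric] nN [symmetric] by (simp add: power2_eq_square algebra_simps)
  also have "\<dots> = N\<^sup>2 * 1"
    unfolding f by (simp add: power2_eq_square)
  finally have "m\<^sup>2 - D * n\<^sup>2 = 1"
    using N by simp
  \<comment> \<open>\<open>n = 0\<close> would make two coprime pairs with positive second entries
    proportional, hence equal.\<close>
  moreover have "n \<noteq> 0"
  proof
    assume "n = 0"
    then have eq: "h * k' = h' * k"
      using nN by simp
    have cop: "k > 0" "k' > 0" "coprime h k" "coprime h' k'"
      using A(1,2) aa eqs by blast+
    then have "k dvd k'" "k' dvd k"
      using eq by (metis coprime_commute coprime_dvd_mult_right_iff dvd_triv_right mult.commute)+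
    then have "k = k'"
      using cop by (simp add: zdvd_antisym_nonneg)
    then have "h = h'"
      using eq cop by simp
    then show False
      using aa(6) eqs \<open>k = k'\<close> by simp
  qed
  ultimately show thesis
    by (rule that)
qed

section \<open>Orthogonal bases\<close>

context rational_form
begin

text \<open>Gram-Schmidt applied to \<open>cross3 e f\<close>, which is independent of
  \<open>e\<close> and \<open>f\<close>; the correction does not change the determinant.\<close>

lemma orthogonal_extension:
  assumes "rvec e" "rvec f" "q e \<noteq> 0" "q f \<noteq> 0" "B e f = 0"
  obtains g where "rvec g" "B e g = 0" "B f g = 0" "vol e f g \<noteq> 0"
proof -
  define h where "h = cross3 e f"
  define g where "g = h - ((B e h / (2 * q e)) *\<^sub>R e + (B f h / (2 * q f)) *\<^sub>R f)"
  have "h \<noteq> 0"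
  proof
    assume "h = 0"
    moreover have "e \<noteq> 0"
      using assms by auto
    ultimately obtain r where "f = r *\<^sub>R e"
      by (auto simp: h_def cross3_eq_0_iff_parallel)
    then show False
      using assms by (auto simp: B_simps B_self q_scaleR)
  qed
  moreover have "vol e f g = vol e f h"
    by (simp add: g_def vol_def inner_diff_right inner_add_right dot_cross_self)
  moreover have "rvec g"
    unfolding g_def h_def
    by (intro rvec_diff rvec_add rvec_scaleR rvec_cross3 Rats_divide Rats_mult Rats_number_of
        rational rational_q assms)
  moreover have "B e g = 0" "B f g = 0"
    using assms by (simp_all add: g_def B_simps B_self sym [of f e])
  ultimately show thesis
    by (intro that [of g]) (simp_all add: vol_def h_def)
qed

lemma q_orthogonal_coordinates:
  assumes "rvec e" "rvec f" "rvec g" "vol e f g \<noteq> 0" "B e f = 0" "B e g = 0" "B f g = 0"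
  obtains a b c where "rvec a" "rvec b" "rvec c"
    "\<And>w. q w = q e * (a \<bullet> w)\<^sup>2 + q f * (b \<bullet> w)\<^sup>2 + q g * (c \<bullet> w)\<^sup>2"
    "\<And>w. w = (a \<bullet> w) *\<^sub>R e + (b \<bullet> w) *\<^sub>R f + (c \<bullet> w) *\<^sub>R g"
proof -
  define D where "D = vol e f g"
  have "D \<in> \<rat>"
    unfolding D_def by (intro rvec_vol assms)
  define a b c where "a = (1 / D) *\<^sub>R cross3 f g" and "b = (1 / D) *\<^sub>R cross3 g e"
    and "c = (1 / D) *\<^sub>R cross3 e f"
  have w: "w = (a \<bullet> w) *\<^sub>R e + (b \<bullet> w) *\<^sub>R f + (c \<bullet> w) *\<^sub>R g" for w
    unfolding a_def b_def c_def D_def by (rule dual_basis_expand [OF assms(4)])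
  have "q w = q e * (a \<bullet> w)\<^sup>2 + q f * (b \<bullet> w)\<^sup>2 + q g * (c \<bullet> w)\<^sup>2" for w
  proof -
    define x y z where "x = a \<bullet> w" and "y = b \<bullet> w" and "z = c \<bullet> w"
    have "w = x *\<^sub>R e + y *\<^sub>R f + z *\<^sub>R g"
      unfolding x_def y_def z_def by (rule w)
    then have "q w = q e * x\<^sup>2 + q f * y\<^sup>2 + q g * z\<^sup>2"
      by (simp add: q_add q_scaleR B_simps assms)
    then show ?thesis
      by (simp add: x_def y_def z_def)
  qed
  moreover have "rvec a" "rvec b" "rvec c"
    unfolding a_def b_def c_def
    by (intro rvec_scaleR rvec_cross3 Rats_divide Rats_1 assms \<open>D \<in> \<rat>\<close>)+
  ultimately show thesis
    using w that by blast
qed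

end

context rational_conic
begin

text \<open>Polarisation yields a rational \<open>e\<close> with \<open>q e \<noteq> 0\<close>. If
  all rational vectors orthogonal to \<open>e\<close> were isotropic, \<open>q\<close> would be
  \<open>q e\<close> times the square of a rational linear form.\<close>

lemma orthogonal_pair:
  obtains e f where "rvec e" "rvec f" "q e \<noteq> 0" "q f \<noteq> 0" "B e f = 0"
proof -
  have "\<exists>e. rvec e \<and> q e \<noteq> 0"
  proof (rule ccontr)
    assume *: "\<not> ?thesis"
    have "B x y = 0" if "rvec x" "rvec y" for x y
      using q_add [of x y] * that rvec_add by auto
    then have 1: "B x (axis i 1) = 0" if "rvec x" for x i
      using that by simp
    then have 2: "B (axis i 1) x = 0" for x i
      by (subst B_eq_inner) (simp add: inner_vec_def)
    have "B x x = 0" for x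
      by (subst B_eq_inner) (simp add: inner_vec_def sym [of x] 2)
    then show False
      using irred [of 0 0] by simp
  qed
  then obtain e where e: "rvec e" "q e \<noteq> 0"
    by blast
  have "\<exists>f. rvec f \<and> q f \<noteq> 0 \<and> B e f = 0"
  proof (rule ccontr)
    assume *: "\<not> ?thesis"
    define proj where "proj h = h - (B e h / (2 * q e)) *\<^sub>R e" for h
    have proj: "rvec (proj h)" "B e (proj h) = 0" if "rvec h" for h
      using e that unfolding proj_def
      by (auto intro!: rvec_diff rvec_scaleR Rats_divide Rats_mult rational rational_q
          simp: B_simps B_self)
    have "e \<noteq> 0"
      using e by auto
    then obtain i where i: "cross3 e (axis i 1) \<noteq> 0"
      using cross_basis_nonzero by blast
    define f where "f = proj (axis i 1)"
    define g where "g = proj (cross3 e f)"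
    have f: "rvec f" "B e f = 0" "cross3 e f \<noteq> 0"
      using i proj by (simp_all add: f_def proj_def Cross3.right_diff_distrib cross_mult_right)
    have g: "rvec g" "B e g = 0" "vol e f g \<noteq> 0"
      using proj [of "cross3 e f"] f e
      by (simp_all add: g_def rvec_cross3) (simp add: proj_def vol_def inner_diff_right dot_cross_self)
    have "q f = 0" "q g = 0" "q (f + g) = 0"
      using * f g rvec_add [of f g] by (auto simp: B_simps)
    then have "B f g = 0"
      by (simp add: q_add)
    obtain a b c where abc: "rvec a" "\<And>w. q w = q e * (a \<bullet> w)\<^sup>2 + q f * (b \<bullet> w)\<^sup>2 + q g * (c \<bullet> w)\<^sup>2"
      using q_orthogonal_coordinates [OF e(1) f(1) g(1,3) f(2) g(2) \<open>B f g = 0\<close>] by metis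
    have "B w w = (((2 * q e) *\<^sub>R a) \<bullet> w) * (a \<bullet> w)" for w
      using abc(2) [of w] \<open>q f = 0\<close> \<open>q g = 0\<close> by (simp add: B_self power2_eq_square)
    moreover have "rvec ((2 * q e) *\<^sub>R a)"
      by (intro rvec_scaleR Rats_mult Rats_number_of rational_q e abc)
    ultimately show False
      using irred abc(1) by blast
  qed
  then show thesis
    using e that by blast
qed

text \<open>If neither \<open>q f\<close> nor \<open>q g\<close> had the sign opposite to
  \<open>q e\<close>, the form would be semidefinite with all its zeros on the line of
  \<open>g\<close>, so the conic would have at most one point.\<close>

lemma opposite_sign_pair:
  obtains e f where "rvec e" "rvec f" "q e * q f < 0" "B e f = 0"
proof -
  obtain e f where ef: "rvec e" "rvec f" "q e \<noteq> 0" "q f \<noteq> 0" "B e f = 0"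
    by (rule orthogonal_pair)
  obtain g where g: "rvec g" "B e g = 0" "B f g = 0" "vol e f g \<noteq> 0"
    using orthogonal_extension [OF ef] .
  obtain a b c where q: "\<And>w. q w = q e * (a \<bullet> w)\<^sup>2 + q f * (b \<bullet> w)\<^sup>2 + q g * (c \<bullet> w)\<^sup>2"
    and w: "\<And>w. w = (a \<bullet> w) *\<^sub>R e + (b \<bullet> w) *\<^sub>R f + (c \<bullet> w) *\<^sub>R g"
    using q_orthogonal_coordinates [OF ef(1,2) g(1,4) ef(5) g(2,3)] by metis
  show thesis
  proof (cases "q e * q f < 0 \<or> q e * q g < 0")
    case True
    then show thesis
      using that [OF ef(1,2)] that [OF ef(1) g(1)] ef g by blast
  next
    case False
    then have "q e * q f > 0" "q e * q g \<ge> 0"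
      using ef by (auto simp: not_less zero_less_mult_iff zero_le_mult_iff)
    then have "a \<bullet> w = 0 \<and> b \<bullet> w = 0" if "q w = 0" for w
    proof -
      have "0 = q e * q w"
        using that by simp
      also have "\<dots> = (q e * (a \<bullet> w))\<^sup>2 + (q e * q f) * (b \<bullet> w)\<^sup>2 + (q e * q g) * (c \<bullet> w)\<^sup>2"
        by (subst q) (simp add: algebra_simps power2_eq_square)
      finally have "(q e * (a \<bullet> w))\<^sup>2 + (q e * q f) * (b \<bullet> w)\<^sup>2 + (q e * q g) * (c \<bullet> w)\<^sup>2 = 0"
        by simp
      moreover have "0 \<le> (q e * (a \<bullet> w))\<^sup>2" "0 \<le> (q e * q f) * (b \<bullet> w)\<^sup>2" "0 \<le> (q e * q g) * (c \<bullet> w)\<^sup>2"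
        using \<open>q e * q f > 0\<close> \<open>q e * q g \<ge> 0\<close> by simp_all
      ultimately have "(q e * (a \<bullet> w))\<^sup>2 = 0" "(q e * q f) * (b \<bullet> w)\<^sup>2 = 0"
        by linarith+
      then show ?thesis
        using ef by simp
    qed
    then have "w = (c \<bullet> w) *\<^sub>R g" if "q w = 0" for w
      using w [of w] that by simp
    then have multiple: "\<exists>r. w = r *\<^sub>R g" if "q w = 0" for w
      using that by blast
    have "cross3 v w = 0" if "q v = 0" "q w = 0" for v w
    proof -
      obtain r s where "v = r *\<^sub>R g" "w = s *\<^sub>R g"
        using multiple \<open>q v = 0\<close> \<open>q w = 0\<close> by blast
      then show ?thesis
        by (simp add: cross_mult_left cross_mult_right)
    qed
    then show thesis
      using two_zeros by blast
  qed
qed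

text \<open>The nonsquare \<open>b\<close> is wanted for Pell's equation. If the ratio
  \<open>b0\<close> is not a rational square, clearing its denominator suffices. If it is,
  \<open>f\<close> is tilted towards the third basis vector \<open>g\<close>, where
  \<open>q g \<noteq> 0\<close> by irreducibility.\<close>

lemma nonsquare_pair:
  obtains e f and b :: int where "rvec e" "rvec f" "B e f = 0" "q e \<noteq> 0" "q f = - q e * of_int b"
    "b > 0" "\<And>z. z\<^sup>2 \<noteq> b"
proof -
  obtain e f where ef: "rvec e" "rvec f" "q e * q f < 0" "B e f = 0"
    by (rule opposite_sign_pair)
  have nz: "q e \<noteq> 0" "q f \<noteq> 0"
    using ef by auto
  define b0 where "b0 = - q f / q e"
  have b0: "b0 > 0" "b0 \<in> \<rat>" "q f = - q e * b0"
    using ef nz by (auto simp: b0_def rational_q divide_less_0_iff mult_less_0_iff)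
  show thesis
  proof (cases "\<exists>s\<in>\<rat>. s\<^sup>2 = b0")
    case False
    obtain N :: nat where N: "N > 0" "real N * b0 \<in> \<int>"
      using Rats_denominator b0 by blast
    then obtain n where n: "real N * b0 = of_int n"
      by (auto elim: Ints_cases)
    show thesis
    proof (rule that [of e "real N *\<^sub>R f" "int N * n"])
      have "of_int n > (0::real)"
        using N b0 unfolding n [symmetric] by simp
      then show "int N * n > 0"
        using N by simp
      show "q (real N *\<^sub>R f) = - q e * of_int (int N * n)"
        by (simp add: q_scaleR b0(3) power2_eq_square flip: n)
      show "z\<^sup>2 \<noteq> int N * n" for z
      proof
        assume "z\<^sup>2 = int N * n"
        then have "(real_of_int z)\<^sup>2 = real N * (real N * b0)"
          by (simp add: n flip: of_int_power)
        then have "(real_of_int z / real N)\<^sup>2 = b0"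
          using N by (simp add: power_divide power2_eq_square)
        moreover have "real_of_int z / real N \<in> \<rat>"
          by simp
        ultimately show False
          using False by blast
      qed
    qed (use ef nz rvec_scaleR in \<open>auto simp: B_simps\<close>)
  next
    case True
    then obtain s where s: "s \<in> \<rat>" "s\<^sup>2 = b0"
      by blast
    have s0: "s \<noteq> 0"
      using s b0 by auto
    obtain g where g: "rvec g" "B e g = 0" "B f g = 0" "vol e f g \<noteq> 0"
      using orthogonal_extension [OF ef(1,2) nz ef(4)] .
    have qg: "q g \<noteq> 0"
    proof
      assume "q g = 0"
      obtain a b c where abc: "rvec a" "rvec b"
        "\<And>w. q w = q e * (a \<bullet> w)\<^sup>2 + q f * (b \<bullet> w)\<^sup>2 + q g * (c \<bullet> w)\<^sup>2"
        using q_orthogonal_coordinates [OF ef(1,2) g(1,4) ef(4) g(2,3)] by metis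
      have "B w w = (((2 * q e) *\<^sub>R (a - s *\<^sub>R b)) \<bullet> w) * ((a + s *\<^sub>R b) \<bullet> w)" for w
      proof -
        have "q w = q e * (a \<bullet> w)\<^sup>2 - q e * s\<^sup>2 * (b \<bullet> w)\<^sup>2"
          using abc(3) [of w] \<open>q g = 0\<close> b0(3) s(2) by simp
        then show ?thesis
          by (simp add: B_self inner_diff_left inner_add_left power2_eq_square algebra_simps)
      qed
      moreover have "rvec ((2 * q e) *\<^sub>R (a - s *\<^sub>R b))" "rvec (a + s *\<^sub>R b)"
        by (intro rvec_scaleR rvec_diff rvec_add Rats_mult Rats_number_of rational_q ef s abc)+
      ultimately show False
        using irred by blast
    qed
    define c0 where "c0 = - q g / q e"
    have c0: "c0 \<in> \<rat>" "c0 \<noteq> 0" "q g = - q e * c0"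
      using nz qg by (simp_all add: c0_def rational_q ef g)
    obtain N :: nat where N: "N > 0" "real N * c0 \<in> \<int>"
      using Rats_denominator c0 by blast
    then obtain n where n: "real N * c0 = of_int n"
      by (auto elim: Ints_cases)
    define c where "c = int N * n"
    \<comment> \<open>With this \<open>k\<close> the integer \<open>k\<^sup>2 + c\<close> lies
      strictly between \<open>(k - 1)\<^sup>2\<close> and \<open>(k + 1)\<^sup>2\<close> and differs
      from \<open>k\<^sup>2\<close>, so it is not a square.\<close>
    define k where "k = \<bar>c\<bar> + 1"
    have "n \<noteq> 0"
      using N c0 n by auto
    then have c: "c \<noteq> 0" "of_int c = c0 * (real N)\<^sup>2"
      using N(1) by (simp_all add: c_def power2_eq_square flip: n)
    have nonsquare: "z\<^sup>2 \<noteq> k\<^sup>2 + c" for z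
    proof
      assume z: "z\<^sup>2 = k\<^sup>2 + c"
      have "(\<bar>z\<bar>)\<^sup>2 < (k + 1)\<^sup>2" "(k - 1)\<^sup>2 < (\<bar>z\<bar>)\<^sup>2"
        unfolding power2_abs z by (simp_all add: k_def power2_eq_square algebra_simps)
      then have "\<bar>z\<bar> < k + 1" "k - 1 < \<bar>z\<bar>"
        using power_less_imp_less_base [of "\<bar>z\<bar>" 2 "k + 1"] power_less_imp_less_base [of "k - 1" 2 "\<bar>z\<bar>"]
        by (simp_all add: k_def)
      then have "\<bar>z\<bar> = k"
        by simp
      then have "z\<^sup>2 = k\<^sup>2"
        by (metis power2_abs)
      then show False
        using z c(1) by simp
    qed
    define h where "h = (of_int k / s) *\<^sub>R f + real N *\<^sub>R g"
    show thesis
    proof (rule that [of e h "k\<^sup>2 + c"])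
      show "rvec h"
        unfolding h_def by (intro rvec_add rvec_scaleR Rats_divide Rats_of_int Rats_of_nat s ef g)
      show "B e h = 0"
        by (simp add: h_def B_simps ef g)
      have "q h = (of_int k / s)\<^sup>2 * q f + (real N)\<^sup>2 * q g"
        by (simp add: h_def q_add q_scaleR B_simps g)
      also have "\<dots> = - q e * ((of_int k)\<^sup>2 + of_int c)"
        using s0 by (simp add: b0(3) c0(3) c(2) power_divide algebra_simps flip: s(2))
      finally show "q h = - q e * of_int (k\<^sup>2 + c)"
        by simp
      have "\<bar>c\<bar> * 1 \<le> k * k"
        unfolding k_def by (intro mult_mono) auto
      then have "0 \<le> k\<^sup>2 + c"
        by (simp add: power2_eq_square)
      then show "0 < k\<^sup>2 + c"
        using nonsquare [of 0] by simp
    qed (use ef nz nonsquare in auto)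
  qed
qed

text \<open>In this basis \<open>q\<close> is \<open>q e\<close> times
  \<open>X\<^sup>2 - b * Y\<^sup>2 - c * Z\<^sup>2\<close>. The nonsquare \<open>b\<close> serves
  Pell's equation, and \<open>b + c\<close> becomes the positive integer \<open>d\<close> of
  \<open>starting_points\<close>.\<close>

lemma diagonal_basis:
  obtains e f g and b c :: int where "rvec e" "rvec f" "rvec g" "vol e f g \<noteq> 0"
    "B e f = 0" "B e g = 0" "B f g = 0" "q e \<noteq> 0"
    "q f = - q e * of_int b" "q g = - q e * of_int c" "b > 0" "\<And>z. z\<^sup>2 \<noteq> b" "b + c \<ge> 1"
proof -
  obtain e f and b :: int where ef: "rvec e" "rvec f" "B e f = 0" "q e \<noteq> 0" "q f = - q e * of_int b"
    "b > 0" "\<And>z. z\<^sup>2 \<noteq> b"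
    using nonsquare_pair by metis
  have "q f \<noteq> 0"
    using ef by simp
  obtain g where g: "rvec g" "B e g = 0" "B f g = 0" "vol e f g \<noteq> 0"
    using orthogonal_extension [OF ef(1,2,4) \<open>q f \<noteq> 0\<close> ef(3)] .
  define c0 where "c0 = - q g / q e"
  have c0: "c0 \<in> \<rat>" "q g = - q e * c0"
    using ef by (simp_all add: c0_def rational_q g)
  obtain N :: nat where N: "N > 0" "real N * c0 \<in> \<int>"
    using Rats_denominator c0 by blast
  then obtain n where n: "real N * c0 = of_int n"
    by (auto elim: Ints_cases)
  define c where "c = int N * n"
  \<comment> \<open>Scaling \<open>f\<close> by \<open>k\<close> multiplies \<open>b\<close> by a
    square large enough to outweigh a negative \<open>c\<close>.\<close>
  define k where "k = \<bar>c\<bar> + 1"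
  have k: "k > 0"
    by (simp add: k_def)
  show thesis
  proof (rule that [of e "of_int k *\<^sub>R f" "real N *\<^sub>R g" "k\<^sup>2 * b" c])
    show "vol e (of_int k *\<^sub>R f) (real N *\<^sub>R g) \<noteq> 0"
      using g(4) N k by (simp add: vol_def cross_mult_right)
    show "q (of_int k *\<^sub>R f) = - q e * of_int (k\<^sup>2 * b)" "q (real N *\<^sub>R g) = - q e * of_int c"
      by (simp_all add: q_scaleR ef(5) c0(2) c_def power2_eq_square flip: n)
    show "k\<^sup>2 * b > 0"
      using k ef by simp
    show "z\<^sup>2 \<noteq> k\<^sup>2 * b" for z
      using ef(7) k by (intro square_mult_nonsquare) auto
    have "k * 1 \<le> k * (k * b)"
      using k ef(6) by (intro mult_left_mono) (auto intro: mult_pos_pos simp: int_one_le_iff_zero_less)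
    then have "k \<le> k\<^sup>2 * b"
      by (simp add: power2_eq_square mult.assoc)
    then show "1 \<le> k\<^sup>2 * b + c"
      using abs_ge_minus_self [of c] unfolding k_def by linarith
  qed (use ef g in \<open>auto simp: B_simps intro: rvec_scaleR\<close>)
qed

end

section \<open>Points with Fibonacci growth\<close>

text \<open>
  If \<open>q (x n) = 1\<close> and \<open>t n = B (x n) (x (n - 2))\<close>, the recursion for \<open>x\<close> is
  \<open>x (n + 1) = psi (x n) (x (n - 2))\<close>, and it implies the one for \<open>t\<close>.
\<close>

locale fibonacci_points =
  fixes x :: "nat \<Rightarrow> real^3" and t :: "nat \<Rightarrow> real"
  assumes x_rec: "x (n + 3) = t (n + 2) *\<^sub>R x (n + 2) - x n"
    and t_rec: "t (n + 3) = t (n + 2) * t (n + 1) - t n"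
    and t_init: "10 \<le> t 0" "t 0 \<le> t 1" "t 1 \<le> t 2"
    and vol_init: "vol (x 0) (x 1) (x 2) \<noteq> 0"
    and denominator: "\<exists>N::nat. N > 0 \<and> (\<forall>n. ivec (real N *\<^sub>R x n))"
begin

lemma t_mono_ge_10: "10 \<le> t n \<and> t n \<le> t (n + 1) \<and> t (n + 1) \<le> t (n + 2)"
proof (induction n)
  case 0
  then show ?case
    using t_init by (simp add: numeral_2_eq_2)
next
  case (Suc n)
  have "t (n + 2) * 10 \<le> t (n + 2) * t (n + 1)"
    using Suc by (intro mult_left_mono) auto
  then have "t (n + 2) \<le> t (n + 3)"
    using Suc t_rec [of n] by linarith
  then show ?case
    using Suc by (simp add: eval_nat_numeral)
qed

lemma t_ge_10: "10 \<le> t n" and t_mono: "t n \<le> t (n + 1)"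
  using t_mono_ge_10 by blast+

lemma t_incseq: "i \<le> j \<Longrightarrow> t i \<le> t j"
  by (rule lift_Suc_mono_le [of t]) (use t_mono in simp_all)

lemma t_pos [simp]: "0 < t n" "t n \<noteq> 0"
  using t_ge_10 [of n] by auto

lemma abs_t [simp]: "\<bar>t n\<bar> = t n"
  by (simp add: less_imp_le)

lemma t_product: "10 * t (n + 2) \<le> t (n + 2) * t (n + 1)"
  using mult_left_mono [OF t_ge_10 [of "n + 1"], of "t (n + 2)"] by (simp add: less_imp_le)

text \<open>The initial bound 10 makes the product outweigh the subtracted \<open>t n\<close>, with
  room for the 2 that \<open>growth_bound\<close> subtracts.\<close>

lemma t_double: "2 * t (n + 2) \<le> t (n + 3)"
  and t_product_le: "t (n + 2) * t (n + 1) \<le> 2 * (t (n + 3) - 2)"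
proof -
  define P where "P = t (n + 2) * t (n + 1)"
  have "t (n + 3) = P - t n" "10 * t (n + 2) \<le> P"
    using t_rec [of n] t_product [of n] by (simp_all add: P_def)
  moreover have "10 \<le> t n" "t n \<le> t (n + 2)"
    using t_mono_ge_10 [of n] by auto
  ultimately have "2 * t (n + 2) \<le> t (n + 3) \<and> P \<le> 2 * (t (n + 3) - 2)"
    by auto
  then show "2 * t (n + 2) \<le> t (n + 3)" "t (n + 2) * t (n + 1) \<le> 2 * (t (n + 3) - 2)"
    by (simp_all only: P_def)
qed

lemma t_power: "2 ^ n \<le> t (n + 2)"
proof (induction n)
  case 0
  then show ?case
    using t_ge_10 [of 2] by (simp add: numeral_2_eq_2)
next
  case (Suc n)
  then show ?case
    using t_double [of n] by (simp add: eval_nat_numeral)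
qed

lemma t_at_top: "filterlim t at_top sequentially"
proof -
  have "real n \<le> t (n + 2)" for n
    using t_power [of n] of_nat_less_two_power [of n, where 'a = real] by linarith
  then have "filterlim (\<lambda>n. t (n + 2)) at_top sequentially"
    by (intro filterlim_at_top_mono [OF filterlim_real_sequentially]) simp
  then show ?thesis
    using filterlim_sequentially_Suc [of t] filterlim_sequentially_Suc [of "\<lambda>n. t (Suc n)"] by simp
qed

text \<open>
  The subtracted \<open>2\<close> turns the majorant \<open>t\<close>, which satisfies the recursion with the wrong sign of the
  last term, into a supersolution.
\<close>

lemma growth_bound:
  assumes rec: "\<And>j. a (j + 3) \<le> t (j + s + 2) * a (j + 2) + a j"
    and init: "a 0 \<le> M * (t (s + 1) - 2)" "a 1 \<le> M * (t (s + 2) - 2)" "a 2 \<le> M * (t (s + 3) - 2)"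
    and M: "0 \<le> M"
  shows "a j \<le> M * (t (j + s + 1) - 2)"
proof (induction j rule: less_induct)
  case (less j)
  show ?case
  proof (cases j rule: nat_cases_3)
    case (4 i)
    have "a j \<le> t (i + s + 2) * a (i + 2) + a i"
      using rec 4 by simp
    also have "\<dots> \<le> t (i + s + 2) * (M * (t (i + 2 + s + 1) - 2)) + M * (t (i + s + 1) - 2)"
      using less [of "i + 2"] less [of i] 4 by (intro add_mono mult_left_mono) (auto intro: less_imp_le)
    also have "\<dots> = M * (t (i + s + 2) * (t (i + s + 3) - 2) + (t (i + s + 1) - 2))"
      by (simp add: algebra_simps eval_nat_numeral)
    \<comment> \<open>By \<open>t_rec\<close> this reduces to the monotonicity
      \<open>t (i + s + 1) \<le> t (i + s + 2)\<close>.\<close>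
    also have "\<dots> \<le> M * (t (j + s + 1) - 2)"
      using M t_rec [of "i + s + 1"] t_mono [of "i + s + 1"]
      by (intro mult_left_mono) (simp_all add: 4 algebra_simps eval_nat_numeral)
    finally show ?thesis .
  qed (use init in \<open>auto simp: numeral_2_eq_2 numeral_3_eq_3\<close>)
qed

section \<open>Upper bounds for norms and cross products\<close>

lemma norm_x_bound: "\<exists>M>0. \<forall>n. norm (x n) \<le> M * t (n + 1)"
proof -
  define M where "M = norm (x 0) + norm (x 1) + norm (x 2) + 1"
  have init: "norm (x i) \<le> M * (t j - 2)" if "i \<in> {0, 1, 2}" for i j
  proof -
    have "norm (x i) \<le> M"
      using that by (auto simp: M_def)
    moreover have "M * 1 \<le> M * (t j - 2)"
      using t_ge_10 [of j] by (intro mult_left_mono) (auto simp: M_def intro: add_nonneg_nonneg)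
    ultimately show ?thesis
      by simp
  qed
  have "norm (x n) \<le> M * (t (n + 0 + 1) - 2)" for n
  proof (rule growth_bound)
    show "norm (x (j + 3)) \<le> t (j + 0 + 2) * norm (x (j + 2)) + norm (x j)" for j
      using norm_triangle_ineq4 [of "t (j + 2) *\<^sub>R x (j + 2)" "x j"]
      by (simp add: x_rec less_imp_le)
  qed (use init in \<open>auto simp: M_def intro: add_nonneg_nonneg\<close>)
  moreover have "M > 0"
    by (simp add: M_def add_nonneg_pos)
  moreover have "M * (t (n + 0 + 1) - 2) \<le> M * t (n + 1)" for n
    using \<open>M > 0\<close> by simp
  ultimately show ?thesis
    by (meson order_trans)
qed

lemma cross3_step: "norm (cross3 (x (n + 3)) (x (n + 2))) = norm (cross3 (x (n + 2)) (x n))"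
proof -
  have "cross3 (x (n + 3)) (x (n + 2)) = cross3 (x (n + 2)) (x n)"
    using cross_skew [of "x n" "x (n + 2)"]
    by (simp add: x_rec Cross3.left_diff_distrib cross_mult_left)
  then show ?thesis
    by simp
qed

text \<open>The trivial bound is of order \<open>t (n + 1) * t (n + 2)\<close>. But
  \<open>cross3_step\<close> trades a consecutive pair for an earlier pair two steps apart, whose
  expansion gives a recursion of the shape of \<open>t_rec\<close> and hence growth like
  \<open>t n\<close>.\<close>

lemma consecutive_cross3_bound:
  "\<exists>K>0. \<forall>n. norm (cross3 (x (n + 1)) (x n)) \<le> K * (t n - 2)"
proof -
  define w where "w n = cross3 (x (n + 1)) (x n)" for n
  have rec: "norm (w (n + 3)) \<le> t (n + 2) * norm (w (n + 1)) + norm (w n)" for n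
  proof -
    have "norm (w (n + 3)) = norm (cross3 (x (n + 3)) (x (n + 1)))"
      using cross3_step [of "n + 1"] by (simp add: w_def eval_nat_numeral)
    also have "cross3 (x (n + 3)) (x (n + 1)) = t (n + 2) *\<^sub>R w (n + 1) + w n"
      using cross_skew [of "x n" "x (n + 1)"]
      by (simp add: x_rec Cross3.left_diff_distrib cross_mult_left w_def)
    also have "norm \<dots> \<le> t (n + 2) * norm (w (n + 1)) + norm (w n)"
      using norm_triangle_ineq [of "t (n + 2) *\<^sub>R w (n + 1)" "w n"] by (simp add: less_imp_le)
    finally show ?thesis .
  qed
  define K where "K = norm (w 0) + norm (w 1) + norm (w 2) + 1"
  have K: "K > 0"
    by (simp add: K_def add_nonneg_pos)
  have init: "norm (w i) \<le> K * (t i - 2)" if "i \<in> {0, 1, 2}" for i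
  proof -
    have "norm (w i) \<le> K"
      using that by (auto simp: K_def)
    moreover have "K * 1 \<le> K * (t i - 2)"
      using t_ge_10 [of i] K by (intro mult_left_mono) auto
    ultimately show ?thesis
      by simp
  qed
  have "norm (w n) \<le> K * (t n - 2)" for n
  proof (induction n rule: less_induct)
    case (less n)
    show ?case
    proof (cases n rule: nat_cases_3)
      case (4 i)
      have "norm (w n) \<le> t (i + 2) * norm (w (i + 1)) + norm (w i)"
        using rec 4 by simp
      also have "\<dots> \<le> t (i + 2) * (K * (t (i + 1) - 2)) + K * (t i - 2)"
        using less [of "i + 1"] less [of i] 4 by (intro add_mono mult_left_mono) (auto intro: less_imp_le)
      also have "\<dots> = K * (t (i + 2) * (t (i + 1) - 2) + (t i - 2))"
        by (simp add: algebra_simps)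
      also have "\<dots> \<le> K * (t n - 2)"
        using K t_rec [of i] t_mono_ge_10 [of i]
        by (intro mult_left_mono) (simp_all add: 4 algebra_simps)
      finally show ?thesis .
    qed (use init in auto)
  qed
  then show ?thesis
    using K by (auto simp: w_def)
qed

text \<open>For fixed \<open>i\<close> the cross products obey the recursion of \<open>x\<close> in
  \<open>j\<close>, so they grow at most like \<open>t (i + j + 2)\<close>. The factor
  \<open>1 / t (i + 2)\<close>, inherited from the initial ones, becomes up to a constant the
  distance from \<open>x (Suc i)\<close> to the limit line.\<close>

lemma cross3_bound:
  "\<exists>K>0. \<forall>i j. norm (cross3 (x (Suc i)) (x (Suc i + j))) \<le> K / t (i + 2) * t (i + j + 2)"
proof -
  obtain K where K: "K > 0" "\<And>n. norm (cross3 (x (n + 1)) (x n)) \<le> K * (t n - 2)"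
    using consecutive_cross3_bound by blast
  have main: "norm (cross3 (x (Suc i)) (x (Suc i + j))) \<le> 2 * K / t (i + 2) * t (i + j + 2)" for i j
  proof -
    define M where "M = 2 * K / t (i + 2)"
    have M: "0 \<le> M" "M * t (i + 2) = 2 * K"
      using K(1) by (simp_all add: M_def less_imp_le)
    define p where "p j = cross3 (x (Suc i)) (x (Suc i + j))" for j
    have large: "K * t n \<le> M * (t m - 2)" if "t n * t (i + 2) + 4 \<le> 2 * (t m - 2) + 4" for n m
    proof -
      have "K * (t n * t (i + 2)) \<le> K * (2 * (t m - 2))"
        using that K(1) by (intro mult_left_mono) auto
      then show ?thesis
        by (simp add: M_def field_simps)
    qed
    have p1: "norm (p 1) \<le> K * t (i + 1)"
    proof -
      have "norm (p 1) = norm (cross3 (x (i + 1 + 1)) (x (i + 1)))"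
        using cross_skew [of "x (Suc i)" "x (Suc (Suc i))"] by (simp add: p_def)
      also have "\<dots> \<le> K * (t (i + 1) - 2)"
        by (rule K(2))
      also have "\<dots> \<le> K * t (i + 1)"
        using K(1) by simp
      finally show ?thesis .
    qed
    have p2: "norm (p 2) \<le> K * t (i + 3)"
    proof -
      have "norm (p 2) = norm (cross3 (x (i + 1 + 2)) (x (i + 1)))"
        using cross_skew [of "x (Suc i)" "x (i + 3)"] by (simp add: p_def eval_nat_numeral)
      also have "\<dots> = norm (cross3 (x (i + 3 + 1)) (x (i + 3)))"
        using cross3_step [of "i + 1"] by (simp add: eval_nat_numeral)
      also have "\<dots> \<le> K * (t (i + 3) - 2)"
        by (rule K(2))
      also have "\<dots> \<le> K * t (i + 3)"
        using K(1) by simp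
      finally show ?thesis .
    qed
    have "norm (p j) \<le> M * (t (j + Suc i + 1) - 2)"
    proof (rule growth_bound)
      show "norm (p (j + 3)) \<le> t (j + Suc i + 2) * norm (p (j + 2)) + norm (p j)" for j
      proof -
        have "p (j + 3) = t (j + Suc i + 2) *\<^sub>R p (j + 2) - p j"
          using x_rec [of "Suc i + j"]
          by (simp add: p_def Cross3.right_diff_distrib cross_mult_right eval_nat_numeral add.commute add.left_commute)
        then show ?thesis
          using norm_triangle_ineq4 [of "t (j + Suc i + 2) *\<^sub>R p (j + 2)" "p j"] by (simp add: less_imp_le)
      qed
      show "norm (p 0) \<le> M * (t (Suc i + 1) - 2)"
        using M(1) t_ge_10 [of "Suc i + 1"] by (simp add: p_def)
      have "t (i + 1) * t (i + 2) \<le> 2 * (t (i + 3) - 2)"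
        using t_product_le [of i] by (simp add: mult.commute)
      then show "norm (p 1) \<le> M * (t (Suc i + 2) - 2)"
        using order_trans [OF p1 large] by (simp add: eval_nat_numeral)
      have "t (i + 3) * t (i + 2) \<le> 2 * (t (i + 4) - 2)"
        using t_product_le [of "i + 1"] by (simp add: mult.commute eval_nat_numeral)
      then show "norm (p 2) \<le> M * (t (Suc i + 3) - 2)"
        using order_trans [OF p2 large] by (simp add: eval_nat_numeral)
    qed (rule M)
    also have "\<dots> \<le> M * t (i + j + 2)"
      using M(1) by (intro mult_left_mono) (simp_all add: add.commute)
    finally show ?thesis
      by (simp add: p_def M_def)
  qed
  then show ?thesis
    using K(1) by (intro exI [of _ "2 * K"]) auto
qed

section \<open>Limit points of the normalised sequence\<close>

lemma vol_x_nonzero: "vol (x n) (x (n + 1)) (x (n + 2)) \<noteq> 0"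
proof (induction n)
  case 0
  then show ?case
    using vol_init by (simp add: numeral_2_eq_2)
next
  case (Suc n)
  have "vol (x (n + 1)) (x (n + 2)) (x (n + 3)) = - vol (x (n + 1)) (x (n + 2)) (x n)"
    by (simp add: x_rec vol_def inner_diff_right dot_cross_self)
  then show ?case
    using Suc vol_rotate [of "x n"] by (simp add: eval_nat_numeral)
qed

text \<open>Dividing by \<open>t (n + 1)\<close>, which bounds \<open>norm (x n)\<close> up to a
  constant, instead of by the norm itself keeps linear forms of \<open>u n\<close> in a linear
  recursion.\<close>

definition u :: "nat \<Rightarrow> real^3" where "u n = (1 / t (n + 1)) *\<^sub>R x n"

lemma norm_u_bound: "\<exists>M>0. \<forall>n. norm (u n) \<le> M"
  using norm_x_bound by (auto simp: u_def pos_divide_le_eq)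

text \<open>
  The linear form \<open>z \<mapsto> vol (x 0) (x 1) z\<close>, normalised at \<open>x 2\<close>, is nondecreasing along \<open>u\<close>; this
  keeps the limit points of \<open>u\<close> away from \<open>0\<close>.
\<close>

lemma vol_u_bound: "1 / t 3 \<le> vol (x 0) (x 1) (u (n + 2)) / vol (x 0) (x 1) (x 2)"
proof -
  define f where "f z = vol (x 0) (x 1) z / vol (x 0) (x 1) (x 2)" for z
  have f_scale: "f (c *\<^sub>R z) = c * f z" and f_diff: "f (z - z') = f z - f z'" for c z z'
    by (simp_all add: f_def vol_def inner_diff_right diff_divide_distrib)
  have f_x: "f (x n) = t (n + 1) * f (u n)" for n
    by (simp add: u_def f_scale)
  \<comment> \<open>By \<open>t_rec\<close> each increment of \<open>f\<close> along
    \<open>u\<close> is a positive multiple of an earlier difference, so signs persist.\<close>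
  have f_u: "(f (u (n + 3)) - f (u (n + 2))) * t (n + 4) = t (n + 1) * (f (u (n + 2)) - f (u n))" for n
  proof -
    have "t (n + 4) * f (u (n + 3)) = t (n + 2) * f (x (n + 2)) - f (x n)"
    proof -
      have "f (x (n + 3)) = t (n + 2) * f (x (n + 2)) - f (x n)"
        by (simp only: x_rec f_scale f_diff)
      then show ?thesis
        using f_x [of "n + 3"] by (simp add: eval_nat_numeral)
    qed
    also have "\<dots> = t (n + 2) * t (n + 3) * f (u (n + 2)) - t (n + 1) * f (u n)"
      by (simp add: f_x eval_nat_numeral)
    also have "t (n + 2) * t (n + 3) = t (n + 4) + t (n + 1)"
      using t_rec [of "n + 1"] by (simp add: eval_nat_numeral mult.commute)
    finally show ?thesis
      by (simp add: algebra_simps)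
  qed
  have f2: "f (u 2) = 1 / t 3"
    using vol_init by (simp add: u_def f_scale) (simp add: f_def)
  have "f (u n) \<le> f (u (n + 1)) \<and> f (u (n + 1)) \<le> f (u (n + 2))" for n
  proof (induction n)
    case 0
    have "f (u 0) = 0" "f (u 1) = 0"
      by (simp_all add: f_def u_def vol_def dot_cross_self)
    then show ?case
      using f2 by (simp add: numeral_2_eq_2 less_imp_le)
  next
    case (Suc n)
    have "0 \<le> (f (u (n + 3)) - f (u (n + 2))) * t (n + 4)"
      unfolding f_u using Suc by (simp add: less_imp_le)
    then have "0 \<le> f (u (n + 3)) - f (u (n + 2))"
      by (simp add: zero_le_mult_iff) (meson t_pos not_le)
    then show ?case
      using Suc by (simp add: eval_nat_numeral)
  qed
  then have "f (u 2) \<le> f (u (n + 2))"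
    by (intro lift_Suc_mono_le [of "\<lambda>n. f (u n)" 2 "n + 2"]) auto
  then show ?thesis
    unfolding f2 by (simp add: f_def)
qed

text \<open>\<open>\<sigma> n\<close> measures how far \<open>ln (t n)\<close> is from growing with
  ratio \<open>golden\<close>. The identity \<open>l * (1 + l) = 1\<close> gives
  \<open>\<sigma> (Suc n) = - l * \<sigma> n\<close> up to a bounded error, a contraction, so
  \<sigma> stays bounded.\<close>

lemma t_golden_growth: "\<exists>C>0. \<forall>n. t (n + 2) powr (1 / golden) \<le> C * t (n + 1)"
proof -
  define l where "l = 1 / golden"
  have "2 < sqrt 5" "sqrt 5 < 3"
    by (simp_all add: real_less_rsqrt real_less_lsqrt)
  then have l: "1/2 < l" "l \<le> 7/10" "l * (1 + l) = 1"
    by (simp_all add: l_def golden_def field_simps)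
  define \<tau> where "\<tau> n = ln (t n)" for n
  define \<sigma> where "\<sigma> n = l * \<tau> (n + 2) - \<tau> (n + 1)" for n
  have step: "\<tau> (n + 3) \<le> \<tau> (n + 2) + \<tau> (n + 1)" "\<tau> (n + 2) + \<tau> (n + 1) \<le> \<tau> (n + 3) + ln 2" for n
  proof -
    have "t (n + 3) \<le> t (n + 2) * t (n + 1)"
      using t_rec [of n] t_pos(1) [of n] by linarith
    then have "ln (t (n + 3)) \<le> ln (t (n + 2) * t (n + 1))"
      by (intro ln_mono) auto
    then show "\<tau> (n + 3) \<le> \<tau> (n + 2) + \<tau> (n + 1)"
      by (simp add: \<tau>_def ln_mult)
    have "t (n + 2) * t (n + 1) \<le> t (n + 3) * 2"
      using t_product_le [of n] by simp
    then have "ln (t (n + 2) * t (n + 1)) \<le> ln (t (n + 3) * 2)"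
      by (intro ln_mono) auto
    then show "\<tau> (n + 2) + \<tau> (n + 1) \<le> \<tau> (n + 3) + ln 2"
      by (simp add: \<tau>_def ln_mult)
  qed
  have rec: "\<bar>\<sigma> (Suc n)\<bar> \<le> 7/10 * \<bar>\<sigma> n\<bar> + ln 2" for n
  proof -
    have "\<sigma> (Suc n) = - l * \<sigma> n - l * (\<tau> (n + 2) + \<tau> (n + 1) - \<tau> (n + 3)) + (l * (1 + l) - 1) * \<tau> (n + 2)"
      by (simp add: \<sigma>_def algebra_simps eval_nat_numeral)
    then have eq: "\<sigma> (Suc n) = - l * \<sigma> n - l * (\<tau> (n + 2) + \<tau> (n + 1) - \<tau> (n + 3))"
      using l by simp
    have "\<bar>l * \<sigma> n\<bar> \<le> 7/10 * \<bar>\<sigma> n\<bar>"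
      unfolding abs_mult using l by (intro mult_right_mono) auto
    moreover have "\<bar>l * (\<tau> (n + 2) + \<tau> (n + 1) - \<tau> (n + 3))\<bar> \<le> 1 * ln 2"
      unfolding abs_mult using l step [of n] by (intro mult_mono) auto
    ultimately show ?thesis
      unfolding eq by linarith
  qed
  \<comment> \<open>\<open>rec\<close> preserves every bound that is at least
    \<open>10/3 * ln 2\<close>.\<close>
  define S where "S = \<bar>\<sigma> 0\<bar> + 4 * ln 2"
  have "0 \<le> ln (2::real)"
    by simp
  then have \<sigma>: "\<bar>\<sigma> n\<bar> \<le> S" for n
  proof (induction n)
    case (Suc n)
    then show ?case
      using rec [of n] by (simp add: S_def)
  qed (simp add: S_def)
  have "t (n + 2) powr l \<le> exp S * t (n + 1)" for n
  proof -
    have "t (n + 2) powr l = exp (l * \<tau> (n + 2))"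
      by (simp add: powr_def \<tau>_def)
    also have "\<dots> \<le> exp (S + \<tau> (n + 1))"
      using \<sigma> [of n] by (simp add: \<sigma>_def)
    also have "\<dots> = exp S * t (n + 1)"
      by (simp add: exp_add \<tau>_def)
    finally show ?thesis .
  qed
  then show ?thesis
    unfolding l_def by (intro exI [of _ "exp S"]) auto
qed

text \<open>Bolzano-Weierstrass for the bounded sequence \<open>u\<close>. A subsequence is enough,
  since \<open>cross3_bound\<close> compares each point with all later ones.\<close>

lemma limit_point:
  obtains v r where "strict_mono r" "(u \<circ> r) \<longlonglongrightarrow> v" "v \<noteq> 0"
proof -
  obtain M where "\<And>n. norm (u n) \<le> M"
    using norm_u_bound by blast
  then have "bounded (range u)"
    by (auto simp: bounded_iff)
  then obtain v r where r: "strict_mono r" "(u \<circ> r) \<longlonglongrightarrow> v"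
    using bounded_imp_convergent_subsequence by blast
  have "(\<lambda>n. vol (x 0) (x 1) ((u \<circ> r) n) / vol (x 0) (x 1) (x 2))
      \<longlonglongrightarrow> vol (x 0) (x 1) v / vol (x 0) (x 1) (x 2)"
    unfolding vol_def using r(2) vol_init by (intro tendsto_intros) (simp_all add: vol_def comp_def)
  moreover have "\<forall>n\<ge>2. 1 / t 3 \<le> vol (x 0) (x 1) ((u \<circ> r) n) / vol (x 0) (x 1) (x 2)"
  proof (intro allI impI)
    fix n :: nat assume "n \<ge> 2"
    then have "r n \<ge> 2"
      using seq_suble [OF r(1), of n] by simp
    then show "1 / t 3 \<le> vol (x 0) (x 1) ((u \<circ> r) n) / vol (x 0) (x 1) (x 2)"
      using vol_u_bound [of "r n - 2"] le_add_diff_inverse2 [of 2 "r n"] by (simp only: comp_def)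
  qed
  ultimately have "1 / t 3 \<le> vol (x 0) (x 1) v / vol (x 0) (x 1) (x 2)"
    by (intro LIMSEQ_le_const) blast+
  moreover have "0 < 1 / t 3"
    by simp
  ultimately have "v \<noteq> 0"
    by (metis vol_def inner_zero_right div_0 not_le)
  then show thesis
    using r that by blast
qed

lemma cross3_limit_bound:
  "\<exists>K>0. \<forall>v r. strict_mono r \<longrightarrow> (u \<circ> r) \<longlonglongrightarrow> v \<longrightarrow> (\<forall>i. norm (cross3 (x (Suc i)) v) \<le> K / t (i + 2))"
proof -
  obtain K where K: "K > 0"
    "\<And>i j. norm (cross3 (x (Suc i)) (x (Suc i + j))) \<le> K / t (i + 2) * t (i + j + 2)"
    using cross3_bound by blast
  have "norm (cross3 (x (Suc i)) v) \<le> K / t (i + 2)"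
    if r: "strict_mono r" and v: "(u \<circ> r) \<longlonglongrightarrow> v" for v r i
  proof (rule LIMSEQ_le_const2)
    show "(\<lambda>n. norm (cross3 (x (Suc i)) ((u \<circ> r) n))) \<longlonglongrightarrow> norm (cross3 (x (Suc i)) v)"
      using v by (intro tendsto_norm bounded_bilinear.tendsto [OF bilinear_conv_bounded_bilinear [THEN iffD1, OF bilinear_cross]] tendsto_const)
    show "\<exists>N. \<forall>n\<ge>N. norm (cross3 (x (Suc i)) ((u \<circ> r) n)) \<le> K / t (i + 2)"
    proof (intro exI allI impI)
      fix n assume "n \<ge> Suc i"
      then have "r n \<ge> Suc i"
        using seq_suble [OF r, of n] by simp
      then obtain j where j: "r n = Suc i + j"
        using le_Suc_ex by blast
      have "norm (cross3 (x (Suc i)) ((u \<circ> r) n)) = norm (cross3 (x (Suc i)) (x (Suc i + j))) / t (i + j + 2)"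
        by (simp add: u_def j cross_mult_right less_imp_le)
      then show "norm (cross3 (x (Suc i)) ((u \<circ> r) n)) \<le> K / t (i + 2)"
        using K(2) [of i j] by (simp add: pos_divide_le_eq)
    qed
  qed
  then show ?thesis
    using K(1) by blast
qed

text \<open>If \<open>a \<bullet> v = 0\<close>, then \<open>a \<bullet> x (Suc i)\<close> is at
  most a constant times \<open>1 / t (i + 2)\<close>, while its denominators are bounded. So it
  vanishes eventually, in particular on three independent points.\<close>

lemma limit_independent:
  assumes v: "strict_mono r" "(u \<circ> r) \<longlonglongrightarrow> v" "v \<noteq> 0" and a: "rvec a" "a \<bullet> v = 0"
  shows "a = 0"
proof -
  obtain K where K: "K > 0" "\<And>i. norm (cross3 (x (Suc i)) v) \<le> K / t (i + 2)"
    using cross3_limit_bound v by blast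
  obtain N where N: "N > 0" "\<And>n. ivec (real N *\<^sub>R x n)"
    using denominator by blast
  obtain M where M: "M > 0" "ivec (real M *\<^sub>R a)"
    using rvec_denominator a(1) .
  define R where "R = real N * real M * norm a * K / norm v"
  obtain m where m: "\<And>n. n \<ge> m \<Longrightarrow> t n > R"
    using t_at_top by (metis eventually_sequentially filterlim_at_top_dense)
  have zero: "a \<bullet> x (Suc i) = 0" if "i \<ge> m" for i
  proof (rule ccontr)
    assume nz: "a \<bullet> x (Suc i) \<noteq> 0"
    have "(real M *\<^sub>R a) \<bullet> (real N *\<^sub>R x (Suc i)) \<in> \<int>"
      by (intro ivec_inner M N)
    then have "1 \<le> \<bar>(real M *\<^sub>R a) \<bullet> (real N *\<^sub>R x (Suc i))\<bar>"
      using nz M N by (intro Ints_abs_ge_1) auto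
    then have 1: "1 \<le> real N * real M * \<bar>a \<bullet> x (Suc i)\<bar>"
      by (simp add: abs_mult mult_ac)
    have "cross3 a (cross3 (x (Suc i)) v) = - (a \<bullet> x (Suc i)) *\<^sub>R v"
      by (simp add: cross3_cross3_right a)
    then have "\<bar>a \<bullet> x (Suc i)\<bar> * norm v \<le> norm a * norm (cross3 (x (Suc i)) v)"
      using norm_cross3_le [of a "cross3 (x (Suc i)) v"] by simp
    also have "\<dots> \<le> norm a * (K / t (i + 2))"
      using K by (intro mult_left_mono) auto
    finally have "\<bar>a \<bullet> x (Suc i)\<bar> \<le> norm a * (K / t (i + 2)) / norm v"
      using v(3) by (simp add: pos_le_divide_eq mult_ac)
    then have "real N * real M * \<bar>a \<bullet> x (Suc i)\<bar> \<le> real N * real M * (norm a * (K / t (i + 2)) / norm v)"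
      by (intro mult_left_mono) auto
    also have "\<dots> = R / t (i + 2)"
      by (simp add: R_def mult_ac)
    also have "\<dots> < 1"
      using m [of "i + 2"] that by simp
    finally show False
      using 1 by simp
  qed
  show ?thesis
    by (rule orthogonal_basis_imp_zero [OF vol_x_nonzero [of "Suc m"]])
      (use zero [of m] zero [of "Suc m"] zero [of "m + 2"] in \<open>simp_all\<close>)
qed

text \<open>For \<open>R * t (i + 2) \<le> X < R * t (i + 3)\<close> the integral multiple
  \<open>z\<close> of \<open>x (Suc i)\<close> works: its distance is of order at most
  \<open>1 / t (i + 2)\<close>, which \<open>t_golden_growth\<close> compares with
  \<open>X powr (- l)\<close>.\<close>

lemma limit_solvable:
  assumes v: "strict_mono r" "(u \<circ> r) \<longlonglongrightarrow> v"
  shows "\<exists>c>0. \<forall>\<^sub>F X in at_top. approx_solvable v (1 / golden) c X"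
proof -
  define l where "l = 1 / golden"
  have l: "l > 0"
    by (simp add: l_def golden_def add_pos_nonneg)
  obtain K where K: "K > 0" "\<And>i. norm (cross3 (x (Suc i)) v) \<le> K / t (i + 2)"
    using cross3_limit_bound v by blast
  obtain N where N: "N > 0" "\<And>n. ivec (real N *\<^sub>R x n)"
    using denominator by blast
  obtain M where M: "M > 0" "\<And>n. norm (x n) \<le> M * t (n + 1)"
    using norm_x_bound by blast
  obtain C where C: "C > 0" "\<And>n. t (n + 2) powr l \<le> C * t (n + 1)"
    using t_golden_growth unfolding l_def by blast
  define R where "R = real N * M"
  have R: "R > 0"
    using N M by (simp add: R_def)
  define c where "c = real N * K * C * R powr l"
  have "c > 0"
    using N K C R by (simp add: c_def)
  have "approx_solvable v l c X" if X: "X \<ge> R * t 2" for X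
  proof -
    obtain m where m: "t m > X / R"
      using t_at_top by (metis eventually_sequentially filterlim_at_top_dense order_refl)
    define j where "j = (LEAST j. X < R * t j)"
    have "X < R * t m"
      using m R by (simp add: field_simps)
    then have j: "X < R * t j"
      unfolding j_def by (rule LeastI)
    have "j > 2"
    proof (rule ccontr)
      assume "\<not> j > 2"
      then have "R * t j \<le> R * t 2"
        using R by (intro mult_left_mono t_incseq) auto
      then show False
        using j X by simp
    qed
    then obtain i where i: "j = i + 3"
      by (metis add.commute le_Suc_ex numeral_3_eq_3 Suc_1 Suc_leI numeral_2_eq_2)
    have "\<not> X < R * t (i + 2)"
      using not_less_Least [of "i + 2" "\<lambda>j. X < R * t j"] i unfolding j_def by simp
    then have X1: "R * t (i + 2) \<le> X" and X2: "X < R * t (i + 3)"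
      using j i by auto
    have X0: "X > 0"
      using X1 R t_pos(1) [of "i + 2"] by (smt (verit) mult_pos_pos)
    define z where "z = real N *\<^sub>R x (Suc i)"
    have "x (Suc i) \<noteq> 0"
      using vol_x_nonzero [of "Suc i"] by (auto simp: vol_def)
    then have "z \<noteq> 0" "ivec z"
      using N by (simp_all add: z_def)
    moreover have "infnorm z \<le> X"
    proof -
      have "infnorm z \<le> norm z"
        by (rule infnorm_le_norm)
      also have "\<dots> \<le> R * t (i + 2)"
        using mult_left_mono [OF M(2) [of "Suc i"], of "real N"] by (simp add: z_def R_def mult.assoc)
      finally show ?thesis
        using X1 by simp
    qed
    moreover have "infnorm (cross3 z v) \<le> c * X powr (- l)"
    proof -
      have "X powr l \<le> (R * t (i + 3)) powr l"
        using X0 X2 l by (intro powr_mono2) auto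
      also have "\<dots> = R powr l * t (i + 3) powr l"
        using R by (simp add: powr_mult less_imp_le)
      also have "\<dots> \<le> R powr l * (C * t (i + 2))"
        using C(2) [of "i + 1"] by (intro mult_left_mono) (auto simp: eval_nat_numeral)
      finally have "K * X powr l \<le> K * (R powr l * (C * t (i + 2)))"
        using K(1) by (intro mult_left_mono) auto
      then have "K / t (i + 2) \<le> K * C * R powr l * X powr (- l)"
        using X0 by (simp add: powr_minus field_simps)
      then have "real N * norm (cross3 (x (Suc i)) v) \<le> real N * (K * C * R powr l * X powr (- l))"
        using K(2) [of i] by (intro mult_left_mono) auto
      moreover have "infnorm (cross3 z v) \<le> real N * norm (cross3 (x (Suc i)) v)"
        using infnorm_le_norm [of "cross3 z v"] by (simp add: z_def cross_mult_left)
      ultimately show ?thesis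
        by (simp add: c_def mult.assoc)
    qed
    ultimately show ?thesis
      unfolding approx_solvable_def ivec_def by blast
  qed
  then have "\<forall>\<^sub>F X in at_top. approx_solvable v l c X"
    using eventually_ge_at_top eventually_mono by metis
  then show ?thesis
    using \<open>c > 0\<close> unfolding l_def by blast
qed

end

section \<open>Existence of points with exponent one over the golden ratio\<close>

text \<open>The recursion of the traces of Fibonacci words in two matrices of determinant 1; its
  polynomial form keeps the values integral.\<close>

fun trace_seq :: "real \<Rightarrow> real \<Rightarrow> real \<Rightarrow> nat \<Rightarrow> real" where
  "trace_seq a b c 0 = a"
| "trace_seq a b c (Suc 0) = b"
| "trace_seq a b c (Suc (Suc 0)) = c"
| "trace_seq a b c (Suc (Suc (Suc n))) =
    trace_seq a b c (Suc (Suc n)) * trace_seq a b c (Suc n) - trace_seq a b c n"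

fun point_seq :: "(nat \<Rightarrow> real) \<Rightarrow> real^3 \<Rightarrow> real^3 \<Rightarrow> real^3 \<Rightarrow> nat \<Rightarrow> real^3" where
  "point_seq t a b c 0 = a"
| "point_seq t a b c (Suc 0) = b"
| "point_seq t a b c (Suc (Suc 0)) = c"
| "point_seq t a b c (Suc (Suc (Suc n))) =
    t (Suc (Suc n)) *\<^sub>R point_seq t a b c (Suc (Suc n)) - point_seq t a b c n"

lemma trace_seq_int:
  assumes "a \<in> \<int>" "b \<in> \<int>" "c \<in> \<int>"
  shows "trace_seq a b c n \<in> \<int>"
  using assms by (induction a b c n rule: trace_seq.induct) auto

lemma point_seq_ivec:
  assumes "\<And>n. t n \<in> \<int>" "ivec (r *\<^sub>R a)" "ivec (r *\<^sub>R b)" "ivec (r *\<^sub>R c)"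
  shows "ivec (r *\<^sub>R point_seq t a b c n)"
  using assms
proof (induction t a b c n rule: point_seq.induct)
  case (4 t a b c n)
  have "r *\<^sub>R point_seq t a b c (Suc (Suc (Suc n)))
      = t (Suc (Suc n)) *\<^sub>R (r *\<^sub>R point_seq t a b c (Suc (Suc n))) - r *\<^sub>R point_seq t a b c n"
    by (simp add: scaleR_diff_right mult.commute)
  then show ?case
    using 4 by (simp only: ivec_diff ivec_scaleR)
qed simp_all

context rational_form
begin

text \<open>The Gram matrix of three consecutive points is carried along. For nonzero \<alpha>, the
  value \<open>B (x (n + 2)) (x n) = \<alpha> * t (n + 2)\<close> makes \<open>x (n + 3)\<close>
  minus the reflection of \<open>x n\<close> in \<open>x (n + 2)\<close>, so \<open>q\<close> is
  preserved.\<close>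

lemma point_seq_invariants:
  fixes t :: "nat \<Rightarrow> real" and x :: "nat \<Rightarrow> real^3"
  assumes x: "\<And>n. x (n + 3) = t (n + 2) *\<^sub>R x (n + 2) - x n"
    and t: "\<And>n. t (n + 3) = t (n + 2) * t (n + 1) - t n"
    and q: "q (x 0) = \<alpha>" "q (x 1) = \<alpha>" "q (x 2) = \<alpha>"
    and B: "B (x 1) (x 0) = \<alpha> * t 0" "B (x 2) (x 1) = \<alpha> * t 1" "B (x 2) (x 0) = \<alpha> * t 2"
  shows "q (x n) = \<alpha>"
proof -
  have "q (x n) = \<alpha> \<and> q (x (n + 1)) = \<alpha> \<and> q (x (n + 2)) = \<alpha> \<and> B (x (n + 1)) (x n) = \<alpha> * t n \<and>
      B (x (n + 2)) (x (n + 1)) = \<alpha> * t (n + 1) \<and> B (x (n + 2)) (x n) = \<alpha> * t (n + 2)"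
  proof (induction n)
    case 0
    then show ?case
      using q B by (simp add: numeral_2_eq_2)
  next
    case (Suc n)
    have x3: "x (n + 3) = t (n + 2) *\<^sub>R x (n + 2) + (-1) *\<^sub>R x n"
      using x [of n] by simp
    have "q (x (n + 3)) = \<alpha>"
      unfolding x3 q_add q_scaleR B_simps using Suc by (simp add: power2_eq_square)
    moreover have "B (x (n + 3)) (x (n + 2)) = \<alpha> * t (n + 2)"
      unfolding x3 B_simps B_self sym [of "x n" "x (n + 2)"] using Suc by simp
    moreover have "B (x (n + 3)) (x (n + 1)) = \<alpha> * t (n + 3)"
      unfolding x3 B_simps sym [of "x n" "x (n + 1)"] t using Suc by (simp add: algebra_simps)
    ultimately show ?case
      using Suc by (simp add: eval_nat_numeral)
  qed
  then show ?thesis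
    by blast
qed

lemma tendsto_q: "(f \<longlongrightarrow> l) F \<Longrightarrow> ((\<lambda>n. q (f n)) \<longlongrightarrow> q l) F"
  unfolding q_def
  by (intro tendsto_intros bounded_bilinear.tendsto [OF bilinear_conv_bounded_bilinear [THEN iffD1, OF bilinear]]) auto

end

context rational_conic
begin

text \<open>
  The starting points are \<open>e\<close> and, up to sign, its images under the reflections in
  \<open>b (b + c) n e \<plusminus> m f + g\<close>, which are integral because \<open>m\<^sup>2 - b (b + c)\<^sup>2 n\<^sup>2 = 1\<close>.
\<close>

lemma starting_points:
  obtains x0 x1 x2 :: "real^3" and t0 t1 t2 :: int and \<alpha> :: real where
    "rvec x0" "rvec x1" "rvec x2" "vol x0 x1 x2 \<noteq> 0"
    "q x0 = \<alpha>" "q x1 = \<alpha>" "q x2 = \<alpha>"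
    "B x1 x0 = \<alpha> * of_int t0" "B x2 x1 = \<alpha> * of_int t1" "B x2 x0 = \<alpha> * of_int t2"
    "10 \<le> t0" "t0 \<le> t1" "t1 \<le> t2"
proof -
  obtain e f g and b c :: int where efg: "rvec e" "rvec f" "rvec g" "vol e f g \<noteq> 0"
    "B e f = 0" "B e g = 0" "B f g = 0" "q e \<noteq> 0"
    "q f = - q e * of_int b" "q g = - q e * of_int c" "b > 0" "\<And>z. z\<^sup>2 \<noteq> b" "b + c \<ge> 1"
    by (fact diagonal_basis)
  define d where "d = b + c"
  have d: "d \<ge> 1" "c = d - b"
    using efg by (simp_all add: d_def)
  have "b * d\<^sup>2 > 0"
    using efg(11) d by simp
  moreover have "z\<^sup>2 \<noteq> b * d\<^sup>2" for z
    using efg(12) d square_mult_nonsquare [of b d z] by (simp add: mult.commute)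
  ultimately obtain m n :: int where mn: "m\<^sup>2 - b * d\<^sup>2 * n\<^sup>2 = 1" "n \<noteq> 0"
    using Pell_solution by blast
  have m2: "m\<^sup>2 = 1 + b * d\<^sup>2 * n\<^sup>2"
    using mn by simp
  \<comment> \<open>At \<open>b * d * n * e + m * f + g\<close> the value of \<open>q\<close> is
    \<open>- d * q e\<close> by Pell's equation, so \<open>d\<close> cancels in the reflection, and
    the image of \<open>e\<close> has the integral coordinates \<open>p\<close>, \<open>r\<close>,
    \<open>s\<close>.\<close>
  define p r s where "p = 1 + 2 * b\<^sup>2 * d * n\<^sup>2" and "r = 2 * b * n * m" and "s = 2 * b * n"
  have norm1: "p\<^sup>2 - b * r\<^sup>2 - c * s\<^sup>2 = 1"
    unfolding p_def r_def s_def d(2) power_mult_distrib m2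
    by (simp add: power2_eq_square algebra_simps)
  define x0 x2 where "x0 = of_int p *\<^sub>R e + of_int r *\<^sub>R f + of_int s *\<^sub>R g"
    and "x2 = of_int p *\<^sub>R e - of_int r *\<^sub>R f + of_int s *\<^sub>R g"
  have b2: "b \<ge> 2"
    using efg(11) efg(12) [of 1] by (simp add: order_less_le)
  have n1: "n\<^sup>2 \<ge> 1"
    using mn(2) by (simp add: int_one_le_iff_zero_less)
  have "2 * 2 * 1 * 1 \<le> b * b * d * n\<^sup>2"
    using b2 d n1 by (intro mult_mono) auto
  then have p9: "p \<ge> 9"
    by (simp add: p_def power2_eq_square)
  show thesis
  proof (rule that [of x0 e x2 "q e" "2 * p" "2 * p" "2 * (p\<^sup>2 + b * r\<^sup>2 - c * s\<^sup>2)"])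
    show "rvec x0" "rvec e" "rvec x2"
      unfolding x0_def x2_def by (intro rvec_add rvec_diff rvec_scaleR Rats_of_int efg)+
    have "vol x0 e x2 = - 2 * of_int r * of_int s * vol e f g"
      unfolding x0_def x2_def by (simp add: vol_def cross3_simps)
    moreover have "m \<noteq> 0"
      using m2 efg(11) n1 d by (auto simp: add_nonneg_eq_0_iff)
    then have "r \<noteq> 0" "s \<noteq> 0"
      using mn b2 by (auto simp: r_def s_def)
    ultimately show "vol x0 e x2 \<noteq> 0"
      using efg(4) by simp
    have norm1': "(of_int p)\<^sup>2 - of_int b * (of_int r)\<^sup>2 - of_int c * (of_int s)\<^sup>2 = (1::real)"
      using arg_cong [OF norm1, of real_of_int] by simp
    have "q x0 = q e * ((of_int p)\<^sup>2 - of_int b * (of_int r)\<^sup>2 - of_int c * (of_int s)\<^sup>2)"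
      unfolding x0_def by (simp add: q_add q_scaleR B_simps efg algebra_simps)
    then show "q x0 = q e"
      by (simp add: norm1')
    have x2: "x2 = of_int p *\<^sub>R e + (- of_int r) *\<^sub>R f + of_int s *\<^sub>R g"
      by (simp add: x2_def)
    have "q x2 = q e * ((of_int p)\<^sup>2 + - of_int b * (of_int r)\<^sup>2 + - of_int c * (of_int s)\<^sup>2)"
      unfolding x2 q_add q_scaleR B_simps efg by (simp add: algebra_simps)
    then have "q x2 = q e * ((of_int p)\<^sup>2 - of_int b * (of_int r)\<^sup>2 - of_int c * (of_int s)\<^sup>2)"
      by simp
    then show "q x2 = q e"
      by (simp add: norm1')
    show "B e x0 = q e * of_int (2 * p)" "B x2 e = q e * of_int (2 * p)"
      unfolding x0_def x2_def by (simp_all add: B_simps efg sym [of _ e] B_self)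
    show "B x2 x0 = q e * of_int (2 * (p\<^sup>2 + b * r\<^sup>2 - c * s\<^sup>2))"
      unfolding x0_def x2_def
      by (simp add: B_simps efg sym [of f e] sym [of g e] sym [of g f] B_self power2_eq_square algebra_simps)
    show "10 \<le> 2 * p"
      using p9 by simp
    have "p\<^sup>2 - c * s\<^sup>2 = 1 + b * r\<^sup>2"
      using norm1 by simp
    \<comment> \<open>By \<open>norm1\<close> the last inner product is
      \<open>2 * (1 + 2 * b * r\<^sup>2)\<close> times \<open>q e\<close>, so this is the required
      \<open>t1 \<le> t2\<close>.\<close>
    moreover have "p \<le> 1 + 2 * (b * r\<^sup>2)"
    proof -
      have "d * 1 \<le> d * (b * d * n\<^sup>2)"
        using b2 d n1 by (intro mult_left_mono) (auto simp: int_one_le_iff_zero_less)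
      then have "d \<le> b * d\<^sup>2 * n\<^sup>2"
        by (simp add: power2_eq_square mult_ac)
      then have "d \<le> m\<^sup>2"
        using m2 by linarith
      moreover have "1 \<le> 4 * b"
        using b2 by simp
      ultimately have "1 * d \<le> 4 * b * m\<^sup>2"
        using d by (intro mult_mono) auto
      then have "2 * b\<^sup>2 * n\<^sup>2 * d \<le> 2 * b\<^sup>2 * n\<^sup>2 * (4 * b * m\<^sup>2)"
        by (intro mult_left_mono) auto
      then show ?thesis
        by (simp add: p_def r_def power_mult_distrib power2_eq_square mult_ac)
    qed
    moreover have "p\<^sup>2 + b * r\<^sup>2 - c * s\<^sup>2 = (p\<^sup>2 - c * s\<^sup>2) + b * r\<^sup>2"
      by simp
    ultimately show "2 * p \<le> 2 * (p\<^sup>2 + b * r\<^sup>2 - c * s\<^sup>2)"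
      by simp
  qed (use efg in auto)
qed

definition golden_vector :: "real^3 \<Rightarrow> bool" where
  "golden_vector v \<longleftrightarrow> v \<noteq> 0 \<and> q v = 0 \<and> (\<forall>a. rvec a \<longrightarrow> a \<bullet> v = 0 \<longrightarrow> a = 0) \<and>
    (\<exists>c>0. \<forall>\<^sub>F X in at_top. approx_solvable v (1 / golden) c X)"

lemma golden_vector_exists: "\<exists>v. golden_vector v"
proof -
  obtain x0 x1 x2 :: "real^3" and t0 t1 t2 :: int and \<alpha> :: real where start:
    "rvec x0" "rvec x1" "rvec x2" "vol x0 x1 x2 \<noteq> 0"
    "q x0 = \<alpha>" "q x1 = \<alpha>" "q x2 = \<alpha>"
    "B x1 x0 = \<alpha> * of_int t0" "B x2 x1 = \<alpha> * of_int t1" "B x2 x0 = \<alpha> * of_int t2"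
    "10 \<le> t0" "t0 \<le> t1" "t1 \<le> t2"
    by (rule starting_points)
  define t where "t = trace_seq (of_int t0) (of_int t1) (of_int t2)"
  define x where "x = point_seq t x0 x1 x2"
  have t_int: "t n \<in> \<int>" for n
    unfolding t_def by (rule trace_seq_int) auto
  have init: "t 0 = of_int t0" "t 1 = of_int t1" "t 2 = of_int t2" "x 0 = x0" "x 1 = x1" "x 2 = x2"
    by (simp_all add: t_def x_def numeral_2_eq_2)
  have rec: "x (n + 3) = t (n + 2) *\<^sub>R x (n + 2) - x n" "t (n + 3) = t (n + 2) * t (n + 1) - t n" for n
    by (simp_all add: t_def x_def eval_nat_numeral)
  obtain N0 N1 N2 :: nat where N: "N0 > 0" "ivec (real N0 *\<^sub>R x0)" "N1 > 0" "ivec (real N1 *\<^sub>R x1)"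
    "N2 > 0" "ivec (real N2 *\<^sub>R x2)"
    using rvec_denominator start(1-3) by metis
  interpret fibonacci_points x t
  proof
    have "ivec (real (N0 * N1 * N2) *\<^sub>R x0)" "ivec (real (N0 * N1 * N2) *\<^sub>R x1)"
      "ivec (real (N0 * N1 * N2) *\<^sub>R x2)"
      using ivec_scaleR [OF Ints_of_nat [of "N1 * N2"] N(2)]
        ivec_scaleR [OF Ints_of_nat [of "N0 * N2"] N(4)]
        ivec_scaleR [OF Ints_of_nat [of "N0 * N1"] N(6)]
      by (simp_all add: mult_ac)
    then have "ivec (real (N0 * N1 * N2) *\<^sub>R x n)" for n
      unfolding x_def using t_int by (intro point_seq_ivec)
    then show "\<exists>N::nat. N > 0 \<and> (\<forall>n. ivec (real N *\<^sub>R x n))"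
      using N by (intro exI [of _ "N0 * N1 * N2"]) auto
  qed (use rec init start in auto)
  have q_x: "q (x n) = \<alpha>" for n
    by (rule point_seq_invariants [OF rec]) (simp_all only: init start)
  obtain v r where v: "strict_mono r" "(u \<circ> r) \<longlonglongrightarrow> v" "v \<noteq> 0"
    by (rule limit_point)
  \<comment> \<open>\<open>q\<close> is constant along \<open>x\<close>, but \<open>u\<close>
    divides by values of \<open>t\<close>, which tend to infinity.\<close>
  have "q v = 0"
  proof (rule LIMSEQ_unique)
    show "(\<lambda>n. q ((u \<circ> r) n)) \<longlonglongrightarrow> q v"
      using v(2) by (rule tendsto_q)
    have "filterlim (\<lambda>n. t (r n + 1)) at_top sequentially"
      using filterlim_compose [OF filterlim_compose [OF t_at_top filterlim_Suc] filterlim_subseq [OF v(1)]]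
      by simp
    then have "(\<lambda>n. \<alpha> * (inverse (t (r n + 1)))\<^sup>2) \<longlonglongrightarrow> \<alpha> * 0\<^sup>2"
      by (intro tendsto_intros tendsto_inverse_0_at_top)
    then show "(\<lambda>n. q ((u \<circ> r) n)) \<longlonglongrightarrow> 0"
      by (simp add: u_def q_scaleR q_x power_one_over inverse_eq_divide)
  qed
  then have "golden_vector v"
    using v limit_independent [OF v] limit_solvable [OF v(1,2)] by (simp add: golden_vector_def)
  then show ?thesis ..
qed

text \<open>A rational linear injection changes norms, distances and denominators by bounded factors
  only, so \<open>l\<close> survives with another constant.\<close>

lemma approx_solvable_linear_image:
  assumes T: "linear T" and N: "N > 0" "\<And>x. ivec x \<Longrightarrow> ivec (real N *\<^sub>R T x)"
    and inj: "\<And>x. T x = 0 \<Longrightarrow> x = 0"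
    and v: "v \<noteq> 0" "\<forall>\<^sub>F X in at_top. approx_solvable v l c X" "c > 0"
  shows "\<exists>c>0. \<forall>\<^sub>F X in at_top. approx_solvable (T v) l c X"
proof -
  obtain K where K: "K > 0" "\<And>x. norm (T x) \<le> K * norm x"
    using linear_bounded_pos [OF T] by blast
  define C where "C = 2 * real N * K"
  have C: "C > 0"
    using N K by (simp add: C_def)
  define D where "D = 2 * real N * K * K"
  have D: "D > 0"
    using N K by (simp add: D_def)
  have size: "infnorm (real N *\<^sub>R T x) \<le> C * infnorm x" for x
  proof -
    have "infnorm (real N *\<^sub>R T x) \<le> real N * (K * norm x)"
      using infnorm_le_norm [of "real N *\<^sub>R T x"] mult_left_mono [OF K(2) [of x], of "real N"] by simp
    also have "\<dots> \<le> real N * (K * (2 * infnorm x))"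
      using norm_le_2_infnorm [of x] K by (intro mult_left_mono) auto
    finally show ?thesis
      by (simp add: C_def mult_ac)
  qed
  have cross: "infnorm (cross3 (real N *\<^sub>R T x) (T v)) \<le> D * infnorm (cross3 x v)" for x
  proof -
    \<comment> \<open>Only the component \<open>w\<close> of \<open>x\<close> orthogonal to
      \<open>v\<close> contributes to either cross product, and
      \<open>norm (cross3 w v) = norm w * norm v\<close>.\<close>
    define a where "a = (x \<bullet> v) / (v \<bullet> v)"
    define w where "w = x - a *\<^sub>R v"
    have vv: "v \<bullet> v \<noteq> 0"
      using v by simp
    have "w \<bullet> v = 0"
      using vv by (simp add: w_def inner_diff_left a_def)
    then have "(norm (cross3 w v))\<^sup>2 = (norm w * norm v)\<^sup>2"
      using norm_cross_dot [of w v] by simp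
    then have "norm (cross3 w v) = norm w * norm v"
      by (simp add: power2_eq_iff_nonneg)
    moreover have "cross3 w v = cross3 x v"
      by (simp add: w_def Cross3.left_diff_distrib cross_mult_left)
    ultimately have w: "norm w * norm v = norm (cross3 x v)"
      by simp
    have "T x = a *\<^sub>R T v + T w"
      by (simp add: w_def linear_diff [OF T] linear_scale [OF T])
    then have "cross3 (T x) (T v) = cross3 (T w) (T v)"
      by (simp add: cross_add_left cross_mult_left)
    then have "norm (cross3 (T x) (T v)) \<le> norm (T w) * norm (T v)"
      using norm_cross3_le by metis
    also have "\<dots> \<le> (K * norm w) * (K * norm v)"
      using K by (intro mult_mono) auto
    also have "\<dots> = K * K * norm (cross3 x v)"
      by (simp add: w [symmetric] mult_ac)
    also have "\<dots> \<le> K * K * (2 * infnorm (cross3 x v))"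
      using K norm_le_2_infnorm by (intro mult_left_mono) auto
    finally have "real N * norm (cross3 (T x) (T v)) \<le> real N * (K * K * (2 * infnorm (cross3 x v)))"
      by (intro mult_left_mono) auto
    then show ?thesis
      using infnorm_le_norm [of "cross3 (real N *\<^sub>R T x) (T v)"] by (simp add: cross_mult_left D_def mult_ac)
  qed
  have "filterlim (\<lambda>X. X * (1 / C)) at_top at_top"
    using C by (intro filterlim_at_top_mult_tendsto_pos [OF tendsto_const] filterlim_ident) auto
  then have "\<forall>\<^sub>F X in at_top. approx_solvable v l c (X * (1 / C))"
    using v(2) by (simp add: filterlim_iff)
  then have "\<forall>\<^sub>F X in at_top. approx_solvable v l c (X * (1 / C)) \<and> X > 0"
    using eventually_gt_at_top by (rule eventually_conj)
  then have "\<forall>\<^sub>F X in at_top. approx_solvable (T v) l (D * c * C powr l) X"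
  proof (rule eventually_mono)
    fix X assume X: "approx_solvable v l c (X * (1 / C)) \<and> X > 0"
    then obtain x where x: "x \<noteq> 0" "ivec x" "infnorm x \<le> X * (1 / C)"
      "infnorm (cross3 x v) \<le> c * (X * (1 / C)) powr (- l)"
      by (auto simp: approx_solvable_def ivec_def)
    let ?z = "real N *\<^sub>R T x"
    have "?z \<noteq> 0" "ivec ?z"
      using inj x N by auto
    moreover have "infnorm ?z \<le> X"
      using size [of x] mult_left_mono [OF x(3), of C] C by simp
    moreover have "infnorm (cross3 ?z (T v)) \<le> D * c * C powr l * X powr (- l)"
    proof -
      have "infnorm (cross3 ?z (T v)) \<le> D * (c * (X * (1 / C)) powr (- l))"
        by (rule order_trans [OF cross mult_left_mono [OF x(4)]]) (use D in simp)
      also have "(X * (1 / C)) powr (- l) = C powr l * X powr (- l)"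
        using X C by (simp add: powr_divide powr_minus field_simps)
      finally show ?thesis
        by (simp add: mult_ac)
    qed
    ultimately show "approx_solvable (T v) l (D * c * C powr l) X"
      unfolding approx_solvable_def ivec_def by blast
  qed
  then show ?thesis
    using D C v(3) by (intro exI [of _ "D * c * C powr l"]) simp
qed

lemma golden_vector_psi:
  assumes v: "golden_vector v" and w: "rvec w" "q w \<noteq> 0"
  shows "golden_vector (psi w v)"
proof -
  have inj: "x = 0" if "psi w x = 0" for x
  proof -
    have "(q w)\<^sup>2 *\<^sub>R x = psi w (psi w x)"
      by (simp only: psi_psi)
    also have "\<dots> = 0"
      by (simp only: that linear_0 [OF linear_psi])
    finally show ?thesis
      using w by simp
  qed
  obtain N :: nat where N: "N > 0" "\<And>x y. ivec x \<Longrightarrow> ivec y \<Longrightarrow> real N * B x y \<in> \<int>"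
    "\<And>x. ivec x \<Longrightarrow> real N * q x \<in> \<int>"
    using common_denominator by metis
  obtain M where M: "M > 0" "ivec (real M *\<^sub>R w)"
    using rvec_denominator w(1) .
  have "ivec (real (N * M * M) *\<^sub>R psi w x)" if "ivec x" for x
  proof -
    let ?w = "real M *\<^sub>R w"
    have eq: "real (N * M * M) *\<^sub>R psi w x = (real N * B ?w x) *\<^sub>R ?w - (real N * q ?w) *\<^sub>R x"
      by (simp add: psi_def B_simps q_scaleR scaleR_diff_right power2_eq_square mult_ac)
    show ?thesis
      unfolding eq by (intro ivec_diff ivec_scaleR N M that)
  qed
  moreover have "N * M * M > 0"
    using N M by simp
  moreover obtain c where "c > 0" "\<forall>\<^sub>F X in at_top. approx_solvable v (1 / golden) c X"
    using v by (auto simp: golden_vector_def)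
  moreover have "v \<noteq> 0"
    using v by (simp add: golden_vector_def)
  ultimately have "\<exists>c>0. \<forall>\<^sub>F X in at_top. approx_solvable (psi w v) (1 / golden) c X"
    using approx_solvable_linear_image [OF linear_psi _ _ inj] by blast
  moreover have "a = 0" if a: "rvec a" "a \<bullet> psi w v = 0" for a
  proof -
    \<comment> \<open>\<open>a'\<close> is the image of \<open>a\<close> under the transpose of
      \<open>psi w\<close>. It vanishes by independence of \<open>v\<close>, so \<open>a\<close> is
      orthogonal to the image of \<open>psi w\<close>, which contains a nonzero multiple of
      \<open>a\<close>.\<close>
    define a' where "a' = (a \<bullet> w) *\<^sub>R (\<chi> i. B w (axis i 1)) - q w *\<^sub>R a"
    have a': "a' \<bullet> x = a \<bullet> psi w x" for x
      by (simp add: a'_def psi_def inner_diff_left inner_diff_right B_eq_inner [of w x])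
    have "rvec a'"
      unfolding a'_def by (intro rvec_diff rvec_scaleR rvec_gradient rvec_inner rational_q a w)
    then have "a' = 0"
      using v a a' by (simp add: golden_vector_def)
    then have "a \<bullet> psi w (psi w a) = 0"
      using a' [of "psi w a"] by simp
    then show ?thesis
      using w by (simp add: psi_psi)
  qed
  moreover have "psi w v \<noteq> 0"
    using inj v by (auto simp: golden_vector_def)
  moreover have "q (psi w v) = 0"
    using v by (simp add: q_psi golden_vector_def)
  ultimately show ?thesis
    by (simp add: golden_vector_def)
qed

text \<open>Pairing with \<open>n = cross3 w w'\<close>, where
  \<open>n \<bullet> v \<noteq> 0\<close>, shows that the proportionality factor is
  \<open>q w' / q w\<close>. Then the \<open>v\<close> terms cancel, which forces
  \<open>B w' v = 0\<close>; by independence the linear form \<open>B w'\<close> vanishes, against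
  \<open>q w' \<noteq> 0\<close>.\<close>

lemma psi_parallel_imp:
  assumes v: "golden_vector v" and w: "rvec w" "q w \<noteq> 0" "rvec w'" "q w' \<noteq> 0"
    and par: "cross3 (psi w v) (psi w' v) = 0"
  shows "cross3 w w' = 0"
proof (rule ccontr)
  assume nz: "cross3 w w' \<noteq> 0"
  have indep: "a = 0" if "rvec a" "a \<bullet> v = 0" for a
    using v that by (simp add: golden_vector_def)
  have "psi w v \<noteq> 0"
    using golden_vector_psi [OF v w(1,2)] by (simp add: golden_vector_def)
  then obtain r where r: "psi w' v = r *\<^sub>R psi w v"
    using par by (auto simp: cross3_eq_0_iff_parallel)
  define n where "n = cross3 w w'"
  have "n \<bullet> psi w' v = - q w' * (n \<bullet> v)" "n \<bullet> psi w v = - q w * (n \<bullet> v)"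
    by (simp_all add: n_def psi_def inner_diff_right dot_cross_self)
  moreover have "n \<bullet> v \<noteq> 0"
    using indep [of n] nz w by (auto simp: n_def rvec_cross3)
  ultimately have q: "q w' = r * q w"
    using r by (auto simp: inner_scaleR_right)
  have "B w' v *\<^sub>R w' = (r * B w v) *\<^sub>R w"
    using r by (simp add: psi_def q scaleR_diff_right)
  then have "cross3 w (B w' v *\<^sub>R w') = 0"
    by (simp add: cross_mult_right)
  then have "B w' v = 0"
    using nz by (simp add: cross_mult_right)
  then have "(\<chi> i. B w' (axis i 1)) = 0"
    using indep rvec_gradient [OF w(3)] by (simp add: B_eq_inner [of w' v])
  then have "B w' w' = 0"
    by (simp add: B_eq_inner [of w' w'])
  then show False
    using w by (simp add: B_self)
qed

lemma representative_span_self: "v \<noteq> 0 \<Longrightarrow> representative v (span {v})"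
  by (simp add: representative_def proj_plane_def subspace_span span_base dim_span dim_singleton)

lemma infinite_golden_points:
  "infinite {P \<in> points. \<exists>v. representative v P \<and> golden_vector v}"
proof -
  obtain v where v: "golden_vector v"
    using golden_vector_exists ..
  obtain e f g and b c :: int where efg: "rvec e" "rvec f" "rvec g" "vol e f g \<noteq> 0"
    "B e f = 0" "B e g = 0" "B f g = 0" "q e \<noteq> 0"
    "q f = - q e * of_int b" "q g = - q e * of_int c" "b > 0" "\<And>z. z\<^sup>2 \<noteq> b" "b + c \<ge> 1"
    by (fact diagonal_basis)
  \<comment> \<open>\<open>q (w k)\<close> is \<open>q e * (1 - (real k)\<^sup>2 * b)\<close>,
    nonzero because \<open>b\<close> is a positive nonsquare.\<close>
  define w where "w k = e + real k *\<^sub>R f" for k :: nat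
  have rw: "rvec (w k)" for k
    unfolding w_def by (intro rvec_add rvec_scaleR Rats_of_nat efg)
  have qw: "q (w k) \<noteq> 0" for k
  proof
    assume "q (w k) = 0"
    then have "q e * (1 - (real k)\<^sup>2 * of_int b) = 0"
      by (simp add: w_def q_add q_scaleR B_simps efg algebra_simps)
    then have "real_of_int ((int k)\<^sup>2 * b) = 1"
      using efg(8) by simp
    then have "(int k)\<^sup>2 * b = 1"
      by linarith
    then have "b = 1"
      using efg(11) by (metis zmult_eq_1_iff less_imp_le not_less_iff_gr_or_eq zero_less_one
          neg_less_0_iff_less less_asym)
    then show False
      using efg(12) [of 1] by simp
  qed
  define P where "P k = span {psi (w k) v}" for k
  have gv: "golden_vector (psi (w k) v)" for k
    using golden_vector_psi [OF v rw qw] .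
  then have rep: "representative (psi (w k) v) (P k)" for k
    unfolding P_def by (intro representative_span_self) (simp add: golden_vector_def)
  have "inj P"
  proof (rule injI)
    fix k j assume "P k = P j"
    then obtain r where "psi (w j) v = r *\<^sub>R psi (w k) v"
      using representative_proportional [OF rep [of k]] rep [of j] by metis
    then have "cross3 (psi (w k) v) (psi (w j) v) = 0"
      by (simp add: cross_mult_right)
    then have "cross3 (w k) (w j) = 0"
      by (rule psi_parallel_imp [OF v rw qw rw qw])
    moreover have "cross3 (w k) (w j) = (real j - real k) *\<^sub>R cross3 e f"
      using cross_skew [of f e]
      by (simp add: w_def cross_add_left cross_add_right cross_mult_left cross_mult_right scaleR_diff_left)
    moreover have "cross3 e f \<noteq> 0"
      using vol_nonzero_imp_cross3(1) [OF efg(4)] .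
    ultimately show "k = j"
      by simp
  qed
  then have "infinite (range P)"
    using finite_imageD by blast
  moreover have "P k \<in> points" for k
    using points_iff [OF rep] gv by (simp add: golden_vector_def)
  then have "range P \<subseteq> {P \<in> points. \<exists>v. representative v P \<and> golden_vector v}"
    using rep gv by blast
  ultimately show ?thesis
    using finite_subset by blast
qed

end

section \<open>Quadratic polynomials and rational forms\<close>

lemma eval3_superset:
  assumes "finite S" "Poly_Mapping.keys p \<subseteq> S"
  shows "eval3 p v = (\<Sum>m\<in>S. of_rat (Poly_Mapping.lookup p m) *
    (\<Prod>i\<in>UNIV. (v $ i) ^ Poly_Mapping.lookup m i))"
  unfolding eval3_def
  by (rule sum.mono_neutral_left) (use assms in \<open>auto simp: in_keys_iff\<close>)

lemma eval3_add: "eval3 (p + p') v = eval3 p v + eval3 p' v"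
proof -
  let ?S = "Poly_Mapping.keys p \<union> Poly_Mapping.keys p'"
  have "Poly_Mapping.keys (p + p') \<subseteq> ?S"
    by (rule Poly_Mapping.keys_add)
  then show ?thesis
    by (simp add: eval3_superset [of ?S] lookup_add of_rat_add algebra_simps sum.distrib)
qed

lemma eval3_0 [simp]: "eval3 0 v = 0"
  by (simp add: eval3_def)

lemma eval3_sum: "eval3 (\<Sum>i\<in>A. f i) v = (\<Sum>i\<in>A. eval3 (f i) v)"
  by (induction A rule: infinite_finite_induct) (simp_all add: eval3_add)

lemma eval3_diff: "eval3 (p - p') v = eval3 p v - eval3 p' v"
  using eval3_add [of "p - p'" p' v] by simp

lemma eval3_single:
  "eval3 (Poly_Mapping.single m a) v = of_rat a * (\<Prod>i\<in>UNIV. (v $ i) ^ Poly_Mapping.lookup m i)"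
  by (subst eval3_superset [of "{m}"]) auto

definition mono2 :: "3 \<Rightarrow> 3 \<Rightarrow> (3 \<Rightarrow>\<^sub>0 nat)" where
  "mono2 i j = Poly_Mapping.single i 1 + Poly_Mapping.single j 1"

lemma lookup_mono2:
  "Poly_Mapping.lookup (mono2 i j) k = (if i = k then 1 else 0) + (if j = k then 1 else 0)"
  by (simp add: mono2_def lookup_add lookup_single when_def)

lemma prod_mono2: "(\<Prod>k\<in>UNIV. (v $ k) ^ Poly_Mapping.lookup (mono2 i j) k) = v $ i * v $ j"
  for v :: "real^3"
proof -
  have "(v $ k) ^ Poly_Mapping.lookup (mono2 i j) k
      = (if i = k then v $ k else 1) * (if j = k then v $ k else 1)" for k
    by (simp add: lookup_mono2)
  then show ?thesis
    by (simp add: prod.distrib)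
qed

lemma nat_sum_eq_2_cases:
  fixes a b c :: nat
  assumes "a + b + c = 2"
  obtains "a = 2" "b = 0" "c = 0" | "a = 0" "b = 2" "c = 0" | "a = 0" "b = 0" "c = 2"
    | "a = 1" "b = 1" "c = 0" | "a = 1" "b = 0" "c = 1" | "a = 0" "b = 1" "c = 1"
proof -
  have "a \<in> {0, 1, 2}" "b \<in> {0, 1, 2}" "c = 2 - a - b"
    using assms by auto
  then show thesis
    using assms that by auto
qed

lemma degree_two_monomial:
  fixes m :: "3 \<Rightarrow>\<^sub>0 nat"
  assumes "(\<Sum>i\<in>UNIV. Poly_Mapping.lookup m i) = 2"
  obtains i j where "m = mono2 i j"
proof -
  let ?a = "Poly_Mapping.lookup m 1" and ?b = "Poly_Mapping.lookup m 2" and ?c = "Poly_Mapping.lookup m 3"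
  have "?a + ?b + ?c = 2"
    using assms by (simp add: sum_3)
  then consider "?a = 2" "?b = 0" "?c = 0" | "?a = 0" "?b = 2" "?c = 0" | "?a = 0" "?b = 0" "?c = 2"
    | "?a = 1" "?b = 1" "?c = 0" | "?a = 1" "?b = 0" "?c = 1" | "?a = 0" "?b = 1" "?c = 1"
    by (rule nat_sum_eq_2_cases)
  moreover have eqI: "m = m'" if "Poly_Mapping.lookup m' 1 = ?a" "Poly_Mapping.lookup m' 2 = ?b"
    "Poly_Mapping.lookup m' 3 = ?c" for m'
    by (rule poly_mapping_eqI) (metis exhaust_3 that)
  ultimately show thesis
  proof cases
    case 1 then show thesis by (intro that [of 1 1] eqI) (simp_all add: lookup_mono2)
  next
    case 2 then show thesis by (intro that [of 2 2] eqI) (simp_all add: lookup_mono2)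
  next
    case 3 then show thesis by (intro that [of 3 3] eqI) (simp_all add: lookup_mono2)
  next
    case 4 then show thesis by (intro that [of 1 2] eqI) (simp_all add: lookup_mono2)
  next
    case 5 then show thesis by (intro that [of 1 3] eqI) (simp_all add: lookup_mono2)
  next
    case 6 then show thesis by (intro that [of 2 3] eqI) (simp_all add: lookup_mono2)
  qed
qed

lemma mono2_commute: "mono2 i j = mono2 j i"
  unfolding mono2_def by (rule add.commute)

lemma mono2_eq_iff: "mono2 i j = mono2 k l \<longleftrightarrow> i = k \<and> j = l \<or> i = l \<and> j = k"
proof
  assume eq: "mono2 i j = mono2 k l"
  have inj: "a = b" if "Poly_Mapping.single a (1::nat) = Poly_Mapping.single b 1" for a b :: 3
    using arg_cong [OF that, of "\<lambda>m. Poly_Mapping.lookup m a"]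
    by (simp add: lookup_single when_def split: if_splits)
  have "i = k \<or> i = l"
  proof (rule ccontr)
    assume "\<not> ?thesis"
    then have "k \<noteq> i" "l \<noteq> i"
      by auto
    then have "Poly_Mapping.lookup (mono2 k l) i = 0"
      by (simp add: lookup_mono2)
    then show False
      unfolding eq [symmetric] by (simp add: lookup_mono2)
  qed
  then show "i = k \<and> j = l \<or> i = l \<and> j = k"
  proof
    assume "i = k"
    then have "Poly_Mapping.single j (1::nat) = Poly_Mapping.single l 1"
      using eq unfolding mono2_def by (simp only: add_left_cancel)
    then show ?thesis
      using inj \<open>i = k\<close> by blast
  next
    assume "i = l"
    then have "Poly_Mapping.single j (1::nat) = Poly_Mapping.single k 1"
      using eq unfolding mono2_def
      by (simp only: add_left_cancel add.commute [of "Poly_Mapping.single k 1"])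
    then show ?thesis
      using inj \<open>i = l\<close> by blast
  qed
qed (auto simp: mono2_def add.commute)

text \<open>The unit vectors isolate the coefficients of the squares; once these vanish, sums of two
  unit vectors isolate the mixed ones.\<close>

lemma quadratic_eq_0:
  assumes keys: "\<And>m. m \<in> Poly_Mapping.keys p \<Longrightarrow> \<exists>i j. m = mono2 i j"
    and zero: "\<And>v. eval3 p v = 0"
  shows "p = 0"
proof -
  let ?c = "\<lambda>i j. real_of_rat (Poly_Mapping.lookup p (mono2 i j))"
  define S where "S = range (\<lambda>(i, j). mono2 i j)"
  have S: "finite S" "Poly_Mapping.keys p \<subseteq> S"
    using keys by (fastforce simp: S_def)+
  have mem: "mono2 i j \<in> S" for i j
    by (force simp: S_def)
  have diag: "?c i i = 0" for i
  proof -
    have "eval3 p (axis i 1) = (\<Sum>m\<in>S. if m = mono2 i i then ?c i i else 0)"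
      unfolding eval3_superset [OF S]
    proof (rule sum.cong)
      fix m assume "m \<in> S"
      then obtain k l where "m = mono2 k l"
        by (auto simp: S_def)
      then show "of_rat (Poly_Mapping.lookup p m) * (\<Prod>k\<in>UNIV. (axis i 1 :: real^3) $ k ^ Poly_Mapping.lookup m k)
          = (if m = mono2 i i then ?c i i else 0)"
        by (simp only: prod_mono2 mono2_eq_iff) (auto simp: axis_def)
    qed simp
    also have "\<dots> = ?c i i"
      using S(1) mem by simp
    finally show ?thesis
      by (simp add: zero)
  qed
  have off: "?c i j = 0" if "i \<noteq> j" for i j
  proof -
    have "eval3 p (axis i 1 + axis j 1) = (\<Sum>m\<in>S. if m = mono2 i j then ?c i j else 0)"
      unfolding eval3_superset [OF S]
    proof (rule sum.cong)
      fix m assume "m \<in> S"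
      then obtain k l where m: "m = mono2 k l"
        by (auto simp: S_def)
      show "of_rat (Poly_Mapping.lookup p m) * (\<Prod>k\<in>UNIV. (axis i 1 + axis j 1 :: real^3) $ k ^ Poly_Mapping.lookup m k)
          = (if m = mono2 i j then ?c i j else 0)"
        unfolding m prod_mono2 mono2_eq_iff
        using that diag [of i] diag [of j] mono2_commute [of j i] by (auto simp: axis_def)
    qed simp
    also have "\<dots> = ?c i j"
      using S(1) mem by simp
    finally show ?thesis
      by (simp add: zero)
  qed
  show ?thesis
  proof (rule ccontr)
    assume "p \<noteq> 0"
    then obtain m where m: "m \<in> Poly_Mapping.keys p"
      by (metis in_keys_iff lookup_zero poly_mapping_eqI)
    then obtain i j where "m = mono2 i j"
      using keys by blast
    moreover have "?c i j = 0"
      using diag off by (cases "i = j") auto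
    ultimately show False
      using m by (simp add: in_keys_iff)
  qed
qed

lemma rat_of_real_vector:
  assumes "rvec a"
  obtains a' :: "3 \<Rightarrow> rat" where "\<And>i. a $ i = of_rat (a' i)"
proof -
  have "\<forall>i. \<exists>r. a $ i = of_rat r"
    using assms unfolding rvec_def Rats_def by blast
  from choice [OF this] show thesis
    using that by blast
qed

text \<open>The product of the two rational linear polynomials takes the same values as \<phi>, so
  by \<open>quadratic_eq_0\<close> it equals \<phi>; neither factor is a unit.\<close>

lemma reducible_if_product:
  assumes "homogeneous3 2 \<phi>" and a: "rvec a" and b: "rvec b"
    and prod: "\<And>v. eval3 \<phi> v = (a \<bullet> v) * (b \<bullet> v)"
  shows "\<not> irreducible \<phi>"
proof
  assume irr: "irreducible \<phi>"
  obtain a' b' :: "3 \<Rightarrow> rat" where ab: "\<And>i. a $ i = of_rat (a' i)" "\<And>i. b $ i = of_rat (b' i)"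
    using rat_of_real_vector a b by metis
  define lin :: "(3 \<Rightarrow> rat) \<Rightarrow> qpoly3" where
    "lin c = (\<Sum>i\<in>UNIV. Poly_Mapping.single (Poly_Mapping.single i 1) (c i))" for c
  have lin_mult: "lin c * lin d = (\<Sum>i\<in>UNIV. \<Sum>j\<in>UNIV. Poly_Mapping.single (mono2 i j) (c i * d j))" for c d
    by (simp add: lin_def sum_product mult_single mono2_def)
  have keys_lin: "\<exists>i. m = Poly_Mapping.single i 1" if "m \<in> Poly_Mapping.keys (lin c)" for m c
  proof -
    have "m \<in> Poly_Mapping.keys (\<Sum>i\<in>UNIV. Poly_Mapping.single (Poly_Mapping.single i 1) (c i))"
      using that by (simp only: lin_def)
    from subsetD [OF Poly_Mapping.keys_sum this] obtain i
      where "m \<in> Poly_Mapping.keys (Poly_Mapping.single (Poly_Mapping.single i 1) (c i))"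
      by blast
    then have "m = Poly_Mapping.single i 1"
      by (simp split: if_splits)
    then show ?thesis ..
  qed
  \<comment> \<open>No multiple of a linear form has a constant term, but 1 has.\<close>
  have not_unit: "\<not> lin c dvd 1" for c
  proof
    assume "lin c dvd 1"
    then obtain d where d: "lin c * d = 1"
      by (metis dvdE)
    have "0 \<in> Poly_Mapping.keys (lin c * d)"
      by (simp add: d in_keys_iff lookup_one)
    then obtain m m' where "0 = m + m'" "m \<in> Poly_Mapping.keys (lin c)"
      using keys_mult [of "lin c" d] by blast
    then obtain i where "0 = Poly_Mapping.single i 1 + m'"
      using keys_lin by blast
    then have "Poly_Mapping.lookup (Poly_Mapping.single i 1 + m') i = Poly_Mapping.lookup 0 i"
      by (simp only:)
    then show False
      by (simp add: lookup_add)
  qed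
  have "\<phi> - lin a' * lin b' = 0"
  proof (rule quadratic_eq_0)
    fix m assume "m \<in> Poly_Mapping.keys (\<phi> - lin a' * lin b')"
    then consider "m \<in> Poly_Mapping.keys \<phi>" | "m \<in> Poly_Mapping.keys (lin a' * lin b')"
      by (cases "Poly_Mapping.lookup \<phi> m = 0") (auto simp: in_keys_iff lookup_minus)
    then show "\<exists>i j. m = mono2 i j"
    proof cases
      case 1
      then have "(\<Sum>i\<in>UNIV. Poly_Mapping.lookup m i) = 2"
        using assms(1) by (simp add: homogeneous3_def)
      then show ?thesis
        by (rule degree_two_monomial) blast
    next
      case 2
      then obtain k l where "m = k + l" "k \<in> Poly_Mapping.keys (lin a')" "l \<in> Poly_Mapping.keys (lin b')"
        using keys_mult by blast
      moreover obtain i where "k = Poly_Mapping.single i 1"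
        using keys_lin calculation(2) by blast
      moreover obtain j where "l = Poly_Mapping.single j 1"
        using keys_lin calculation(3) by blast
      ultimately show ?thesis
        unfolding mono2_def by blast
    qed
  next
    fix v
    have "eval3 (lin a' * lin b') v = (\<Sum>i\<in>UNIV. \<Sum>j\<in>UNIV. of_rat (a' i) * of_rat (b' j) * (v $ i * v $ j))"
      by (simp only: lin_mult eval3_sum eval3_single prod_mono2 of_rat_mult)
    also have "\<dots> = (a \<bullet> v) * (b \<bullet> v)"
      by (simp add: inner_vec_def ab sum_product mult_ac)
    finally show "eval3 (\<phi> - lin a' * lin b') v = 0"
      by (simp add: eval3_diff prod)
  qed
  then show False
    using irr not_unit [of a'] not_unit [of b'] irreducibleD [of \<phi> "lin a'" "lin b'"] by simp
qed

section \<open>From the polynomial to its polar form\<close>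

definition polar :: "qpoly3 \<Rightarrow> real^3 \<Rightarrow> real^3 \<Rightarrow> real" where
  "polar p x y = eval3 p (x + y) - eval3 p x - eval3 p y"

lemma polar_formula:
  assumes "homogeneous3 2 p"
  shows "\<exists>i j :: (3 \<Rightarrow>\<^sub>0 nat) \<Rightarrow> 3. \<forall>x y. polar p x y = (\<Sum>m\<in>Poly_Mapping.keys p.
    of_rat (Poly_Mapping.lookup p m) * (x $ i m * y $ j m + y $ i m * x $ j m))"
proof -
  have "\<forall>m\<in>Poly_Mapping.keys p. \<exists>i j. m = mono2 i j"
  proof
    fix m assume "m \<in> Poly_Mapping.keys p"
    then have "(\<Sum>i\<in>UNIV. Poly_Mapping.lookup m i) = 2"
      using assms by (simp add: homogeneous3_def)
    then show "\<exists>i j. m = mono2 i j"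
      by (rule degree_two_monomial) blast
  qed
  then obtain i j where ij: "\<And>m. m \<in> Poly_Mapping.keys p \<Longrightarrow> m = mono2 (i m) (j m)"
    by metis
  have eval: "eval3 p v = (\<Sum>m\<in>Poly_Mapping.keys p. of_rat (Poly_Mapping.lookup p m) * (v $ i m * v $ j m))" for v
    unfolding eval3_def
  proof (rule sum.cong)
    fix m assume "m \<in> Poly_Mapping.keys p"
    then have "Poly_Mapping.lookup m = Poly_Mapping.lookup (mono2 (i m) (j m))"
      using ij by (intro arg_cong [of m _ Poly_Mapping.lookup])
    then show "of_rat (Poly_Mapping.lookup p m) * (\<Prod>k\<in>UNIV. v $ k ^ Poly_Mapping.lookup m k)
        = of_rat (Poly_Mapping.lookup p m) * (v $ i m * v $ j m)"
      by (simp only: prod_mono2)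
  qed simp
  have "polar p x y = (\<Sum>m\<in>Poly_Mapping.keys p.
        of_rat (Poly_Mapping.lookup p m) * (x $ i m * y $ j m + y $ i m * x $ j m))" for x y
    unfolding polar_def eval sum_subtractf [symmetric]
    by (intro sum.cong refl) (simp add: algebra_simps)
  then show ?thesis
    by blast
qed

lemma rational_form_polar:
  assumes "homogeneous3 2 p"
  shows "rational_form (polar p)"
proof -
  obtain i j where polar: "\<And>x y. polar p x y = (\<Sum>m\<in>Poly_Mapping.keys p.
        of_rat (Poly_Mapping.lookup p m) * (x $ i m * y $ j m + y $ i m * x $ j m))"
    using polar_formula [OF assms] by blast
  show ?thesis
  proof
    show "bilinear (polar p)"
      unfolding bilinear_def polar
      by (intro conjI allI linearI)
        (simp_all add: sum_distrib_left algebra_simps flip: sum.distrib)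
    show "polar p x y = polar p y x" for x y
      by (simp add: polar_def add.commute)
    show "polar p x y \<in> \<rat>" if "rvec x" "rvec y" for x y
      using that unfolding polar rvec_def by (intro Rats_sum Rats_mult Rats_add) auto
  qed
qed

lemma q_polar:
  assumes "homogeneous3 2 p"
  shows "rational_form.q (polar p) v = eval3 p v"
proof -
  interpret rational_form "polar p"
    by (rule rational_form_polar [OF assms])
  have "eval3 p (v + v) = 4 * eval3 p v"
    using eval3_scaleR [OF assms, of 2 v] by (simp add: scaleR_2)
  then show ?thesis
    by (simp add: q_def polar_def)
qed

lemma rational_conic_polar:
  assumes "admissible_conic p"
  shows "rational_conic (polar p)"
proof -
  have hom: "homogeneous3 2 p" and irr: "irreducible p"
    using assms by (simp_all add: admissible_conic_def)
  interpret rational_form "polar p"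
    by (rule rational_form_polar [OF hom])
  show ?thesis
  proof
    fix a b :: "real^3" assume ab: "rvec a" "rvec b"
    show "\<exists>x. polar p x x \<noteq> (a \<bullet> x) * (b \<bullet> x)"
    proof (rule ccontr)
      assume *: "\<not> ?thesis"
      have "eval3 p v = (((1/2) *\<^sub>R a) \<bullet> v) * (b \<bullet> v)" for v
        using * B_self [of v] by (simp add: q_polar [OF hom])
      moreover have "rvec ((1/2) *\<^sub>R a)"
        using ab by (intro rvec_scaleR) auto
      ultimately show False
        using reducible_if_product [OF hom _ ab(2)] irr by blast
    qed
  next
    obtain P Q where PQ: "P \<in> zero_set p" "Q \<in> zero_set p" "P \<noteq> Q"
      using assms by (auto simp: admissible_conic_def)
    then obtain v w where "representative v P" "eval3 p v = 0" "representative w Q" "eval3 p w = 0"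
      by (auto simp: zero_set_def)
    then show "\<exists>v w. cross3 v w \<noteq> 0 \<and> q v = 0 \<and> q w = 0"
      using representative_eqI PQ(3) by (metis q_polar [OF hom])
  qed
qed

lemma points_polar:
  assumes "admissible_conic p"
  shows "rational_conic.points (polar p) = zero_set p"
proof -
  have hom: "homogeneous3 2 p"
    using assms by (simp add: admissible_conic_def)
  interpret rational_conic "polar p"
    by (rule rational_conic_polar [OF assms])
  have "P \<in> points \<longleftrightarrow> P \<in> zero_set p" if "P \<in> proj_plane" for P
    using representative_exists [OF that] points_iff zero_set_iff [OF hom] q_polar [OF hom] by metis
  then show ?thesis
    by (auto simp: points_def zero_set_def)
qed

lemma rat_indep_coords_iff_rvec:
  assumes "representative v P"
  shows "rat_indep_coords P \<longleftrightarrow> (\<forall>a. rvec a \<longrightarrow> a \<bullet> v = 0 \<longrightarrow> a = 0)"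
proof -
  have eq: "(\<Sum>i\<in>UNIV. of_rat (a $ i) * v $ i) = (\<chi> i. of_rat (a $ i)) \<bullet> v" for a :: "rat^3"
    by (simp add: inner_vec_def)
  have zero: "(\<chi> i. real_of_rat (a $ i)) = 0 \<longleftrightarrow> a = 0" for a :: "rat^3"
    by (simp add: vec_eq_iff)
  have rv: "rvec (\<chi> i. of_rat (a $ i))" for a :: "rat^3"
    by (simp add: rvec_def)
  have "\<exists>b :: rat^3. a = (\<chi> i. of_rat (b $ i))" if a: "rvec a" for a
  proof -
    obtain a' :: "3 \<Rightarrow> rat" where "\<And>i. a $ i = of_rat (a' i)"
      using rat_of_real_vector [OF a] by blast
    then show ?thesis
      by (intro exI [of _ "\<chi> i. a' i"]) (simp add: vec_eq_iff)
  qed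
  then show ?thesis
    unfolding rat_indep_coords_iff [OF assms] eq using zero rv by metis
qed

lemma approx_exponent_mono:
  assumes "approx_exponent P l" "0 \<le> l'" "l' \<le> l"
  shows "approx_exponent P l'"
proof -
  obtain v c where v: "representative v P" "c > 0" "\<forall>\<^sub>F X in at_top. approx_solvable v l c X"
    using assms(1) by (auto simp: approx_exponent_def)
  have "\<forall>\<^sub>F X in at_top. approx_solvable v l c X \<and> X \<ge> 1"
    using v(3) eventually_ge_at_top by (rule eventually_conj)
  then have "\<forall>\<^sub>F X in at_top. approx_solvable v l' c X"
  proof (rule eventually_mono)
    fix X :: real assume X: "approx_solvable v l c X \<and> X \<ge> 1"
    then have "c * X powr (- l) \<le> c * X powr (- l')"
      using v(2) assms(3) by (intro mult_left_mono powr_mono) auto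
    then show "approx_solvable v l' c X"
      using X unfolding approx_solvable_def by (meson order_trans)
  qed
  then show ?thesis
    using v assms(2) unfolding approx_exponent_def by blast
qed

theorem theorem2p3:
  shows "(\<forall>\<phi> :: qpoly3. admissible_conic \<phi> \<longrightarrow>
      (\<forall>\<Xi>\<in>zero_set \<phi>. rat_indep_coords \<Xi> \<longrightarrow> approx_exponent \<Xi> (1 / golden) \<longrightarrow>
          strict_approx_exponent \<Xi> (1 / golden)) \<and>
      infinite {\<Xi> \<in> zero_set \<phi>. rat_indep_coords \<Xi> \<and> approx_exponent \<Xi> (1 / golden)}) \<and>
    (\<exists>\<epsilon>>0. \<forall>\<phi> :: qpoly3. admissible_conic \<phi> \<longrightarrow>
      countable {\<Xi> \<in> zero_set \<phi>. approx_lambda \<Xi> > ereal (1 / golden - \<epsilon>)})"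
proof (intro conjI allI impI ballI)
  fix \<phi> \<Xi>
  assume \<phi>: "admissible_conic \<phi>" and \<Xi>: "\<Xi> \<in> zero_set \<phi>" "rat_indep_coords \<Xi>" "approx_exponent \<Xi> (1 / golden)"
  interpret rational_conic "polar \<phi>"
    by (rule rational_conic_polar [OF \<phi>])
  obtain v where v: "representative v \<Xi>"
    using \<Xi>(1) by (auto simp: zero_set_def)
  then show "strict_approx_exponent \<Xi> (1 / golden)"
    using golden_exponent_strict [OF _ v _ \<Xi>(3)] \<Xi>(1,2) points_polar [OF \<phi>] rat_indep_coords_iff_rvec [OF v]
    by blast
next
  fix \<phi> assume \<phi>: "admissible_conic \<phi>"
  interpret rational_conic "polar \<phi>"
    by (rule rational_conic_polar [OF \<phi>])
  have "0 \<le> 1 / golden"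
    by (simp add: golden_def)
  then have "{P \<in> points. \<exists>v. representative v P \<and> golden_vector v}
      \<subseteq> {\<Xi> \<in> zero_set \<phi>. rat_indep_coords \<Xi> \<and> approx_exponent \<Xi> (1 / golden)}"
    using rat_indep_coords_iff_rvec approx_exponent_iff
    unfolding golden_vector_def points_polar [OF \<phi>] by blast
  then show "infinite {\<Xi> \<in> zero_set \<phi>. rat_indep_coords \<Xi> \<and> approx_exponent \<Xi> (1 / golden)}"
    using infinite_golden_points finite_subset by blast
next
  \<comment> \<open>Positive since \<open>1 / golden\<close> is 0.61803..., and free of \<phi>;
    \<open>618 / 1000\<close> is the exponent in \<open>countable_well_approximable\<close>.\<close>
  define \<epsilon> where "\<epsilon> = 1 / golden - 618 / 1000"
  have "2236 / 1000 < sqrt 5"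
    by (rule real_less_rsqrt) (simp add: power2_eq_square)
  moreover have "golden * ((sqrt 5 - 1) / 2) = 1"
    by (simp add: golden_def field_simps)
  then have "1 / golden = (sqrt 5 - 1) / 2"
    by (auto simp: divide_eq_eq mult.commute)
  ultimately have "\<epsilon> > 0"
    by (simp add: \<epsilon>_def)
  moreover have "countable {\<Xi> \<in> zero_set \<phi>. approx_lambda \<Xi> > ereal (1 / golden - \<epsilon>)}"
    if \<phi>: "admissible_conic \<phi>" for \<phi>
  proof -
    interpret rational_conic "polar \<phi>"
      by (rule rational_conic_polar [OF \<phi>])
    have "approx_exponent \<Xi> (618 / 1000)" if \<Xi>: "approx_lambda \<Xi> > ereal (1 / golden - \<epsilon>)" for \<Xi>
    proof -
      obtain l where "approx_exponent \<Xi> l" "ereal (618 / 1000) < ereal l"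
        using \<Xi> unfolding approx_lambda_def less_SUP_iff \<epsilon>_def by auto
      then show ?thesis
        using approx_exponent_mono [of \<Xi> l "618 / 1000"] by simp
    qed
    then have "{\<Xi> \<in> zero_set \<phi>. approx_lambda \<Xi> > ereal (1 / golden - \<epsilon>)}
        \<subseteq> {P \<in> points. approx_exponent P (618 / 1000)}"
      unfolding points_polar [OF \<phi>] by blast
    then show ?thesis
      using countable_well_approximable countable_subset by blast
  qed
  ultimately show "\<exists>\<epsilon>>0. \<forall>\<phi> :: qpoly3. admissible_conic \<phi> \<longrightarrow>
      countable {\<Xi> \<in> zero_set \<phi>. approx_lambda \<Xi> > ereal (1 / golden - \<epsilon>)}"
    by blast
qed

end
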